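(* Let $(\mathcal V,\mathcal E)$ be a finite connected directed graph with at least one boundary vertex ($\mathcal V_\partial\neq\emptyset$), with edge lengths $0<l^e<\infty$ for $e\in\mathcal E$, and let $a,b,c\in L^2(\mathcal E)$ satisfy $C_0\le a,b,c\le C_1$ a.e. on $\mathcal E$ for some constants $C_0,C_1>0$. Then there exist constants $C,\gamma>0$ such that the following holds for all time-independent $\bar f,\bar g\in L^2(\mathcal E)$. Let $(u,p)\in C^1([0,\infty);L^2(\mathcal E)\times L^2(\mathcal E))\cap C([0,\infty);H(\mathrm{div})\times H^1_0)$ be a (classical) solution of $$c\,\partial_t u+\partial_x' p+a u=\bar f,\qquad b\,\partial_t p+\partial_x' u=\bar g\qquad\text{on }\mathcal E,\ t>0,$$ and let $(\bar u,\bar p)\in H(\mathrm{div})\times H^1_0$ be the unique solution of the stationary problem $$\partial_x'\bar p+a\bar u=\bar f,\qquad \partial_x'\bar u=\bar g\qquad\text{on }\mathcal E.$$ Then for all $t\ge s\ge 0$ $$\|u(t)-\bar u\|_{L^2}^2+\|p(t)-\bar p\|_{L^2}^2\le C e^{-\gamma(t-s)}\big(\|u(s)-\bar u\|_{L^2}^2+\|p(s)-\bar p\|_{L^2}^2\big),$$ and moreover $$\|\partial_t u(t)\|_{L^2}^2+\|\partial_t p(t)\|_{L^2}^2\le C e^{-\gamma(t-s)}\big(\|\partial_t u(s)\|_{L^2}^2+\|\partial_t p(s)\|_{L^2}^2\big).$$ The constants $C,\gamma$ are independent of $u$ and $p$.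
   Context: Network notation: $\mathcal E\subset\mathcal V\times\mathcal V$, the two end vertices of each edge being distinct; connectedness ignores edge orientation. $\mathcal E(v)$ is the set of edges having $v$ as an end vertex; $\mathcal V_0=\{v:|\mathcal E(v)|\ge2\}$ are the interior vertices and $\mathcal V_\partial=\mathcal V\setminus\mathcal V_0$ the boundary vertices. For $e\in\mathcal E$: $n^e(v)=-1$ if $e=(v,\cdot)$, $n^e(v)=1$ if $e=(\cdot,v)$, and $n^e(v)=0$ otherwise. Each edge $e=(v_l,v_r)$ is identified with the interval $[0,l^e]$, $v_l$ with $0$ and $v_r$ with $l^e$; for a function $w$ on the network, $w^e=w|_e$ and $w^e(v)$ is the value (trace) of $w^e$ at the endpoint corresponding to $v$. Function spaces: $L^2=L^2(\mathcal E)=\{w: w^e\in L^2(e)\ \forall e\}$ with $(w,z)_{\mathcal E}=\sum_e(w^e,z^e)_{L^2(e)}$ and norm $\|\cdot\|_{L^2}$; $H^1(\mathcal E)=\{w: w^e\in H^1(e)\ \forall e\}$; $\partial_x' w$ is the edgewise derivative, $(\partial_x' w)|_e=\partial_x w^e$. $H^1_0=\{p\in H^1(\mathcal E): p^e(v)=p^{e'}(v)\ \forall e,e'\in\mathcal E(v),v\in\mathcal V_0;\ p^e(v)=0\ \forall v\in\mathcal V_\partial, e\in\mathcal E(v)\}$. $H(\mathrm{div})=\{u\in H^1(\mathcal E):\sum_{e\in\mathcal E(v)}n^e(v)u^e(v)=0\ \forall v\in\mathcal V_0\}$. Both carry the norm $(\|w\|_{L^2}^2+\|\partial_x' w\|_{L^2}^2)^{1/2}$.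 *)

theory Defs
  imports "HOL-Analysis.Analysis"
begin

text \<open>
  A function on the network assigns to every edge \<open>e\<close> a function on \<open>{0..l e}\<close>.
  Elements of \<open>L\<^sup>2\<close> are represented by functions, identified when they agree almost everywhere on
  every edge; values outside the edges are irrelevant. All notions below respect this
  identification.
\<close>

type_synonym 'v netfun = "'v \<times> 'v \<Rightarrow> real \<Rightarrow> real"


subsection \<open>Networks\<close>

locale network =
  fixes V :: "'v set" and E :: "('v \<times> 'v) set" and l :: "'v \<times> 'v \<Rightarrow> real"
  assumes finite_vertices: "finite V"
    and edges_subset: "E \<subseteq> V \<times> V"
    and distinct_ends: "(v, w) \<in> E \<Longrightarrow> v \<noteq> w"
    and connected_undirected: "v \<in> V \<Longrightarrow> w \<in> V \<Longrightarrow> (v, w) \<in> (E \<union> E\<inverse>)\<^sup>*"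
    and length_pos: "e \<in> E \<Longrightarrow> 0 < l e"

definition incident :: "('v \<times> 'v) set \<Rightarrow> 'v \<Rightarrow> ('v \<times> 'v) set" where
  "incident E v = {e \<in> E. fst e = v \<or> snd e = v}"

definition interior_vertices :: "'v set \<Rightarrow> ('v \<times> 'v) set \<Rightarrow> 'v set" where
  "interior_vertices V E = {v \<in> V. card (incident E v) \<ge> 2}"

definition boundary_vertices :: "'v set \<Rightarrow> ('v \<times> 'v) set \<Rightarrow> 'v set" where
  "boundary_vertices V E = V - interior_vertices V E"

definition edge_sign :: "'v \<times> 'v \<Rightarrow> 'v \<Rightarrow> real" where
  "edge_sign e v = (if v = fst e then - 1 else if v = snd e then 1 else 0)"


subsection \<open>\<open>L\<^sup>2\<close> and \<open>H\<^sup>1\<close> on an interval\<close>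

definition L2_interval :: "real \<Rightarrow> (real \<Rightarrow> real) set" where
  "L2_interval r = {w. w \<in> borel_measurable (lebesgue_on {0..r}) \<and>
                       integrable (lebesgue_on {0..r}) (\<lambda>x. (w x)\<^sup>2)}"

text \<open>Test functions in \<open>C\<^sub>c\<^sup>1(0,r)\<close>, given together with their derivative and extended by zero.\<close>

definition C1c_interval :: "real \<Rightarrow> (real \<Rightarrow> real) \<Rightarrow> (real \<Rightarrow> real) \<Rightarrow> bool" where
  "C1c_interval r \<phi> \<phi>' \<longleftrightarrow>
     (\<forall>x. (\<phi> has_real_derivative \<phi>' x) (at x)) \<and> continuous_on UNIV \<phi>' \<and>
     (\<exists>\<alpha> \<beta>. 0 < \<alpha> \<and> \<beta> < r \<and> (\<forall>x. \<phi> x \<noteq> 0 \<longrightarrow> \<alpha> \<le> x \<and> x \<le> \<beta>))"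

definition has_weak_derivative :: "real \<Rightarrow> (real \<Rightarrow> real) \<Rightarrow> (real \<Rightarrow> real) \<Rightarrow> bool" where
  "has_weak_derivative r w g \<longleftrightarrow>
     (\<forall>\<phi> \<phi>'. C1c_interval r \<phi> \<phi>' \<longrightarrow>
        (LINT x|lebesgue_on {0..r}. w x * \<phi>' x) = - (LINT x|lebesgue_on {0..r}. g x * \<phi> x))"

definition H1_interval :: "real \<Rightarrow> (real \<Rightarrow> real) set" where
  "H1_interval r = {w \<in> L2_interval r. \<exists>g \<in> L2_interval r. has_weak_derivative r w g}"

text \<open>
  The choices below are unique for \<open>w \<in> H1_interval r\<close> and \<open>r > 0\<close>: the weak derivative almost
  everywhere, the continuous representative on all of \<open>{0..r}\<close>.
\<close>

definition weak_derivative :: "real \<Rightarrow> (real \<Rightarrow> real) \<Rightarrow> real \<Rightarrow> real" where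
  "weak_derivative r w = (SOME g. g \<in> L2_interval r \<and> has_weak_derivative r w g)"

definition continuous_representative :: "real \<Rightarrow> (real \<Rightarrow> real) \<Rightarrow> real \<Rightarrow> real" where
  "continuous_representative r w =
     (SOME h. continuous_on {0..r} h \<and> (AE x in lebesgue_on {0..r}. w x = h x))"


subsection \<open>Function spaces on a network\<close>

definition L2_net :: "('v \<times> 'v) set \<Rightarrow> ('v \<times> 'v \<Rightarrow> real) \<Rightarrow> 'v netfun set" where
  "L2_net E l = {w. \<forall>e\<in>E. w e \<in> L2_interval (l e)}"

definition inner_net :: "('v \<times> 'v) set \<Rightarrow> ('v \<times> 'v \<Rightarrow> real) \<Rightarrow> 'v netfun \<Rightarrow> 'v netfun \<Rightarrow> real" where
  "inner_net E l w z = (\<Sum>e\<in>E. LINT x|lebesgue_on {0..l e}. w e x * z e x)"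

definition L2_norm :: "('v \<times> 'v) set \<Rightarrow> ('v \<times> 'v \<Rightarrow> real) \<Rightarrow> 'v netfun \<Rightarrow> real" where
  "L2_norm E l w = sqrt (inner_net E l w w)"

definition AE_net :: "('v \<times> 'v) set \<Rightarrow> ('v \<times> 'v \<Rightarrow> real) \<Rightarrow> ('v \<times> 'v \<Rightarrow> real \<Rightarrow> bool) \<Rightarrow> bool" where
  "AE_net E l P \<longleftrightarrow> (\<forall>e\<in>E. AE x in lebesgue_on {0..l e}. P e x)"

definition H1_net :: "('v \<times> 'v) set \<Rightarrow> ('v \<times> 'v \<Rightarrow> real) \<Rightarrow> 'v netfun set" where
  "H1_net E l = {w. \<forall>e\<in>E. w e \<in> H1_interval (l e)}"

definition dx :: "('v \<times> 'v \<Rightarrow> real) \<Rightarrow> 'v netfun \<Rightarrow> 'v netfun" where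
  "dx l w = (\<lambda>e. weak_derivative (l e) (w e))"

definition H1_norm :: "('v \<times> 'v) set \<Rightarrow> ('v \<times> 'v \<Rightarrow> real) \<Rightarrow> 'v netfun \<Rightarrow> real" where
  "H1_norm E l w = sqrt ((L2_norm E l w)\<^sup>2 + (L2_norm E l (dx l w))\<^sup>2)"

text \<open>Meaningful for \<open>w \<in> H1_net E l\<close>, \<open>e \<in> E\<close> and \<open>v\<close> an end vertex of \<open>e\<close>.\<close>

definition trace_at :: "('v \<times> 'v \<Rightarrow> real) \<Rightarrow> 'v netfun \<Rightarrow> 'v \<times> 'v \<Rightarrow> 'v \<Rightarrow> real" where
  "trace_at l w e v =
     continuous_representative (l e) (w e) (if v = fst e then 0 else l e)"

definition H1_0 :: "'v set \<Rightarrow> ('v \<times> 'v) set \<Rightarrow> ('v \<times> 'v \<Rightarrow> real) \<Rightarrow> 'v netfun set" where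
  "H1_0 V E l = {p \<in> H1_net E l.
     (\<forall>v \<in> interior_vertices V E. \<forall>e \<in> incident E v. \<forall>e' \<in> incident E v.
        trace_at l p e v = trace_at l p e' v) \<and>
     (\<forall>v \<in> boundary_vertices V E. \<forall>e \<in> incident E v. trace_at l p e v = 0)}"

definition H_div :: "'v set \<Rightarrow> ('v \<times> 'v) set \<Rightarrow> ('v \<times> 'v \<Rightarrow> real) \<Rightarrow> 'v netfun set" where
  "H_div V E l = {u \<in> H1_net E l.
     \<forall>v \<in> interior_vertices V E. (\<Sum>e\<in>incident E v. edge_sign e v * trace_at l u e v) = 0}"


subsection \<open>Functions of time with values in a function space\<close>

text \<open>\<open>C([0,\<infinity>);X)\<close> for a space \<open>X\<close> of network functions with norm \<open>N\<close>\<close>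

definition time_continuous ::
  "'v netfun set \<Rightarrow> ('v netfun \<Rightarrow> real) \<Rightarrow> (real \<Rightarrow> 'v netfun) \<Rightarrow> bool" where
  "time_continuous X N w \<longleftrightarrow>
     (\<forall>t\<ge>0. w t \<in> X \<and> ((\<lambda>s. N (\<lambda>e x. w s e x - w t e x)) \<longlongrightarrow> 0) (at t within {0..}))"

text \<open>\<open>w\<close> belongs to \<open>C\<^sup>1([0,\<infinity>);X)\<close> and has time derivative \<open>w'\<close> (one-sided at time \<open>0\<close>).\<close>

definition time_C1 ::
  "'v netfun set \<Rightarrow> ('v netfun \<Rightarrow> real) \<Rightarrow> (real \<Rightarrow> 'v netfun) \<Rightarrow> (real \<Rightarrow> 'v netfun) \<Rightarrow> bool" where
  "time_C1 X N w w' \<longleftrightarrow>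
     (\<forall>t\<ge>0. w t \<in> X) \<and> time_continuous X N w' \<and>
     (\<forall>t\<ge>0. ((\<lambda>s. N (\<lambda>e x. (w s e x - w t e x) / (s - t) - w' t e x)) \<longlongrightarrow> 0)
               (at t within {0..}))"


subsection \<open>The damped wave system\<close>

text \<open>\<open>u'\<close> and \<open>p'\<close> are the time derivatives of \<open>u\<close> and \<open>p\<close>.\<close>

definition classical_solution ::
  "'v set \<Rightarrow> ('v \<times> 'v) set \<Rightarrow> ('v \<times> 'v \<Rightarrow> real) \<Rightarrow> 'v netfun \<Rightarrow> 'v netfun \<Rightarrow> 'v netfun \<Rightarrow>
   'v netfun \<Rightarrow> 'v netfun \<Rightarrow> (real \<Rightarrow> 'v netfun) \<Rightarrow> (real \<Rightarrow> 'v netfun) \<Rightarrow>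
   (real \<Rightarrow> 'v netfun) \<Rightarrow> (real \<Rightarrow> 'v netfun) \<Rightarrow> bool" where
  "classical_solution V E l a b c f g u u' p p' \<longleftrightarrow>
     time_C1 (L2_net E l) (L2_norm E l) u u' \<and> time_C1 (L2_net E l) (L2_norm E l) p p' \<and>
     time_continuous (H_div V E l) (H1_norm E l) u \<and>
     time_continuous (H1_0 V E l) (H1_norm E l) p \<and>
     (\<forall>t>0. AE_net E l (\<lambda>e x. c e x * u' t e x + dx l (p t) e x + a e x * u t e x = f e x) \<and>
            AE_net E l (\<lambda>e x. b e x * p' t e x + dx l (u t) e x = g e x))"

definition stationary_solution ::
  "'v set \<Rightarrow> ('v \<times> 'v) set \<Rightarrow> ('v \<times> 'v \<Rightarrow> real) \<Rightarrow> 'v netfun \<Rightarrow>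
   'v netfun \<Rightarrow> 'v netfun \<Rightarrow> 'v netfun \<Rightarrow> 'v netfun \<Rightarrow> bool" where
  "stationary_solution V E l a f g u p \<longleftrightarrow>
     u \<in> H_div V E l \<and> p \<in> H1_0 V E l \<and>
     AE_net E l (\<lambda>e x. dx l p e x + a e x * u e x = f e x) \<and>
     AE_net E l (\<lambda>e x. dx l u e x = g e x)"

end

theory Submission
  imports Defs
begin

text \<open>
  Subtracting the stationary solution reduces the claim to \<open>f = g = 0\<close>. The energy
  \<open>((c u, u) + (b p, p)) / 2\<close> then has derivative \<open>- (a u, u)\<close>, which does not control \<open>p\<close>. It is
  corrected by \<open>- \<epsilon> (c u, v)\<close>, where \<open>v \<in> H(div)\<close> is the flux of the stationary problem with data
  \<open>0\<close> and \<open>b p\<close>; for small \<open>\<epsilon>\<close> this is equivalent to the energy and decays by Gronwall's lemma. The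
  bound of \<open>v\<close> by \<open>p\<close> is Poincare's inequality on \<open>H\<^sup>1\<^sub>0\<close>, obtained by following a path from the boundary.
\<close>

definition primitive :: "(real \<Rightarrow> real) \<Rightarrow> real \<Rightarrow> real" where
  "primitive g x = (LINT y|lebesgue_on {0..x}. g y)"

lemma finite_measure_interval: "finite_measure (lebesgue_on {a..b::real})"
  by (rule finite_measure_lebesgue_on) simp

lemma integrable_const_interval: "integrable (lebesgue_on {a..b::real}) (\<lambda>x. c::real)"
  by (rule finite_measure.integrable_const[OF finite_measure_interval])

lemma borel_measurable_lebesgue_on_continuous:
  fixes h :: "real \<Rightarrow> real"
  assumes "continuous_on {a..b} h"
  shows "h \<in> borel_measurable (lebesgue_on {a..b})"
  using assms by (intro continuous_imp_measurable_on_sets_lebesgue) auto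

lemma integrable_continuous_mult:
  fixes f h :: "real \<Rightarrow> real"
  assumes "integrable (lebesgue_on {a..b}) f" and h: "continuous_on {a..b} h"
  shows "integrable (lebesgue_on {a..b}) (\<lambda>x. f x * h x)"
proof -
  obtain B where B: "\<And>x. x \<in> {a..b} \<Longrightarrow> norm (h x) \<le> B"
    using compact_imp_bounded[OF compact_continuous_image[OF h]] unfolding bounded_iff by blast
  show ?thesis
  proof (rule Bochner_Integration.integrable_bound)
    show "integrable (lebesgue_on {a..b}) (\<lambda>x. B * f x)"
      using assms by simp
    show "(\<lambda>x. f x * h x) \<in> borel_measurable (lebesgue_on {a..b})"
      using assms borel_measurable_lebesgue_on_continuous[OF h] by measurable
    show "AE x in lebesgue_on {a..b}. norm (f x * h x) \<le> norm (B * f x)"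
    proof (rule AE_I2)
      fix x assume "x \<in> space (lebesgue_on {a..b})"
      then have "\<bar>h x\<bar> \<le> \<bar>B\<bar>" using B[of x] by auto
      then show "norm (f x * h x) \<le> norm (B * f x)"
        by (simp add: abs_mult mult.commute[of _ "\<bar>f x\<bar>"] mult_left_mono)
    qed
  qed
qed

subsection \<open>\<open>L\<^sup>2\<close> on an interval\<close>

lemma L2_measurable: "w \<in> L2_interval r \<Longrightarrow> w \<in> borel_measurable (lebesgue_on {0..r})"
  by (simp add: L2_interval_def)

lemma L2_mult:
  assumes "w \<in> L2_interval r" "z \<in> L2_interval r"
  shows "integrable (lebesgue_on {0..r}) (\<lambda>x. w x * z x)"
proof (rule Bochner_Integration.integrable_bound)
  show "integrable (lebesgue_on {0..r}) (\<lambda>x. (w x)\<^sup>2 + (z x)\<^sup>2)"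
    using assms unfolding L2_interval_def by simp
  show "(\<lambda>x. w x * z x) \<in> borel_measurable (lebesgue_on {0..r})"
    using assms[THEN L2_measurable] by measurable
  have "\<bar>w x * z x\<bar> \<le> (w x)\<^sup>2 + (z x)\<^sup>2" for x
  proof -
    have "2 * (\<bar>w x\<bar> * \<bar>z x\<bar>) \<le> \<bar>w x\<bar>\<^sup>2 + \<bar>z x\<bar>\<^sup>2"
      using sum_squares_bound[of "\<bar>w x\<bar>" "\<bar>z x\<bar>"] by simp
    moreover have "0 \<le> \<bar>w x\<bar> * \<bar>z x\<bar>" by simp
    ultimately show ?thesis unfolding abs_mult power2_abs by linarith
  qed
  then show "AE x in lebesgue_on {0..r}. norm (w x * z x) \<le> norm ((w x)\<^sup>2 + (z x)\<^sup>2)"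
    by (intro AE_I2) (simp add: order_trans[OF _ abs_ge_self])
qed

lemma L2_const: "(\<lambda>x. c) \<in> L2_interval r"
  by (simp add: L2_interval_def integrable_const_interval)

lemma L2_integrable: "w \<in> L2_interval r \<Longrightarrow> integrable (lebesgue_on {0..r}) w"
  using L2_mult[of w r "\<lambda>x. 1"] by (simp add: L2_const)

lemma L2_cmult:
  assumes "w \<in> L2_interval r"
  shows "(\<lambda>x. k * w x) \<in> L2_interval r"
  using assms L2_measurable[OF assms] by (simp add: L2_interval_def power_mult_distrib)

lemma L2_add:
  assumes "w \<in> L2_interval r" "z \<in> L2_interval r"
  shows "(\<lambda>x. w x + z x) \<in> L2_interval r"
proof -
  have "(\<lambda>x. (w x + z x)\<^sup>2) = (\<lambda>x. w x * w x + (2 * (w x * z x) + z x * z x))"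
    by (simp add: power2_eq_square algebra_simps fun_eq_iff)
  then show ?thesis
    using assms L2_mult[of w r z] L2_mult[of w r w] L2_mult[of z r z]
    by (auto simp: L2_interval_def)
qed

lemma L2_abs:
  assumes "w \<in> L2_interval r"
  shows "(\<lambda>x. \<bar>w x\<bar>) \<in> L2_interval r"
  using assms L2_measurable[OF assms] by (simp add: L2_interval_def)

lemma L2_cong_AE:
  assumes "w \<in> L2_interval r" "z \<in> borel_measurable (lebesgue_on {0..r})"
    and "AE x in lebesgue_on {0..r}. w x = z x"
  shows "z \<in> L2_interval r"
proof -
  have "integrable (lebesgue_on {0..r}) (\<lambda>x. (z x)\<^sup>2)"
  proof (rule integrable_cong_AE_imp)
    show "integrable (lebesgue_on {0..r}) (\<lambda>x. (w x)\<^sup>2)"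
      using assms(1) by (simp add: L2_interval_def)
    show "(\<lambda>x. (z x)\<^sup>2) \<in> borel_measurable (lebesgue_on {0..r})"
      using assms(2) by measurable
    show "AE x in lebesgue_on {0..r}. (w x)\<^sup>2 = (z x)\<^sup>2"
      using assms(3) by eventually_elim simp
  qed
  then show ?thesis using assms(2) by (simp add: L2_interval_def)
qed

lemma L2_bounded_mult:
  assumes "w \<in> L2_interval r" "m \<in> borel_measurable (lebesgue_on {0..r})"
    and "AE x in lebesgue_on {0..r}. \<bar>m x\<bar> \<le> K"
  shows "(\<lambda>x. m x * w x) \<in> L2_interval r"
proof -
  have "integrable (lebesgue_on {0..r}) (\<lambda>x. (m x * w x)\<^sup>2)"
  proof (rule Bochner_Integration.integrable_bound)
    show "integrable (lebesgue_on {0..r}) (\<lambda>x. K\<^sup>2 * (w x)\<^sup>2)"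
      using assms by (simp add: L2_interval_def)
    show "(\<lambda>x. (m x * w x)\<^sup>2) \<in> borel_measurable (lebesgue_on {0..r})"
      using L2_measurable[OF assms(1)] assms(2) by measurable
    show "AE x in lebesgue_on {0..r}. norm ((m x * w x)\<^sup>2) \<le> norm (K\<^sup>2 * (w x)\<^sup>2)"
      using assms(3)
    proof eventually_elim
      case (elim x)
      then have "(m x)\<^sup>2 \<le> K\<^sup>2" by (simp add: abs_le_square_iff[symmetric])
      then show ?case by (simp add: power_mult_distrib mult_right_mono)
    qed
  qed
  then show ?thesis using assms(1,2) L2_measurable[OF assms(1)] by (simp add: L2_interval_def)
qed

lemma L2_continuous:
  assumes "continuous_on {0..r} h"
  shows "h \<in> L2_interval r"
proof -
  have "integrable (lebesgue_on {0..r}) (\<lambda>x. (1 * h x) * h x)"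
    by (intro integrable_continuous_mult integrable_const_interval assms)
  then show ?thesis
    using borel_measurable_lebesgue_on_continuous[OF assms]
    by (simp add: L2_interval_def power2_eq_square)
qed

subsection \<open>Primitives\<close>

lemma primitive_0 [simp]: "primitive g 0 = 0"
  unfolding primitive_def
  by (rule integral_eq_zero_null_sets) auto

lemma primitive_continuous:
  "integrable (lebesgue_on {0..r}) g \<Longrightarrow> continuous_on {0..r} (primitive g)"
  unfolding primitive_def[abs_def] by (rule indefinite_integral_continuous_real)

text \<open>Puts the values of the primitive at all x on the one measure space over [0, r], the form
  in which Fubini's theorem applies in \<open>primitive_by_parts\<close>.\<close>

lemma primitive_indicator:
  assumes "x \<in> {0..r}"
  shows "primitive g x = (LINT y|lebesgue_on {0..r}. (if y \<le> x then g y else 0))"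
proof -
  have "primitive g x = (LINT y|lebesgue_on {0..r}. (if y \<in> {0..x} then g y else 0))"
    unfolding primitive_def by (rule integral_restrict[symmetric]) (use assms in auto)
  also have "\<dots> = (LINT y|lebesgue_on {0..r}. (if y \<le> x then g y else 0))"
    by (rule Bochner_Integration.integral_cong) auto
  finally show ?thesis .
qed

lemma primitive_diff_points:
  assumes "integrable (lebesgue_on {0..r}) g" "0 \<le> x" "x \<le> y" "y \<le> r"
  shows "primitive g y - primitive g x = (LINT t|lebesgue_on {x..y}. g t)"
proof -
  have "integrable (lebesgue_on {0..y}) g"
    by (rule integrable_subinterval[OF assms(1)]) (use assms in auto)
  from integral_combine[OF this, of x] show ?thesis
    using assms by (simp add: primitive_def)
qed

lemma primitive_add:
  assumes "integrable (lebesgue_on {0..r}) g" "integrable (lebesgue_on {0..r}) h" "x \<in> {0..r}"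
  shows "primitive (\<lambda>y. g y + k * h y) x = primitive g x + k * primitive h x"
proof -
  have "integrable (lebesgue_on {0..x}) g" "integrable (lebesgue_on {0..x}) h"
    by (rule integrable_subinterval[OF assms(1)] integrable_subinterval[OF assms(2)]; use assms(3) in auto)+
  then show ?thesis by (simp add: primitive_def)
qed

text \<open>The Lebesgue differentiation theorem recovers a function from its primitive.\<close>

lemma primitive_zero_imp_AE_zero:
  assumes g: "integrable (lebesgue_on {0..r}) g"
    and z: "\<And>x. x \<in> {0..r} \<Longrightarrow> primitive g x = 0"
  shows "AE x in lebesgue_on {0..r}. g x = 0"
proof -
  define f where "f x = (if x \<in> {0..r} then g x else 0)" for x
  have fL: "integrable lebesgue f"
    unfolding f_def using g Lebesgue_Measure.integrable_restrict_UNIV[of "{0..r}" g] by simp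
  then have "f integrable_on UNIV" by (rule integrable_on_lebesgue)
  then have f: "f integrable_on cbox a b" for a b
    by (rule integrable_on_subcbox) auto
  \<comment> \<open>Outside the null set \<open>N\<close> the averages of \<open>f\<close> over
    [x, x + h] converge to \<open>f x\<close> as h decreases to 0.\<close>
  obtain N where N: "negligible N"
    "\<And>x e. \<lbrakk>x \<notin> N; 0 < e\<rbrakk> \<Longrightarrow> \<exists>d>0. \<forall>h. 0 < h \<and> h < d \<longrightarrow>
        norm (integral (cbox x (x + h *\<^sub>R One)) f /\<^sub>R h ^ DIM(real) - f x) < e"
    using integrable_ccontinuous_explicit[of f, OF f] by blast
  have zero: "g x = 0" if "0 \<le> x" "x < r" "x \<notin> N" for x
  proof (rule ccontr)
    assume "g x \<noteq> 0"
    then obtain d where d: "d > 0" "\<And>h. 0 < h \<Longrightarrow> h < d \<Longrightarrow>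
        norm (integral (cbox x (x + h *\<^sub>R One)) f /\<^sub>R h ^ DIM(real) - f x) < \<bar>g x\<bar>"
      using N(2)[OF \<open>x \<notin> N\<close>, of "\<bar>g x\<bar>"] by auto
    \<comment> \<open>Keeps [x, x + h] inside [0, r], where \<open>f\<close> is \<open>g\<close> and
      the average is a difference quotient of the primitive, hence 0.\<close>
    define h where "h = min (d/2) (r - x)"
    have h: "0 < h" "h < d" "x + h \<le> r" using d(1) that by (auto simp: h_def)
    have "integral {x..x+h} f = integral {x..x+h} g"
      by (rule integral_cong) (use h that in \<open>auto simp: f_def\<close>)
    also have "\<dots> = (LINT t|lebesgue_on {x..x+h}. g t)"
      by (rule lebesgue_integral_eq_integral[symmetric])
         (use h that in \<open>auto intro: integrable_subinterval[OF g]\<close>)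
    also have "\<dots> = 0"
      using primitive_diff_points[OF g, of x "x+h"] z[of x] z[of "x+h"] h that by simp
    finally have "integral (cbox x (x + h *\<^sub>R One)) f = 0" by simp
    with d(2)[OF h(1,2)] that show False by (simp add: f_def)
  qed
  \<comment> \<open>The end point r has no right neighbourhood inside the interval and joins the
    exceptional set.\<close>
  have "AE x in lebesgue. x \<notin> insert r N"
    using N(1) by (intro AE_not_in) (simp add: negligible_iff_null_sets[symmetric])
  then have "AE x in lebesgue. x \<in> {0..r} \<longrightarrow> g x = 0"
    by eventually_elim (use zero in force)
  then show ?thesis by (subst AE_restrict_space_iff) auto
qed

text \<open>The right-hand side is the integral of f(x) g(y) over the square. Cutting along the
  diagonal, the part y \<le> x gives the first term and the part x < y the second, so Fubini's
  theorem does the work of the product rule.\<close>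

lemma primitive_by_parts:
  assumes r: "0 \<le> r" and f: "integrable (lebesgue_on {0..r}) f" and g: "integrable (lebesgue_on {0..r}) g"
  shows "(LINT x|lebesgue_on {0..r}. f x * primitive g x) + (LINT x|lebesgue_on {0..r}. primitive f x * g x)
       = primitive f r * primitive g r"
proof -
  define M where "M = lebesgue_on {0..r}"
  interpret finite_measure M unfolding M_def by (rule finite_measure_interval)
  interpret P: pair_sigma_finite M M ..
  have fM: "integrable M f" and gM: "integrable M g" using f g by (simp_all add: M_def)
  then have [measurable]: "f \<in> borel_measurable M" "g \<in> borel_measurable M" by auto
  have [measurable]: "(\<lambda>x. x) \<in> borel_measurable M"
    unfolding M_def by (intro borel_measurable_lebesgue_on_continuous continuous_intros)
  have sp: "space M = {0..r}" by (simp add: M_def)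
  have split: "(\<lambda>y. f x * g y) = (\<lambda>y. f x * (if y \<le> x then g y else 0) + f x * (if y \<le> x then 0 else g y))" for x
    by auto
  have I: "integrable (M \<Otimes>\<^sub>M M) (\<lambda>(x,y). f x * g y)"
    by (rule P.Fubini_integrable) (use fM gM in \<open>auto simp: abs_mult\<close>)
  have I1: "integrable (M \<Otimes>\<^sub>M M) (\<lambda>(x,y). f x * (if y \<le> x then g y else 0))"
    by (rule Bochner_Integration.integrable_bound[OF I]) auto
  have I2: "integrable (M \<Otimes>\<^sub>M M) (\<lambda>(x,y). (if x < y then f x else 0) * g y)"
    by (rule Bochner_Integration.integrable_bound[OF I]) auto
  have "primitive f r * primitive g r = (LINT x|M. LINT y|M. f x * g y)"
    by (simp add: primitive_def M_def)
  also have "\<dots> = integral\<^sup>L (M \<Otimes>\<^sub>M M) (\<lambda>(x,y). f x * g y)"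
    using P.integral_fst'[OF I] by simp
  also have "\<dots> = integral\<^sup>L (M \<Otimes>\<^sub>M M) (\<lambda>z. (\<lambda>(x,y). f x * (if y \<le> x then g y else 0)) z
      + (\<lambda>(x,y). (if x < y then f x else 0) * g y) z)"
    by (rule Bochner_Integration.integral_cong) auto
  also have "\<dots> = integral\<^sup>L (M \<Otimes>\<^sub>M M) (\<lambda>(x,y). f x * (if y \<le> x then g y else 0))
     + integral\<^sup>L (M \<Otimes>\<^sub>M M) (\<lambda>(x,y). (if x < y then f x else 0) * g y)"
    by (rule Bochner_Integration.integral_add[OF I1 I2])
  also have "integral\<^sup>L (M \<Otimes>\<^sub>M M) (\<lambda>(x,y). f x * (if y \<le> x then g y else 0))
     = (LINT x|M. LINT y|M. f x * (if y \<le> x then g y else 0))"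
    using P.integral_fst'[OF I1] by simp
  also have "\<dots> = (LINT x|M. f x * primitive g x)"
    by (rule Bochner_Integration.integral_cong)
       (auto simp: primitive_indicator[of _ r] M_def)
  also have "integral\<^sup>L (M \<Otimes>\<^sub>M M) (\<lambda>(x,y). (if x < y then f x else 0) * g y)
     = (LINT y|M. LINT x|M. (if x < y then f x else 0) * g y)"
    using P.integral_snd[of "\<lambda>x y. (if x < y then f x else 0) * g y"] I2 by simp
  also have "\<dots> = (LINT y|M. primitive f y * g y)"
  proof (rule Bochner_Integration.integral_cong[OF refl])
    fix y assume "y \<in> space M"
    then have y: "y \<in> {0..r}" by (simp add: sp)
    \<comment> \<open>The strict cut x < y and the cut x \<le> y of
      \<open>primitive_indicator\<close> differ in a single point.\<close>
    have N: "AE x in M. x \<noteq> y"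
    proof -
      have "AE x in lebesgue. x \<notin> {y}" by (rule AE_not_in) auto
      then show ?thesis unfolding M_def by (subst AE_restrict_space_iff) (auto elim: eventually_mono)
    qed
    have "(LINT x|M. (if x < y then f x else 0)) = (LINT x|M. (if x \<le> y then f x else 0))"
      by (rule integral_cong_AE) (use N in \<open>auto elim: eventually_mono\<close>)
    then show "(LINT x|M. (if x < y then f x else 0) * g y) = primitive f y * g y"
      using primitive_indicator[OF y, of f] by (simp add: M_def)
  qed
  finally show ?thesis by (simp add: M_def)
qed

lemma primitive_abs_le:
  assumes g: "integrable (lebesgue_on {0..r}) g" and x: "x \<in> {0..r}"
  shows "\<bar>primitive g x\<bar> \<le> (LINT y|lebesgue_on {0..r}. \<bar>g y\<bar>)"
proof -
  have ga: "integrable (lebesgue_on {0..r}) (\<lambda>y. \<bar>g y\<bar>)" using g by simp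
  have "\<bar>primitive g x\<bar> \<le> primitive (\<lambda>y. \<bar>g y\<bar>) x"
    unfolding primitive_def by (rule integral_abs_bound)
  also have "\<dots> \<le> primitive (\<lambda>y. \<bar>g y\<bar>) r"
  proof -
    have "0 \<le> (LINT t|lebesgue_on {x..r}. \<bar>g t\<bar>)" by (rule Bochner_Integration.integral_nonneg) simp
    moreover have "primitive (\<lambda>y. \<bar>g y\<bar>) r - primitive (\<lambda>y. \<bar>g y\<bar>) x = (LINT t|lebesgue_on {x..r}. \<bar>g t\<bar>)"
      by (rule primitive_diff_points[OF ga]) (use x in auto)
    ultimately show ?thesis by linarith
  qed
  finally show ?thesis by (simp add: primitive_def)
qed

subsection \<open>Weak derivatives\<close>

lemma integral_deriv_eq_primitive:
  assumes "\<And>x. (\<phi> has_real_derivative \<phi>' x) (at x)" "continuous_on UNIV \<phi>'" "0 \<le> x"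
  shows "primitive \<phi>' x = \<phi> x - \<phi> 0"
proof -
  have "(\<phi>' has_integral \<phi> x - \<phi> 0) {0..x}"
    by (rule fundamental_theorem_of_calculus)
       (use assms in \<open>auto simp flip: has_real_derivative_iff_has_vector_derivative
          intro: has_field_derivative_at_within\<close>)
  moreover have "integrable (lebesgue_on {0..x}) \<phi>'"
    by (rule continuous_imp_integrable_real) (use assms(2) continuous_on_subset in blast)
  ultimately show ?thesis
    by (simp add: primitive_def lebesgue_integral_eq_integral integral_unique)
qed

lemma C1c_intervalD:
  assumes "C1c_interval r \<phi> \<phi>'" "0 < r"
  shows "x \<in> {0..r} \<Longrightarrow> \<phi> x = primitive \<phi>' x" "\<phi> r = 0"
    "continuous_on {0..r} \<phi>'"
proof -
  from assms(1) obtain \<alpha> \<beta> where D: "\<And>x. (\<phi> has_real_derivative \<phi>' x) (at x)"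
    and c: "continuous_on UNIV \<phi>'" and ab: "0 < \<alpha>" "\<beta> < r"
    and s: "\<And>x. \<phi> x \<noteq> 0 \<Longrightarrow> \<alpha> \<le> x \<and> x \<le> \<beta>"
    unfolding C1c_interval_def by blast
  have "\<phi> 0 = 0" using s[of 0] ab by fastforce
  then show "x \<in> {0..r} \<Longrightarrow> \<phi> x = primitive \<phi>' x"
    using integral_deriv_eq_primitive[OF D c] by auto
  show "\<phi> r = 0" using s[of r] ab by fastforce
  show "continuous_on {0..r} \<phi>'" using c continuous_on_subset by blast
qed

text \<open>Integration by parts for \<phi>' and g: the constant k contributes k \<phi>(r), the
  boundary term also has the factor \<phi>(r), and \<phi>(r) = 0.\<close>

lemma has_weak_derivative_primitive:
  assumes r: "0 < r" and g: "integrable (lebesgue_on {0..r}) g"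
    and w: "AE x in lebesgue_on {0..r}. w x = k + primitive g x"
    and m: "w \<in> borel_measurable (lebesgue_on {0..r})"
  shows "has_weak_derivative r w g"
  unfolding has_weak_derivative_def
proof (intro allI impI)
  fix \<phi> \<phi>' assume C: "C1c_interval r \<phi> \<phi>'"
  note CD = C1c_intervalD[OF C r]
  have i: "integrable (lebesgue_on {0..r}) \<phi>'"
    using CD(3) by (rule continuous_imp_integrable_real)
  have i2: "integrable (lebesgue_on {0..r}) (\<lambda>x. \<phi>' x * primitive g x)"
    by (rule integrable_continuous_mult[OF i primitive_continuous[OF g]])
  have [measurable]: "\<phi>' \<in> borel_measurable (lebesgue_on {0..r})"
    "primitive g \<in> borel_measurable (lebesgue_on {0..r})"
    by (intro borel_measurable_lebesgue_on_continuous CD primitive_continuous g)+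
  note [measurable] = m
  have "(LINT x|lebesgue_on {0..r}. w x * \<phi>' x)
      = (LINT x|lebesgue_on {0..r}. k * \<phi>' x + \<phi>' x * primitive g x)"
    by (rule integral_cong_AE) (use w in \<open>auto simp: algebra_simps elim: eventually_mono\<close>)
  also have "\<dots> = k * primitive \<phi>' r + (LINT x|lebesgue_on {0..r}. \<phi>' x * primitive g x)"
    using i i2 by (simp add: primitive_def)
  also have "\<dots> = - (LINT x|lebesgue_on {0..r}. primitive \<phi>' x * g x)"
    using primitive_by_parts[OF _ i g] CD(1)[of r] CD(2) r by simp
  also have "(LINT x|lebesgue_on {0..r}. primitive \<phi>' x * g x) = (LINT x|lebesgue_on {0..r}. g x * \<phi> x)"
    by (rule Bochner_Integration.integral_cong) (use CD(1) in auto)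
  finally show "(LINT x|lebesgue_on {0..r}. w x * \<phi>' x) = - (LINT x|lebesgue_on {0..r}. g x * \<phi> x)" .
qed

text \<open>An antiderivative of \<psi> is constant on either side of the support. Mean zero makes
  the two constants equal, so subtracting the value at 0 leaves a function that vanishes off
  [\<alpha>, \<beta>].\<close>

lemma C1c_interval_ex:
  assumes c: "continuous_on UNIV \<psi>" and ab: "0 < \<alpha>" "\<alpha> \<le> \<beta>" "\<beta> < r"
    and s: "\<And>x. \<psi> x \<noteq> 0 \<Longrightarrow> \<alpha> \<le> x \<and> x \<le> \<beta>" and z: "primitive \<psi> r = 0"
  shows "\<exists>\<phi>. C1c_interval r \<phi> \<psi>"
proof -
  have "\<exists>F. \<forall>x. (-\<infinity>::ereal) < ereal x \<longrightarrow> ereal x < \<infinity> \<longrightarrow> (F has_vector_derivative \<psi> x) (at x)"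
    using c by (intro einterval_antiderivative) (auto simp: continuous_on_eq_continuous_at)
  then obtain F where F: "\<And>x. (F has_real_derivative \<psi> x) (at x)"
    by (auto simp: has_real_derivative_iff_has_vector_derivative)
  have "\<exists>k. \<forall>x\<in>{..<\<alpha>}. F x = k"
  proof (rule has_field_derivative_zero_constant)
    fix x assume "x \<in> {..<\<alpha>}"
    then have "\<psi> x = 0" using s[of x] by fastforce
    then show "(F has_real_derivative 0) (at x within {..<\<alpha>})"
      using F[of x] by (simp add: has_field_derivative_at_within)
  qed (rule convex_real_interval)
  then have 1: "F x = F 0" if "x < \<alpha>" for x
    using that ab by (metis lessThan_iff)
  have "\<exists>k. \<forall>x\<in>{\<beta><..}. F x = k"
  proof (rule has_field_derivative_zero_constant)
    fix x assume "x \<in> {\<beta><..}"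
    then have "\<psi> x = 0" using s[of x] by fastforce
    then show "(F has_real_derivative 0) (at x within {\<beta><..})"
      using F[of x] by (simp add: has_field_derivative_at_within)
  qed (rule convex_real_interval)
  then have "F x = F r" if "x > \<beta>" for x
    using that ab by (metis greaterThan_iff)
  moreover have "F r = F 0"
    using integral_deriv_eq_primitive[OF F c, of r] ab z by simp
  ultimately have 2: "F x = F 0" if "x > \<beta>" for x
    using that by simp
  have D: "((\<lambda>x. F x - F 0) has_real_derivative \<psi> x) (at x)" for x
    using DERIV_diff[OF F[of x] DERIV_const[of "F 0"]] by simp
  have "\<alpha> \<le> x \<and> x \<le> \<beta>" if "F x - F 0 \<noteq> 0" for x
    using 1[of x] 2[of x] that by force
  then have "C1c_interval r (\<lambda>x. F x - F 0) \<psi>"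
    unfolding C1c_interval_def using D c ab by blast
  then show ?thesis by blast
qed

text \<open>A piecewise linear approximation of the indicator of [x, y]. Its ramps of slope n lie
  inside [x, y], so the support does not grow and stays away from 0 and r whenever x and y
  do.\<close>

definition trapezoid :: "nat \<Rightarrow> real \<Rightarrow> real \<Rightarrow> real \<Rightarrow> real" where
  "trapezoid n x y t = max 0 (min 1 (real n * min (t - x) (y - t)))"

lemma trapezoid_continuous: "continuous_on S (trapezoid n x y)"
  unfolding trapezoid_def[abs_def] by (intro continuous_intros)

lemma trapezoid_support: "trapezoid n x y t \<noteq> 0 \<Longrightarrow> x \<le> t \<and> t \<le> y"
proof (rule ccontr)
  assume a: "trapezoid n x y t \<noteq> 0" "\<not> (x \<le> t \<and> t \<le> y)"
  then have "real n * min (t - x) (y - t) \<le> 0"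
    by (intro mult_nonneg_nonpos) auto
  with a show False by (simp add: trapezoid_def)
qed

lemma trapezoid_LIMSEQ:
  assumes "t \<noteq> x" "t \<noteq> y"
  shows "(\<lambda>n. trapezoid n x y t) \<longlonglongrightarrow> (if t \<in> {x..y} then 1 else 0)"
proof (cases "t \<in> {x..y}")
  case True
  define d where "d = min (t - x) (y - t)"
  have d: "d > 0" using True assms by (auto simp: d_def)
  have "\<forall>\<^sub>F n in sequentially. trapezoid n x y t = 1"
    using eventually_ge_at_top[of "nat \<lceil>1 / d\<rceil>"]
  proof eventually_elim
    case (elim n)
    then have "1 / d \<le> real n" by linarith
    then have "1 \<le> real n * d" using d by (simp add: field_simps)
    then show ?case by (simp add: trapezoid_def d_def)
  qed
  then show ?thesis using True by (simp add: tendsto_eventually)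
next
  case False
  then have "trapezoid n x y t = 0" for n using trapezoid_support by force
  then show ?thesis by (subst if_not_P[OF False]) simp
qed

lemma trapezoid_integral_LIMSEQ:
  assumes z: "integrable (lebesgue_on {0..r}) z" and xy: "0 \<le> x" "x \<le> y" "y \<le> r"
  shows "(\<lambda>n. LINT t|lebesgue_on {0..r}. z t * trapezoid n x y t) \<longlonglongrightarrow> primitive z y - primitive z x"
proof -
  have "(\<lambda>n. LINT t|lebesgue_on {0..r}. z t * trapezoid n x y t) \<longlonglongrightarrow>
     (LINT t|lebesgue_on {0..r}. (if t \<in> {x..y} then z t else 0))"
  proof (rule integral_dominated_convergence[where w="\<lambda>t. \<bar>z t\<bar>"])
    have "{x..y} \<inter> space (lebesgue_on {0..r}) = {x..y}"
      using xy by auto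
    moreover have "{x..y} \<in> sets (lebesgue_on {0..r})"
      using xy by (subst sets_restrict_space_iff) auto
    ultimately have "{x..y} \<inter> space (lebesgue_on {0..r}) \<in> sets (lebesgue_on {0..r})"
      by metis
    then show "(\<lambda>t. if t \<in> {x..y} then z t else 0) \<in> borel_measurable (lebesgue_on {0..r})"
      by (rule measurable_If_set[rotated 2]) (use borel_measurable_integrable[OF z] in auto)
    show "(\<lambda>t. z t * trapezoid n x y t) \<in> borel_measurable (lebesgue_on {0..r})" for n
      using z borel_measurable_lebesgue_on_continuous[OF trapezoid_continuous[of _ n x y]] by measurable
    show "integrable (lebesgue_on {0..r}) (\<lambda>t. \<bar>z t\<bar>)" using z by simp
    show "AE t in lebesgue_on {0..r}. norm (z t * trapezoid n x y t) \<le> \<bar>z t\<bar>" for n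
      by (rule AE_I2) (simp add: trapezoid_def abs_mult mult_left_le)
    \<comment> \<open>At x and y themselves every trapezoid is 0 while the indicator is 1.\<close>
    have "AE t in lebesgue. t \<notin> {x,y}" by (rule AE_not_in) auto
    then have "AE t in lebesgue_on {0..r}. t \<notin> {x,y}"
      by (subst AE_restrict_space_iff) (auto elim: eventually_mono)
    then show "AE t in lebesgue_on {0..r}. (\<lambda>n. z t * trapezoid n x y t) \<longlonglongrightarrow> (if t \<in> {x..y} then z t else 0)"
    proof eventually_elim
      case (elim t)
      then have "(\<lambda>n. z t * trapezoid n x y t) \<longlonglongrightarrow> z t * (if t \<in> {x..y} then 1 else 0)"
        by (intro tendsto_intros trapezoid_LIMSEQ) auto
      then show ?case by (auto split: if_splits)
    qed
  qed
  also have "(LINT t|lebesgue_on {0..r}. (if t \<in> {x..y} then z t else 0)) = primitive z y - primitive z x"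
    using integral_restrict[of "{x..y}" "{0..r}" z] primitive_diff_points[OF z] xy by simp
  finally show ?thesis .
qed

lemma primitive_const: "0 \<le> x \<Longrightarrow> primitive (\<lambda>_. k) x = k * x"
  by (simp add: primitive_def measure_restrict_space)

text \<open>du Bois-Reymond: testing against derivatives means testing against continuous compactly
  supported functions of mean zero, and differences of normalised indicators of intervals are limits of these.\<close>

lemma weak_derivative_zero_imp_AE_const:
  assumes r: "0 < r" and z: "integrable (lebesgue_on {0..r}) z"
    and w: "\<And>\<phi> \<psi>. C1c_interval r \<phi> \<psi> \<Longrightarrow> (LINT x|lebesgue_on {0..r}. z x * \<psi> x) = 0"
  shows "\<exists>k. AE x in lebesgue_on {0..r}. z x = k"
proof -
  define J where "J x y = primitive z y - primitive z x" for x y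
  have eq: "J x1 y1 * (y2 - x2) = J x2 y2 * (y1 - x1)"
    if "0 < x1" "x1 \<le> y1" "y1 < r" "0 < x2" "x2 \<le> y2" "y2 < r" for x1 y1 x2 y2
  proof -
    let ?I = "\<lambda>f. LINT t|lebesgue_on {0..r}. f t"
    define m where "m n x y = ?I (\<lambda>t. trapezoid n x y t)" for n x y
    have i: "integrable (lebesgue_on {0..r}) (trapezoid n x y)" for n x y
      by (rule continuous_imp_integrable_real[OF trapezoid_continuous])
    have iz: "integrable (lebesgue_on {0..r}) (\<lambda>t. z t * trapezoid n x y t)" for n x y
      by (rule integrable_continuous_mult[OF z trapezoid_continuous])
    have zero: "m n x2 y2 * ?I (\<lambda>t. z t * trapezoid n x1 y1 t) - m n x1 y1 * ?I (\<lambda>t. z t * trapezoid n x2 y2 t) = 0" for n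
    proof -
      \<comment> \<open>Weighting each trapezoid by the integral of the other gives mean
        zero.\<close>
      define \<psi> where "\<psi> t = m n x2 y2 * trapezoid n x1 y1 t - m n x1 y1 * trapezoid n x2 y2 t" for t
      have "\<exists>\<phi>. C1c_interval r \<phi> \<psi>"
      proof (rule C1c_interval_ex[of _ "min x1 x2" "max y1 y2"])
        show "continuous_on UNIV \<psi>" unfolding \<psi>_def
          by (intro continuous_intros trapezoid_continuous)
        show "min x1 x2 \<le> t \<and> t \<le> max y1 y2" if "\<psi> t \<noteq> 0" for t
        proof -
          have "trapezoid n x1 y1 t \<noteq> 0 \<or> trapezoid n x2 y2 t \<noteq> 0" using that by (auto simp: \<psi>_def)
          then show ?thesis using trapezoid_support by fastforce
        qed
        show "primitive \<psi> r = 0"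
          unfolding primitive_def \<psi>_def using i by (simp add: m_def)
      qed (use that in auto)
      then obtain \<phi> where "C1c_interval r \<phi> \<psi>" by blast
      from w[OF this] have "?I (\<lambda>t. m n x2 y2 * (z t * trapezoid n x1 y1 t) - m n x1 y1 * (z t * trapezoid n x2 y2 t)) = 0"
        by (simp add: \<psi>_def algebra_simps)
      then show ?thesis using iz by simp
    qed
    have 1: "(\<lambda>n. m n x y) \<longlonglongrightarrow> y - x" if "0 \<le> x" "x \<le> y" "y \<le> r" for x y
      using trapezoid_integral_LIMSEQ[of r "\<lambda>_. 1" x y] that
      by (simp add: m_def primitive_const integrable_const_interval)
    have "(\<lambda>n. m n x2 y2 * ?I (\<lambda>t. z t * trapezoid n x1 y1 t) - m n x1 y1 * ?I (\<lambda>t. z t * trapezoid n x2 y2 t))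
       \<longlonglongrightarrow> (y2 - x2) * J x1 y1 - (y1 - x1) * J x2 y2"
      unfolding J_def by (intro tendsto_intros 1 trapezoid_integral_LIMSEQ z) (use that in auto)
    then have "(y2 - x2) * J x1 y1 - (y1 - x1) * J x2 y2 = 0"
      unfolding zero by (simp add: LIMSEQ_const_iff)
    then show ?thesis by (simp add: algebra_simps)
  qed
  \<comment> \<open>The mean of z over one fixed interval. By \<open>eq\<close> the primitive P of z
    - k is constant on (0, r), by continuity on [0, r], and it is 0 at 0.\<close>
  define k where "k = J (r/3) (r/2) / (r/2 - r/3)"
  define P where "P = primitive (\<lambda>y. z y + (- k) * 1)"
  have P: "P x = primitive z x - k * x" if "x \<in> {0..r}" for x
    unfolding P_def using that primitive_add[OF z integrable_const_interval, of x "-k" 1]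
    by (simp add: primitive_const)
  have zk: "integrable (lebesgue_on {0..r}) (\<lambda>y. z y + (- k) * 1)"
    using z integrable_const_interval by (intro Bochner_Integration.integrable_add) auto
  have cP: "continuous_on (closure {0<..<r}) P"
    unfolding P_def using primitive_continuous[OF zk] r by simp
  have mid: "P x = P (r/2)" if "x \<in> {0<..<r}" for x
  proof -
    have *: "P y = P x" if "0 < x" "x \<le> y" "y < r" for x y
    proof -
      have "J x y = k * (y - x)"
        using eq[of x y "r/3" "r/2"] that r by (simp add: k_def field_simps)
      then show ?thesis using P[of x] P[of y] that by (simp add: J_def algebra_simps)
    qed
    show ?thesis using *[of x "r/2"] *[of "r/2" x] that r by (cases "x \<le> r/2") auto
  qed
  have c: "P x = P (r/2)" if "x \<in> {0..r}" for x
    by (rule continuous_constant_on_closure[OF cP mid]) (use that r in auto)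
  have "P x = 0" if "x \<in> {0..r}" for x
    using c[OF that] c[of 0] r by (simp add: P_def)
  then have "AE x in lebesgue_on {0..r}. z x + (- k) * 1 = 0"
    unfolding P_def by (intro primitive_zero_imp_AE_zero zk)
  then show ?thesis by (intro exI[of _ k]) (auto elim: eventually_mono)
qed

subsection \<open>\<open>H\<^sup>1\<close> functions as primitives\<close>

text \<open>The fundamental theorem of calculus as a relation: g is the weak derivative and h the
  continuous representative of w. Since w meets h only almost everywhere, its measurability is
  recorded separately.\<close>

definition H1_rep :: "real \<Rightarrow> (real \<Rightarrow> real) \<Rightarrow> (real \<Rightarrow> real) \<Rightarrow> (real \<Rightarrow> real) \<Rightarrow> bool" where
  "H1_rep r w g h \<longleftrightarrow> w \<in> borel_measurable (lebesgue_on {0..r}) \<and> g \<in> L2_interval r \<and>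
     (\<forall>x\<in>{0..r}. h x = h 0 + primitive g x) \<and> (AE x in lebesgue_on {0..r}. w x = h x)"

lemma H1_repD:
  assumes "H1_rep r w g h"
  shows "w \<in> borel_measurable (lebesgue_on {0..r})" "g \<in> L2_interval r"
    "x \<in> {0..r} \<Longrightarrow> h x = h 0 + primitive g x" "AE x in lebesgue_on {0..r}. w x = h x"
  using assms unfolding H1_rep_def by blast+

lemma H1_rep_continuous:
  assumes "H1_rep r w g h"
  shows "continuous_on {0..r} h"
proof -
  have "continuous_on {0..r} (\<lambda>x. h 0 + primitive g x)"
    using assms unfolding H1_rep_def by (intro continuous_intros primitive_continuous L2_integrable) auto
  moreover have "h x = h 0 + primitive g x" if "x \<in> {0..r}" for x
    using assms that unfolding H1_rep_def by blast
  ultimately show ?thesis by (metis continuous_on_eq)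
qed

lemma H1_rep_L2:
  assumes "H1_rep r w g h"
  shows "w \<in> L2_interval r"
proof (rule L2_cong_AE[OF L2_continuous[OF H1_rep_continuous[OF assms]]])
  show "w \<in> borel_measurable (lebesgue_on {0..r})" using assms by (simp add: H1_rep_def)
  have "AE x in lebesgue_on {0..r}. w x = h x" using assms by (simp add: H1_rep_def)
  then show "AE x in lebesgue_on {0..r}. h x = w x" by eventually_elim simp
qed

text \<open>The set of agreement is closed. Containing almost every point of (0, r), it contains the
  whole open interval and then its closure.\<close>

lemma continuous_AE_eq_imp_eq:
  fixes f h :: "real \<Rightarrow> real"
  assumes r: "0 < r" and f: "continuous_on {0..r} f" and h: "continuous_on {0..r} h"
    and ae: "AE x in lebesgue_on {0..r}. f x = h x" and x: "x \<in> {0..r}"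
  shows "f x = h x"
proof -
  define C where "C = {x \<in> {0..r}. f x - h x = 0}"
  have "closed C" unfolding C_def
    by (rule continuous_closed_preimage_constant) (intro continuous_intros f h closed_atLeastAtMost)+
  have "AE x in lebesgue. x \<in> {0..r} \<longrightarrow> f x = h x"
    using ae by (subst (asm) AE_restrict_space_iff) auto
  then have "AE x \<in> {0<..<r} in lebesgue. x \<in> C"
    by eventually_elim (auto simp: C_def)
  then have "{0<..<r} \<subseteq> C"
    by (intro subsetI mem_closed_if_AE_lebesgue_open[OF _ \<open>closed C\<close>, of "{0<..<r}"]) auto
  then have "closure {0<..<r} \<subseteq> C" using \<open>closed C\<close> by (rule closure_minimal)
  then show ?thesis using x r by (auto simp: C_def)
qed

text \<open>The difference of w and the primitive of g is orthogonal to derivatives of test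
  functions, hence constant almost everywhere.\<close>

lemma has_weak_derivative_imp_rep:
  assumes r: "0 < r" and w: "w \<in> L2_interval r" and g: "g \<in> L2_interval r"
    and d: "has_weak_derivative r w g"
  shows "\<exists>k. H1_rep r w g (\<lambda>x. k + primitive g x)"
proof -
  note gi = L2_integrable[OF g]
  have P: "primitive g \<in> L2_interval r"
    by (rule L2_continuous[OF primitive_continuous[OF gi]])
  define z where "z x = w x + (- 1) * primitive g x" for x
  have zL: "z \<in> L2_interval r" unfolding z_def by (intro L2_add L2_cmult w P)
  have dP: "has_weak_derivative r (primitive g) g"
    by (rule has_weak_derivative_primitive[OF r gi, of _ 0]) (use L2_measurable[OF P] in auto)
  have "\<exists>k. AE x in lebesgue_on {0..r}. z x = k"
  proof (rule weak_derivative_zero_imp_AE_const[OF r L2_integrable[OF zL]])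
    fix \<phi> \<psi> assume C: "C1c_interval r \<phi> \<psi>"
    note c = C1c_intervalD(3)[OF C r]
    have "(LINT x|lebesgue_on {0..r}. z x * \<psi> x)
      = (LINT x|lebesgue_on {0..r}. w x * \<psi> x - primitive g x * \<psi> x)"
      by (simp add: z_def algebra_simps)
    also have "\<dots> = (LINT x|lebesgue_on {0..r}. w x * \<psi> x) - (LINT x|lebesgue_on {0..r}. primitive g x * \<psi> x)"
      by (intro Bochner_Integration.integral_diff integrable_continuous_mult c L2_integrable w P)
    also have "\<dots> = 0"
      using d dP C unfolding has_weak_derivative_def by auto
    finally show "(LINT x|lebesgue_on {0..r}. z x * \<psi> x) = 0" .
  qed
  then obtain k where k: "AE x in lebesgue_on {0..r}. z x = k" by blast
  have "H1_rep r w g (\<lambda>x. k + primitive g x)"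
    unfolding H1_rep_def using w g k L2_measurable[OF w]
    by (auto simp: z_def elim: eventually_mono)
  then show ?thesis by blast
qed

text \<open>The two continuous representatives of w agree everywhere. Comparing them at 0 removes
  the constants, so the primitives of g and g' agree, and differentiation of primitives
  finishes.\<close>

lemma has_weak_derivative_unique:
  assumes r: "0 < r" and w: "w \<in> L2_interval r" and g: "g \<in> L2_interval r" "g' \<in> L2_interval r"
    and d: "has_weak_derivative r w g" "has_weak_derivative r w g'"
  shows "AE x in lebesgue_on {0..r}. g x = g' x"
proof -
  obtain k k' where R: "H1_rep r w g (\<lambda>x. k + primitive g x)" "H1_rep r w g' (\<lambda>x. k' + primitive g' x)"
    using has_weak_derivative_imp_rep[OF r w] g d by blast
  then have "AE x in lebesgue_on {0..r}. k + primitive g x = k' + primitive g' x"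
    unfolding H1_rep_def by auto
  then have e: "k + primitive g x = k' + primitive g' x" if "x \<in> {0..r}" for x
    using continuous_AE_eq_imp_eq[OF r H1_rep_continuous[OF R(1)] H1_rep_continuous[OF R(2)] _ that] by blast
  have "primitive (\<lambda>x. g x + (- 1) * g' x) x = 0" if "x \<in> {0..r}" for x
    using e[OF that] e[of 0] r primitive_add[OF L2_integrable L2_integrable that, of g g' "-1"] g by simp
  then have "AE x in lebesgue_on {0..r}. g x + (- 1) * g' x = 0"
    by (intro primitive_zero_imp_AE_zero L2_integrable L2_add L2_cmult g)
  then show ?thesis by (auto elim: eventually_mono)
qed

lemma H1_rep_imp_weak:
  assumes r: "0 < r" and R: "H1_rep r w g h"
  shows "has_weak_derivative r w g"
proof (rule has_weak_derivative_primitive[OF r, of _ _ "h 0"])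
  have "AE x in lebesgue_on {0..r}. x \<in> {0..r}" by (rule AE_I2) simp
  moreover have "AE x in lebesgue_on {0..r}. w x = h x" using R by (simp add: H1_rep_def)
  ultimately show "AE x in lebesgue_on {0..r}. w x = h 0 + primitive g x"
    by eventually_elim (use H1_repD(3)[OF R] in metis)
qed (intro H1_repD(1)[OF R] L2_integrable H1_repD(2)[OF R])+

lemma H1_rep_H1:
  assumes "0 < r" "H1_rep r w g h"
  shows "w \<in> H1_interval r"
proof -
  have "g \<in> L2_interval r" using assms(2) by (simp add: H1_rep_def)
  then show ?thesis
    using H1_rep_imp_weak[OF assms] H1_rep_L2[OF assms(2)] unfolding H1_interval_def by blast
qed

lemma weak_derivativeD:
  assumes "w \<in> H1_interval r"
  shows "weak_derivative r w \<in> L2_interval r" "has_weak_derivative r w (weak_derivative r w)"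
proof -
  have "\<exists>g. g \<in> L2_interval r \<and> has_weak_derivative r w g"
    using assms by (auto simp: H1_interval_def)
  from someI_ex[OF this]
  show "weak_derivative r w \<in> L2_interval r" "has_weak_derivative r w (weak_derivative r w)"
    by (auto simp: weak_derivative_def)
qed

lemma H1_rep_weak_derivative:
  assumes "0 < r" "H1_rep r w g h"
  shows "AE x in lebesgue_on {0..r}. weak_derivative r w x = g x"
proof -
  have "g \<in> L2_interval r" using assms(2) by (simp add: H1_rep_def)
  then show ?thesis
    by (intro has_weak_derivative_unique[OF assms(1) H1_rep_L2[OF assms(2)]]
        weak_derivativeD[OF H1_rep_H1[OF assms]] H1_rep_imp_weak[OF assms])
qed

lemma H1_rep_continuous_representative:
  assumes r: "0 < r" and R: "H1_rep r w g h" and x: "x \<in> {0..r}"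
  shows "continuous_representative r w x = h x"
proof -
  let ?c = "continuous_representative r w"
  have "\<exists>h. continuous_on {0..r} h \<and> (AE x in lebesgue_on {0..r}. w x = h x)"
    using R H1_rep_continuous[OF R] by (auto simp: H1_rep_def)
  from someI_ex[OF this]
  have c: "continuous_on {0..r} ?c" "AE x in lebesgue_on {0..r}. w x = ?c x"
    by (auto simp: continuous_representative_def)
  moreover have "AE x in lebesgue_on {0..r}. w x = h x" using R by (simp add: H1_rep_def)
  ultimately have "AE x in lebesgue_on {0..r}. ?c x = h x" by auto
  then show ?thesis by (rule continuous_AE_eq_imp_eq[OF r c(1) H1_rep_continuous[OF R] _ x])
qed

lemma H1_interval_rep:
  assumes r: "0 < r" and w: "w \<in> H1_interval r"
  shows "H1_rep r w (weak_derivative r w) (continuous_representative r w)"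
proof -
  have wL: "w \<in> L2_interval r" using w by (simp add: H1_interval_def)
  obtain k where R: "H1_rep r w (weak_derivative r w) (\<lambda>x. k + primitive (weak_derivative r w) x)"
    using has_weak_derivative_imp_rep[OF r wL weak_derivativeD[OF w]] by blast
  have e: "continuous_representative r w x = k + primitive (weak_derivative r w) x" if "x \<in> {0..r}" for x
    by (rule H1_rep_continuous_representative[OF r R that])
  have "AE x in lebesgue_on {0..r}. x \<in> {0..r}" by (rule AE_I2) simp
  moreover have "AE x in lebesgue_on {0..r}. w x = k + primitive (weak_derivative r w) x"
    using R by (simp add: H1_rep_def)
  ultimately have "AE x in lebesgue_on {0..r}. w x = continuous_representative r w x"
    by eventually_elim (simp add: e)
  moreover have "continuous_representative r w x = continuous_representative r w 0 + primitive (weak_derivative r w) x"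
    if "x \<in> {0..r}" for x
    using e[OF that] e[of 0] r by simp
  ultimately show ?thesis using H1_repD(1,2)[OF R] unfolding H1_rep_def by blast
qed

lemma H1_rep_add:
  assumes R: "H1_rep r w g h" "H1_rep r w' g' h'"
  shows "H1_rep r (\<lambda>x. w x + k * w' x) (\<lambda>x. g x + k * g' x) (\<lambda>x. h x + k * h' x)"
  unfolding H1_rep_def
proof (intro conjI ballI)
  have [measurable]: "w \<in> borel_measurable (lebesgue_on {0..r})" "w' \<in> borel_measurable (lebesgue_on {0..r})"
    using H1_repD(1)[OF R(1)] H1_repD(1)[OF R(2)] by auto
  show "(\<lambda>x. w x + k * w' x) \<in> borel_measurable (lebesgue_on {0..r})" by measurable
  show "(\<lambda>x. g x + k * g' x) \<in> L2_interval r"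
    by (intro L2_add L2_cmult H1_repD(2)[OF R(1)] H1_repD(2)[OF R(2)])
  fix x assume x: "x \<in> {0..r}"
  have "h x = h 0 + primitive g x" "h' x = h' 0 + primitive g' x"
    using H1_repD(3)[OF R(1) x] H1_repD(3)[OF R(2) x] .
  moreover have "primitive (\<lambda>x. g x + k * g' x) x = primitive g x + k * primitive g' x"
    by (intro primitive_add[OF _ _ x] L2_integrable H1_repD(2)[OF R(1)] H1_repD(2)[OF R(2)])
  ultimately show "h x + k * h' x = h 0 + k * h' 0 + primitive (\<lambda>x. g x + k * g' x) x"
    by (simp add: algebra_simps)
next
  have "AE x in lebesgue_on {0..r}. w x = h x" "AE x in lebesgue_on {0..r}. w' x = h' x"
    using H1_repD(4)[OF R(1)] H1_repD(4)[OF R(2)] .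
  then show "AE x in lebesgue_on {0..r}. w x + k * w' x = h x + k * h' x"
    by eventually_elim simp
qed

text \<open>Splitting h and h' into initial value plus primitive reduces this to
  \<open>primitive_by_parts\<close>. The boundary values are those of the continuous
  representatives, that is, the traces.\<close>

lemma H1_rep_by_parts:
  assumes r: "0 < r" and R: "H1_rep r w g h" "H1_rep r w' g' h'"
  shows "(LINT x|lebesgue_on {0..r}. g x * w' x) + (LINT x|lebesgue_on {0..r}. w x * g' x)
       = h r * h' r - h 0 * h' 0"
proof -
  have L: "g \<in> L2_interval r" "g' \<in> L2_interval r" "w \<in> L2_interval r" "w' \<in> L2_interval r"
    using H1_repD(2)[OF R(1)] H1_repD(2)[OF R(2)] H1_rep_L2[OF R(1)] H1_rep_L2[OF R(2)] .
  note i = L[THEN L2_integrable]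
  note c = primitive_continuous[OF i(1)] primitive_continuous[OF i(2)]
  note [measurable] = L[THEN L2_measurable] c[THEN borel_measurable_lebesgue_on_continuous]
  have sp: "AE x in lebesgue_on {0..r}. x \<in> {0..r}" by (rule AE_I2) simp
  have ae: "AE x in lebesgue_on {0..r}. w x = h x" "AE x in lebesgue_on {0..r}. w' x = h' x"
    using H1_repD(4)[OF R(1)] H1_repD(4)[OF R(2)] .
  have h: "h x = h 0 + primitive g x" "h' x = h' 0 + primitive g' x" if "x \<in> {0..r}" for x
    using H1_repD(3)[OF R(1) that] H1_repD(3)[OF R(2) that] .
  have "(LINT x|lebesgue_on {0..r}. g x * w' x) = (LINT x|lebesgue_on {0..r}. h' 0 * g x + g x * primitive g' x)"
    by (rule integral_cong_AE; (measurable)?) (use sp ae(2) in \<open>eventually_elim, metis h(2) distrib_left mult.commute\<close>)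
  also have "\<dots> = h' 0 * primitive g r + (LINT x|lebesgue_on {0..r}. g x * primitive g' x)"
    using i integrable_continuous_mult[OF i(1) c(2)] by (simp add: primitive_def)
  finally have 1: "(LINT x|lebesgue_on {0..r}. g x * w' x) = h' 0 * primitive g r + (LINT x|lebesgue_on {0..r}. g x * primitive g' x)" .
  have "(LINT x|lebesgue_on {0..r}. w x * g' x) = (LINT x|lebesgue_on {0..r}. h 0 * g' x + primitive g x * g' x)"
    by (rule integral_cong_AE; (measurable)?) (use sp ae(1) in \<open>eventually_elim, metis h(1) distrib_right\<close>)
  also have "\<dots> = h 0 * primitive g' r + (LINT x|lebesgue_on {0..r}. primitive g x * g' x)"
    using i integrable_continuous_mult[OF i(2) c(1)] by (simp add: primitive_def mult.commute)
  finally have 2: "(LINT x|lebesgue_on {0..r}. w x * g' x) = h 0 * primitive g' r + (LINT x|lebesgue_on {0..r}. primitive g x * g' x)" .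
  show ?thesis
  proof -
    have "h r = h 0 + primitive g r" "h' r = h' 0 + primitive g' r" using h[of r] r by simp_all
    then show ?thesis
      using primitive_by_parts[OF _ i(1,2)] r unfolding 1 2 by (simp add: algebra_simps)
  qed
qed

subsection \<open>The semi-inner product space \<open>L\<^sup>2(\<E>)\<close>\<close>

lemma L2_netD: "w \<in> L2_net E l \<Longrightarrow> e \<in> E \<Longrightarrow> w e \<in> L2_interval (l e)"
  by (simp add: L2_net_def)

text \<open>The combination w + k z is the common shape of the linearity lemmas from here on; k = 1
  and k = - 1 give sums and differences.\<close>

lemma L2_net_comb:
  "w \<in> L2_net E l \<Longrightarrow> z \<in> L2_net E l \<Longrightarrow> (\<lambda>e x. w e x + k * z e x) \<in> L2_net E l"
  by (simp add: L2_net_def L2_add L2_cmult)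

lemma L2_net_cmult: "w \<in> L2_net E l \<Longrightarrow> (\<lambda>e x. k * w e x) \<in> L2_net E l"
  by (simp add: L2_net_def L2_cmult)

lemma L2_net_diff:
  "w \<in> L2_net E l \<Longrightarrow> z \<in> L2_net E l \<Longrightarrow> (\<lambda>e x. w e x - z e x) \<in> L2_net E l"
  using L2_net_comb[of w E l z "-1"] by simp

lemma L2_net_const: "(\<lambda>e x. k) \<in> L2_net E l"
  by (simp add: L2_net_def L2_const)

lemma inner_net_commute: "inner_net E l w z = inner_net E l z w"
  by (simp add: inner_net_def mult.commute)

lemma inner_net_comb_left:
  assumes "w \<in> L2_net E l" "w' \<in> L2_net E l" "z \<in> L2_net E l"
  shows "inner_net E l (\<lambda>e x. w e x + k * w' e x) z = inner_net E l w z + k * inner_net E l w' z"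
proof -
  have "(LINT x|lebesgue_on {0..l e}. (w e x + k * w' e x) * z e x)
     = (LINT x|lebesgue_on {0..l e}. w e x * z e x) + k * (LINT x|lebesgue_on {0..l e}. w' e x * z e x)"
    if "e \<in> E" for e
    using L2_mult[OF L2_netD[OF assms(1) that] L2_netD[OF assms(3) that]]
      L2_mult[OF L2_netD[OF assms(2) that] L2_netD[OF assms(3) that]]
    by (simp add: distrib_right mult.assoc)
  then show ?thesis
    by (simp add: inner_net_def sum.distrib sum_distrib_left)
qed

lemma inner_net_comb_right:
  assumes "w \<in> L2_net E l" "w' \<in> L2_net E l" "z \<in> L2_net E l"
  shows "inner_net E l z (\<lambda>e x. w e x + k * w' e x) = inner_net E l z w + k * inner_net E l z w'"
  using inner_net_comb_left[OF assms] by (simp add: inner_net_commute)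

lemma inner_net_cmult_left:
  "w \<in> L2_net E l \<Longrightarrow> z \<in> L2_net E l \<Longrightarrow> inner_net E l (\<lambda>e x. k * w e x) z = k * inner_net E l w z"
  using inner_net_comb_left[OF L2_net_const[of 0], of w E l z k] by (simp add: inner_net_def)

lemma inner_net_nonneg: "0 \<le> inner_net E l w w"
  unfolding inner_net_def by (intro sum_nonneg Bochner_Integration.integral_nonneg) simp

lemma L2_norm_nonneg: "0 \<le> L2_norm E l w"
  by (simp add: L2_norm_def inner_net_nonneg)

lemma L2_norm_power2: "(L2_norm E l w)\<^sup>2 = inner_net E l w w"
  by (simp add: L2_norm_def inner_net_nonneg)

lemma inner_net_square_comb:
  assumes "w \<in> L2_net E l" "z \<in> L2_net E l"
  shows "inner_net E l (\<lambda>e x. w e x + k * z e x) (\<lambda>e x. w e x + k * z e x)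
    = inner_net E l w w + 2 * k * inner_net E l w z + k\<^sup>2 * inner_net E l z z"
  using inner_net_comb_left[OF assms L2_net_comb[OF assms], of k k]
    inner_net_comb_right[OF assms assms(1), of k] inner_net_comb_right[OF assms assms(2), of k]
    inner_net_commute[of E l w z]
  by (simp add: power2_eq_square algebra_simps)

lemma inner_net_Cauchy_Schwarz:
  assumes "w \<in> L2_net E l" "z \<in> L2_net E l"
  shows "\<bar>inner_net E l w z\<bar> \<le> L2_norm E l w * L2_norm E l z"
proof -
  let ?b = "inner_net E l w z" and ?a = "inner_net E l z z" and ?c = "inner_net E l w w"
  \<comment> \<open>The discriminant of this nonnegative polynomial in k gives the claim. The form
    is only semidefinite on functions, so \<open>?a\<close> may be 0; then the polynomial is linear
    and would take the value - 1 unless \<open>?b\<close> is 0.\<close>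
  have q: "0 \<le> ?c + 2 * k * ?b + k\<^sup>2 * ?a" for k
    using inner_net_nonneg[of E l "\<lambda>e x. w e x + k * z e x"] inner_net_square_comb[OF assms] by simp
  have "?b\<^sup>2 \<le> ?c * ?a"
  proof (cases "?a = 0")
    case True
    show ?thesis
    proof (cases "?b = 0")
      case False
      have "0 \<le> ?c + 2 * (- (?c + 1) / (2 * ?b)) * ?b" using q[of "- (?c + 1) / (2 * ?b)"] True by simp
      also have "\<dots> = - 1" using False by (simp add: field_simps)
      finally show ?thesis by simp
    qed (simp add: True)
  next
    case False
    then have a: "?a > 0" using inner_net_nonneg[of E l z] by simp
    have "0 \<le> (?c + 2 * (- ?b / ?a) * ?b + (- ?b / ?a)\<^sup>2 * ?a) * ?a"
      using q[of "- ?b / ?a"] a by simp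
    also have "\<dots> = ?c * ?a - ?b\<^sup>2"
      using a by (simp add: field_simps power2_eq_square)
    finally show ?thesis by simp
  qed
  also have "\<dots> = (L2_norm E l w * L2_norm E l z)\<^sup>2"
    by (simp add: power_mult_distrib L2_norm_power2)
  finally have "\<bar>?b\<bar>\<^sup>2 \<le> (L2_norm E l w * L2_norm E l z)\<^sup>2"
    by (simp only: power2_abs)
  then show ?thesis
    by (rule power2_le_imp_le) (intro mult_nonneg_nonneg L2_norm_nonneg)
qed

lemma inner_net_cong:
  assumes w: "w \<in> L2_net E l" "w' \<in> L2_net E l" and z: "z \<in> L2_net E l"
    and ae: "AE_net E l (\<lambda>e x. w e x = w' e x)"
  shows "inner_net E l w z = inner_net E l w' z"
  unfolding inner_net_def
proof (rule sum.cong[OF refl])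
  fix e assume e: "e \<in> E"
  note i = L2_mult[OF L2_netD[OF w(1) e] L2_netD[OF z e]] L2_mult[OF L2_netD[OF w(2) e] L2_netD[OF z e]]
  have "AE x in lebesgue_on {0..l e}. w e x = w' e x" using ae e by (simp add: AE_net_def)
  then have "AE x in lebesgue_on {0..l e}. w e x * z e x = w' e x * z e x"
    by eventually_elim simp
  then show "(LINT x|lebesgue_on {0..l e}. w e x * z e x) = (LINT x|lebesgue_on {0..l e}. w' e x * z e x)"
    by (intro integral_cong_AE borel_measurable_integrable i)
qed

lemma L2_norm_cong:
  assumes w: "w \<in> L2_net E l" "w' \<in> L2_net E l"
    and ae: "AE_net E l (\<lambda>e x. w e x = w' e x)"
  shows "L2_norm E l w = L2_norm E l w'"
  using inner_net_cong[OF w w(1) ae] inner_net_cong[OF w w(2) ae] inner_net_commute[of E l w w']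
  by (simp add: L2_norm_def)

lemma inner_net_mono:
  assumes "w \<in> L2_net E l" "z \<in> L2_net E l" "w' \<in> L2_net E l" "z' \<in> L2_net E l"
    and ae: "AE_net E l (\<lambda>e x. w e x * z e x \<le> w' e x * z' e x)"
  shows "inner_net E l w z \<le> inner_net E l w' z'"
  unfolding inner_net_def
  by (intro sum_mono integral_mono_AE L2_mult)
     (use assms in \<open>auto simp: AE_net_def L2_net_def\<close>)

lemma inner_net_eq_0_imp_AE:
  assumes E: "finite E" and w: "w \<in> L2_net E l" and z: "inner_net E l w w = 0"
  shows "AE_net E l (\<lambda>e x. w e x = 0)"
  unfolding AE_net_def
proof
  fix e assume e: "e \<in> E"
  have i: "integrable (lebesgue_on {0..l e}) (\<lambda>x. w e x * w e x)"
    using L2_netD[OF w e] by (intro L2_mult)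
  have "(LINT x|lebesgue_on {0..l e}. w e x * w e x) = 0"
    using z E e unfolding inner_net_def
    by (subst (asm) sum_nonneg_eq_0_iff) (auto intro!: Bochner_Integration.integral_nonneg)
  then have "AE x in lebesgue_on {0..l e}. w e x * w e x = 0"
    using integral_nonneg_eq_0_iff_AE[OF i] by simp
  then show "AE x in lebesgue_on {0..l e}. w e x = 0" by eventually_elim simp
qed

lemma AE_net_conj: "AE_net E l P \<Longrightarrow> AE_net E l Q \<Longrightarrow> AE_net E l (\<lambda>e x. P e x \<and> Q e x)"
  by (simp add: AE_net_def)

lemma AE_net_mono: "AE_net E l P \<Longrightarrow> (\<And>e x. e \<in> E \<Longrightarrow> P e x \<Longrightarrow> Q e x) \<Longrightarrow> AE_net E l Q"
  unfolding AE_net_def by (blast intro: eventually_mono)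

section \<open>Multiplication by coefficients bounded above and away from zero\<close>

definition bounded_weight ::
  "('v \<times> 'v) set \<Rightarrow> ('v \<times> 'v \<Rightarrow> real) \<Rightarrow> real \<Rightarrow> real \<Rightarrow> 'v netfun \<Rightarrow> bool" where
  "bounded_weight E l C0 C1 m \<longleftrightarrow> 0 < C0 \<and> 0 < C1 \<and> m \<in> L2_net E l \<and>
     AE_net E l (\<lambda>e x. C0 \<le> m e x \<and> m e x \<le> C1)"

lemma bounded_weight_L2:
  assumes m: "bounded_weight E l C0 C1 m" and w: "w \<in> L2_net E l"
  shows "(\<lambda>e x. m e x * w e x) \<in> L2_net E l"
  unfolding L2_net_def
proof (intro CollectI ballI)
  fix e assume e: "e \<in> E"
  have "AE x in lebesgue_on {0..l e}. C0 \<le> m e x \<and> m e x \<le> C1" and C: "0 < C0"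
    using m e by (auto simp: bounded_weight_def AE_net_def)
  then have "AE x in lebesgue_on {0..l e}. \<bar>m e x\<bar> \<le> C1" by (auto elim: eventually_mono)
  then show "(\<lambda>x. m e x * w e x) \<in> L2_interval (l e)"
    using m e by (intro L2_bounded_mult L2_netD[OF w] L2_measurable[OF L2_netD[of m E l]])
       (auto simp: bounded_weight_def)
qed

lemma bounded_weight_lower:
  assumes m: "bounded_weight E l C0 C1 m" and w: "w \<in> L2_net E l"
  shows "C0 * inner_net E l w w \<le> inner_net E l (\<lambda>e x. m e x * w e x) w"
proof -
  have "inner_net E l (\<lambda>e x. C0 * w e x) w \<le> inner_net E l (\<lambda>e x. m e x * w e x) w"
  proof (rule inner_net_mono[OF L2_net_cmult[OF w] w bounded_weight_L2[OF m w] w])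
    have "AE_net E l (\<lambda>e x. C0 \<le> m e x \<and> m e x \<le> C1)" using m by (simp add: bounded_weight_def)
    then show "AE_net E l (\<lambda>e x. C0 * w e x * w e x \<le> m e x * w e x * w e x)"
      by (rule AE_net_mono) (simp add: mult.assoc mult_right_mono)
  qed
  then show ?thesis by (simp add: inner_net_cmult_left w)
qed

lemma bounded_weight_norm:
  assumes m: "bounded_weight E l C0 C1 m" and w: "w \<in> L2_net E l"
  shows "L2_norm E l (\<lambda>e x. m e x * w e x) \<le> C1 * L2_norm E l w"
proof (rule power2_le_imp_le)
  note mw = bounded_weight_L2[OF m w] and cw = L2_net_cmult[OF w, of C1]
  have C: "0 < C0" "0 < C1" using m by (auto simp: bounded_weight_def)
  have "inner_net E l (\<lambda>e x. m e x * w e x) (\<lambda>e x. m e x * w e x)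
      \<le> inner_net E l (\<lambda>e x. C1 * w e x) (\<lambda>e x. C1 * w e x)"
  proof (rule inner_net_mono[OF mw mw cw cw])
    have "AE_net E l (\<lambda>e x. C0 \<le> m e x \<and> m e x \<le> C1)" using m by (simp add: bounded_weight_def)
    then show "AE_net E l (\<lambda>e x. m e x * w e x * (m e x * w e x) \<le> C1 * w e x * (C1 * w e x))"
    proof (rule AE_net_mono)
      fix e x assume "C0 \<le> m e x \<and> m e x \<le> C1"
      then have "m e x * m e x \<le> C1 * C1" using C by (intro mult_mono) auto
      then have "m e x * m e x * (w e x * w e x) \<le> C1 * C1 * (w e x * w e x)"
        by (intro mult_right_mono) auto
      then show "m e x * w e x * (m e x * w e x) \<le> C1 * w e x * (C1 * w e x)" by (simp add: mult_ac)
    qed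
  qed
  also have "\<dots> = C1 * (C1 * inner_net E l w w)"
    using inner_net_cmult_left[OF w cw, of C1] inner_net_cmult_left[OF w w, of C1]
    by (simp add: inner_net_commute[of E l w "\<lambda>e x. C1 * w e x"])
  finally show "(L2_norm E l (\<lambda>e x. m e x * w e x))\<^sup>2 \<le> (C1 * L2_norm E l w)\<^sup>2"
    unfolding power_mult_distrib L2_norm_power2 by (simp add: power2_eq_square mult.assoc)
  show "0 \<le> C1 * L2_norm E l w" using C by (simp add: L2_norm_nonneg)
qed

lemma bounded_weight_Cauchy_Schwarz:
  assumes m: "bounded_weight E l C0 C1 m" and w: "w \<in> L2_net E l" and z: "z \<in> L2_net E l"
  shows "\<bar>inner_net E l (\<lambda>e x. m e x * w e x) z\<bar> \<le> C1 * L2_norm E l w * L2_norm E l z"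
  by (rule order_trans[OF inner_net_Cauchy_Schwarz[OF bounded_weight_L2[OF m w] z]
        mult_right_mono[OF bounded_weight_norm[OF m w] L2_norm_nonneg]])

subsection \<open>Function spaces on the network\<close>

context network
begin

lemma finite_edges: "finite E"
  using finite_subset[OF edges_subset] finite_vertices by simp

lemma edge_ends: "e \<in> E \<Longrightarrow> fst e \<in> V" "e \<in> E \<Longrightarrow> snd e \<in> V" "e \<in> E \<Longrightarrow> fst e \<noteq> snd e"
  using edges_subset distinct_ends[of "fst e" "snd e"] by auto

lemma H1_net_rep:
  assumes "w \<in> H1_net E l" "e \<in> E"
  shows "H1_rep (l e) (w e) (dx l w e) (continuous_representative (l e) (w e))"
  unfolding dx_def by (rule H1_interval_rep) (use assms length_pos in \<open>auto simp: H1_net_def\<close>)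

lemma H1_net_L2: "w \<in> H1_net E l \<Longrightarrow> w \<in> L2_net E l"
  unfolding L2_net_def using H1_rep_L2[OF H1_net_rep] by blast

lemma dx_L2: "w \<in> H1_net E l \<Longrightarrow> dx l w \<in> L2_net E l"
  unfolding L2_net_def using H1_repD(2)[OF H1_net_rep] by blast

text \<open>\<open>dx\<close> and \<open>trace_at\<close> rest on \<open>SOME\<close>. An explicit
  representation on every edge pins them down, \<open>dx\<close> almost everywhere and the traces
  exactly.\<close>

lemma H1_netI:
  assumes "\<And>e. e \<in> E \<Longrightarrow> H1_rep (l e) (w e) (g e) (h e)"
  shows "w \<in> H1_net E l" "AE_net E l (\<lambda>e x. dx l w e x = g e x)"
    "e \<in> E \<Longrightarrow> trace_at l w e v = h e (if v = fst e then 0 else l e)"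
  using H1_rep_H1[OF length_pos assms] H1_rep_weak_derivative[OF length_pos assms]
    H1_rep_continuous_representative[OF length_pos assms, of e] length_pos[of e]
  by (auto simp: H1_net_def AE_net_def dx_def trace_at_def)

lemma H1_net_comb:
  assumes "w \<in> H1_net E l" "z \<in> H1_net E l"
  shows "(\<lambda>e x. w e x + k * z e x) \<in> H1_net E l"
    "AE_net E l (\<lambda>e x. dx l (\<lambda>e x. w e x + k * z e x) e x = dx l w e x + k * dx l z e x)"
    "e \<in> E \<Longrightarrow> trace_at l (\<lambda>e x. w e x + k * z e x) e v = trace_at l w e v + k * trace_at l z e v"
proof -
  let ?c = "\<lambda>w e. continuous_representative (l e) (w e)"
  have R: "H1_rep (l e) (\<lambda>x. w e x + k * z e x) (\<lambda>x. dx l w e x + k * dx l z e x)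
      (\<lambda>x. ?c w e x + k * ?c z e x)" if "e \<in> E" for e
    by (intro H1_rep_add H1_net_rep assms that)
  note N = H1_netI[of "\<lambda>e x. w e x + k * z e x" "\<lambda>e x. dx l w e x + k * dx l z e x"
      "\<lambda>e x. ?c w e x + k * ?c z e x", OF R]
  show "(\<lambda>e x. w e x + k * z e x) \<in> H1_net E l" using N(1) by blast
  show "AE_net E l (\<lambda>e x. dx l (\<lambda>e x. w e x + k * z e x) e x = dx l w e x + k * dx l z e x)"
    using N(2) by blast
  show "trace_at l (\<lambda>e x. w e x + k * z e x) e v = trace_at l w e v + k * trace_at l z e v" if "e \<in> E"
    using N(3)[OF _ that] unfolding trace_at_def by blast
qed

lemma H_div_H1: "u \<in> H_div V E l \<Longrightarrow> u \<in> H1_net E l"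
  by (simp add: H_div_def)

lemma H1_0_H1: "p \<in> H1_0 V E l \<Longrightarrow> p \<in> H1_net E l"
  by (simp add: H1_0_def)

lemma H_div_comb:
  assumes "w \<in> H_div V E l" "z \<in> H_div V E l"
  shows "(\<lambda>e x. w e x + k * z e x) \<in> H_div V E l"
proof -
  note H = H1_net_comb[OF H_div_H1[OF assms(1)] H_div_H1[OF assms(2)], where k = k]
  have "(\<Sum>e\<in>incident E v. edge_sign e v * trace_at l (\<lambda>e x. w e x + k * z e x) e v)
    = (\<Sum>e\<in>incident E v. edge_sign e v * trace_at l w e v) + k * (\<Sum>e\<in>incident E v. edge_sign e v * trace_at l z e v)" for v
    unfolding sum_distrib_left sum.distrib[symmetric]
    by (rule sum.cong) (auto simp: H(3) incident_def algebra_simps)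
  then show ?thesis using assms H(1) by (simp add: H_div_def)
qed

lemma H1_0_comb:
  assumes "w \<in> H1_0 V E l" "z \<in> H1_0 V E l"
  shows "(\<lambda>e x. w e x + k * z e x) \<in> H1_0 V E l"
proof -
  note H = H1_net_comb[OF H1_0_H1[OF assms(1)] H1_0_H1[OF assms(2)], where k = k]
  have E: "e \<in> incident E v \<Longrightarrow> e \<in> E" for e v by (simp add: incident_def)
  have "trace_at l (\<lambda>e x. w e x + k * z e x) e v = trace_at l (\<lambda>e x. w e x + k * z e x) e' v"
    if "v \<in> interior_vertices V E" "e \<in> incident E v" "e' \<in> incident E v" for v e e'
  proof -
    have "trace_at l w e v = trace_at l w e' v" "trace_at l z e v = trace_at l z e' v"
      using assms that unfolding H1_0_def by blast+
    then show ?thesis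
      unfolding H(3)[OF E[OF that(2)]] H(3)[OF E[OF that(3)]] by (rule arg_cong2)
  qed
  moreover have "trace_at l (\<lambda>e x. w e x + k * z e x) e v = 0"
    if "v \<in> boundary_vertices V E" "e \<in> incident E v" for v e
  proof -
    have "trace_at l w e v = 0" "trace_at l z e v = 0"
      using assms that unfolding H1_0_def by blast+
    then show ?thesis unfolding H(3)[OF E[OF that(2)]] by simp
  qed
  ultimately show ?thesis using H(1) unfolding H1_0_def by blast
qed

text \<open>Rewrites the boundary term of an edge as a sum over all vertices, so that sums over
  edges and vertices can be exchanged.\<close>

lemma sum_edge_sign:
  assumes "e \<in> E"
  shows "(\<Sum>v\<in>V. edge_sign e v * F v) = F (snd e) - F (fst e)"
proof -
  have "(\<Sum>v\<in>V. edge_sign e v * F v) = (\<Sum>v\<in>{fst e, snd e}. edge_sign e v * F v)"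
    using edge_ends[OF assms] finite_vertices
    by (intro sum.mono_neutral_right) (auto simp: edge_sign_def)
  then show ?thesis using edge_ends(3)[OF assms] by (simp add: edge_sign_def)
qed

lemma sum_incident: "(\<Sum>e\<in>incident E v. edge_sign e v * F e) = (\<Sum>e\<in>E. edge_sign e v * F e)"
  using finite_edges
  by (intro sum.mono_neutral_left) (auto simp: incident_def edge_sign_def)

text \<open>The boundary terms of the edges are regrouped by vertex. At an interior vertex p has one
  common trace, which factors out of the flux balance of u; at a boundary vertex p vanishes.\<close>

lemma inner_net_by_parts:
  assumes u: "u \<in> H_div V E l" and p: "p \<in> H1_0 V E l"
  shows "inner_net E l (dx l u) p + inner_net E l u (dx l p) = 0"
proof -
  note H = H1_net_rep[OF H_div_H1[OF u]] H1_net_rep[OF H1_0_H1[OF p]]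
  have "inner_net E l (dx l u) p + inner_net E l u (dx l p)
    = (\<Sum>e\<in>E. (LINT x|lebesgue_on {0..l e}. dx l u e x * p e x) + (LINT x|lebesgue_on {0..l e}. u e x * dx l p e x))"
    by (simp add: inner_net_def sum.distrib)
  also have "\<dots> = (\<Sum>e\<in>E. \<Sum>v\<in>V. edge_sign e v * (trace_at l u e v * trace_at l p e v))"
  proof (rule sum.cong[OF refl])
    fix e assume e: "e \<in> E"
    show "(LINT x|lebesgue_on {0..l e}. dx l u e x * p e x) + (LINT x|lebesgue_on {0..l e}. u e x * dx l p e x)
      = (\<Sum>v\<in>V. edge_sign e v * (trace_at l u e v * trace_at l p e v))"
      using H1_rep_by_parts[OF length_pos[OF e] H(1)[OF e] H(2)[OF e]] edge_ends(3)[OF e]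
      unfolding sum_edge_sign[OF e] by (simp add: trace_at_def)
  qed
  also have "\<dots> = (\<Sum>v\<in>V. \<Sum>e\<in>E. edge_sign e v * (trace_at l u e v * trace_at l p e v))"
    by (rule sum.swap)
  also have "\<dots> = 0"
  proof (rule sum.neutral, rule)
    fix v assume v: "v \<in> V"
    show "(\<Sum>e\<in>E. edge_sign e v * (trace_at l u e v * trace_at l p e v)) = 0"
    proof (cases "v \<in> interior_vertices V E")
      case True
      then obtain \<pi> where \<pi>: "\<And>e. e \<in> incident E v \<Longrightarrow> trace_at l p e v = \<pi>"
        using p unfolding H1_0_def by (cases "incident E v = {}") blast+
      have "(\<Sum>e\<in>incident E v. edge_sign e v * (trace_at l u e v * trace_at l p e v))
        = (\<Sum>e\<in>incident E v. edge_sign e v * trace_at l u e v) * \<pi>"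
        unfolding sum_distrib_right by (rule sum.cong) (simp_all add: \<pi>)
      then show ?thesis using u True by (simp add: H_div_def flip: sum_incident)
    next
      case False
      then have "v \<in> boundary_vertices V E" using v by (simp add: boundary_vertices_def)
      then have "\<And>e. e \<in> incident E v \<Longrightarrow> trace_at l p e v = 0"
        using p by (simp add: H1_0_def)
      then show ?thesis unfolding sum_incident[symmetric] by simp
    qed
  qed
  finally show ?thesis .
qed

subsection \<open>Poincare's inequality\<close>

text \<open>The sum over all edges makes the right-hand side the same for every edge, so that the
  bounds can be chained along a path.\<close>

lemma edge_variation_le:
  assumes q: "q \<in> H1_net E l" and e: "e \<in> E" and x: "x \<in> {0..l e}"
  shows "\<bar>continuous_representative (l e) (q e) x - continuous_representative (l e) (q e) 0\<bar>
    \<le> (\<Sum>e\<in>E. LINT y|lebesgue_on {0..l e}. \<bar>dx l q e y\<bar>)"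
proof -
  note H = H1_net_rep[OF q e]
  have "continuous_representative (l e) (q e) x - continuous_representative (l e) (q e) 0 = primitive (dx l q e) x"
    using H1_repD(3)[OF H x] by linarith
  also have "\<bar>\<dots>\<bar> \<le> (LINT y|lebesgue_on {0..l e}. \<bar>dx l q e y\<bar>)"
    by (rule primitive_abs_le[OF L2_integrable[OF H1_repD(2)[OF H]] x])
  also have "\<dots> \<le> (\<Sum>e\<in>E. LINT y|lebesgue_on {0..l e}. \<bar>dx l q e y\<bar>)"
    by (rule member_le_sum[OF e _ finite_edges]) simp
  finally show ?thesis .
qed

text \<open>Induction along a path that starts at a boundary vertex, where the trace is 0. Crossing
  an edge costs at most the total variation on the network, and an interior vertex hands the trace
  on to its other edges; further boundary vertices reset it to 0. The factor n counts the edges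
  crossed and so does not depend on q.\<close>

lemma vertex_bound:
  assumes b: "boundary_vertices V E \<noteq> {}" and v: "v \<in> V"
  shows "\<exists>n\<ge>0. \<forall>q\<in>H1_0 V E l. \<forall>e\<in>incident E v.
    \<bar>trace_at l q e v\<bar> \<le> n * (\<Sum>e\<in>E. LINT y|lebesgue_on {0..l e}. \<bar>dx l q e y\<bar>)"
proof -
  let ?S = "\<lambda>q. \<Sum>e\<in>E. LINT y|lebesgue_on {0..l e}. \<bar>dx l q e y\<bar>"
  have S: "0 \<le> ?S q" for q by (intro sum_nonneg) simp
  obtain v0 where v0: "v0 \<in> boundary_vertices V E" using b by blast
  then have "v0 \<in> V" by (simp add: boundary_vertices_def)
  then have "(v0, v) \<in> (E \<union> E\<inverse>)\<^sup>*" using connected_undirected v by blast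
  then show ?thesis
  proof (induction rule: rtrancl_induct)
    case base
    have "\<forall>q\<in>H1_0 V E l. \<forall>e\<in>incident E v0. \<bar>trace_at l q e v0\<bar> \<le> 0 * ?S q"
      using v0 by (simp add: H1_0_def)
    then show ?case by blast
  next
    case (step y z)
    then obtain n where n: "n \<ge> 0"
      "\<And>q e. q \<in> H1_0 V E l \<Longrightarrow> e \<in> incident E y \<Longrightarrow> \<bar>trace_at l q e y\<bar> \<le> n * ?S q" by blast
    obtain e where e: "e \<in> E" "e = (y, z) \<or> e = (z, y)" using step.hyps by auto
    then have inc: "e \<in> incident E y" "e \<in> incident E z" by (auto simp: incident_def)
    have "\<bar>trace_at l q e' z\<bar> \<le> (n + 1) * ?S q" if q: "q \<in> H1_0 V E l" and e': "e' \<in> incident E z" for q e'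
    proof (cases "z \<in> interior_vertices V E")
      case True
      then have "trace_at l q e' z = trace_at l q e z" using q e' inc(2) unfolding H1_0_def by blast
      moreover have "\<bar>trace_at l q e z - trace_at l q e y\<bar> \<le> ?S q"
        using edge_variation_le[OF H1_0_H1[OF q] e(1), of "l e"] e(2) edge_ends(3)[OF e(1)] length_pos[OF e(1)]
        by (auto simp: trace_at_def abs_minus_commute)
      moreover have "\<bar>trace_at l q e y\<bar> \<le> n * ?S q" by (rule n(2)[OF q inc(1)])
      ultimately show ?thesis by (simp add: distrib_right)
    next
      case False
      moreover have "z \<in> V" using e edge_ends[OF e(1)] by auto
      ultimately have "trace_at l q e' z = 0" using q e' by (simp add: H1_0_def boundary_vertices_def)
      moreover have "0 \<le> (n + 1) * ?S q" using n(1) S[of q] by (intro mult_nonneg_nonneg) auto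
      ultimately show ?thesis by simp
    qed
    moreover have "n + 1 \<ge> 0" using n(1) by simp
    ultimately show ?case by blast
  qed
qed

lemma Poincare:
  assumes b: "boundary_vertices V E \<noteq> {}"
  shows "\<exists>K\<ge>0. \<forall>q\<in>H1_0 V E l. L2_norm E l q \<le> K * L2_norm E l (dx l q)"
proof -
  let ?S = "\<lambda>q. \<Sum>e\<in>E. LINT y|lebesgue_on {0..l e}. \<bar>dx l q e y\<bar>"
  have S: "0 \<le> ?S q" for q by (intro sum_nonneg) simp
  have "\<exists>n. \<forall>v\<in>V. 0 \<le> n v \<and> (\<forall>q\<in>H1_0 V E l. \<forall>e\<in>incident E v. \<bar>trace_at l q e v\<bar> \<le> n v * ?S q)"
    by (rule bchoice) (use vertex_bound[OF b] in blast)
  then obtain n where n: "\<And>v. v \<in> V \<Longrightarrow> n v \<ge> 0"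
    "\<And>v q e. v \<in> V \<Longrightarrow> q \<in> H1_0 V E l \<Longrightarrow> e \<in> incident E v \<Longrightarrow> \<bar>trace_at l q e v\<bar> \<le> n v * ?S q"
    by blast
  \<comment> \<open>The sum dominates every single \<open>n v\<close>; the 1 pays for the variation
    from the start of an edge to a point on it.\<close>
  define M where "M = sum n V + 1"
  have M: "0 \<le> M" using n(1) by (auto simp: M_def intro!: add_nonneg_nonneg sum_nonneg)
  \<comment> \<open>The square root of the total length. It enters twice: in passing from the
    integral of |dx q| to its L2 norm, and from the uniform bound of q to the L2 norm of q.\<close>
  define L where "L = L2_norm E l (\<lambda>_ _. 1)"
  have L: "0 \<le> L" by (simp add: L_def L2_norm_nonneg)
  have "L2_norm E l q \<le> (L * (M * L)) * L2_norm E l (dx l q)" if q: "q \<in> H1_0 V E l" for q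
  proof -
    note H1 = H1_0_H1[OF q]
    note qL = H1_net_L2[OF H1] and dL = dx_L2[OF H1]
    have dL': "(\<lambda>e x. \<bar>dx l q e x\<bar>) \<in> L2_net E l"
      using dL by (simp add: L2_net_def L2_abs)
    have "?S q = inner_net E l (\<lambda>_ _. 1) (\<lambda>e x. \<bar>dx l q e x\<bar>)" by (simp add: inner_net_def)
    also have "\<dots> \<le> L * L2_norm E l (\<lambda>e x. \<bar>dx l q e x\<bar>)"
      using inner_net_Cauchy_Schwarz[OF L2_net_const dL', of 1] by (simp add: L_def)
    also have "L2_norm E l (\<lambda>e x. \<bar>dx l q e x\<bar>) = L2_norm E l (dx l q)"
      by (simp add: L2_norm_def inner_net_def)
    finally have SL: "?S q \<le> L * L2_norm E l (dx l q)" .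
    have bound: "AE_net E l (\<lambda>e x. \<bar>q e x\<bar> \<le> M * ?S q)"
      unfolding AE_net_def
    proof
      fix e assume e: "e \<in> E"
      let ?c = "continuous_representative (l e) (q e)"
      have "\<bar>?c 0\<bar> \<le> n (fst e) * ?S q"
        using n(2)[OF edge_ends(1)[OF e] q, of e] e by (simp add: incident_def trace_at_def)
      also have "\<dots> \<le> sum n V * ?S q"
        by (intro mult_right_mono S member_le_sum edge_ends(1)[OF e] finite_vertices) (use n in auto)
      finally have "\<bar>?c x\<bar> \<le> M * ?S q" if "x \<in> {0..l e}" for x
        using edge_variation_le[OF H1 e that] by (simp add: M_def distrib_right)
      moreover have "AE x in lebesgue_on {0..l e}. x \<in> {0..l e}" by (rule AE_I2) simp
      moreover have "AE x in lebesgue_on {0..l e}. q e x = ?c x"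
        by (rule H1_repD(4)[OF H1_net_rep[OF H1 e]])
      ultimately show "AE x in lebesgue_on {0..l e}. \<bar>q e x\<bar> \<le> M * ?S q"
        by (auto elim: eventually_elim2)
    qed
    have "inner_net E l q q \<le> inner_net E l (\<lambda>_ _. M * ?S q) (\<lambda>_ _. M * ?S q)"
    proof (rule inner_net_mono[OF qL qL L2_net_const L2_net_const])
      show "AE_net E l (\<lambda>e x. q e x * q e x \<le> M * ?S q * (M * ?S q))"
        using bound
      proof (rule AE_net_mono)
        fix e x assume "\<bar>q e x\<bar> \<le> M * ?S q"
        then have "\<bar>q e x\<bar> * \<bar>q e x\<bar> \<le> M * ?S q * (M * ?S q)"
          by (intro mult_mono) auto
        then show "q e x * q e x \<le> M * ?S q * (M * ?S q)" by simp
      qed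
    qed
    also have "\<dots> = (L * (M * ?S q))\<^sup>2"
    proof -
      have c: "inner_net E l (\<lambda>_ _. k) (\<lambda>_ _. k) = k\<^sup>2 * inner_net E l (\<lambda>_ _. 1) (\<lambda>_ _. 1)" for k
        by (simp add: inner_net_def sum_distrib_left power2_eq_square mult_ac)
      show ?thesis unfolding c[of "M * ?S q"] by (simp add: L_def power_mult_distrib L2_norm_power2 mult_ac)
    qed
    finally have "L2_norm E l q \<le> L * (M * ?S q)"
      using L M S[of q] by (intro power2_le_imp_le[of "L2_norm E l q"] mult_nonneg_nonneg) (simp_all only: L2_norm_power2)
    also have "\<dots> \<le> L * (M * (L * L2_norm E l (dx l q)))"
      using L M SL by (intro mult_left_mono) auto
    finally show ?thesis by (simp add: mult_ac)
  qed
  moreover have "0 \<le> L * (M * L)" using L M by simp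
  ultimately show ?thesis by blast
qed

end

subsection \<open>The stationary problem\<close>

text \<open>Gaussian elimination: solving row k for its own unknown leaves a system on S whose
  matrix is the Schur complement \<open>M'\<close>, and this is again positive definite.\<close>

lemma pos_def_solvable:
  fixes M :: "'a \<Rightarrow> 'a \<Rightarrow> real"
  assumes "finite S"
    and "\<And>x. \<exists>i\<in>S. x i \<noteq> 0 \<Longrightarrow> (\<Sum>i\<in>S. x i * (\<Sum>j\<in>S. M i j * x j)) > 0"
  shows "\<exists>x. \<forall>i\<in>S. (\<Sum>j\<in>S. M i j * x j) = b i"
  using assms
proof (induction S arbitrary: M b rule: finite_induct)
  case empty
  then show ?case by simp
next
  case (insert k S)
  note fin = insert.hyps
  have sum_S: "(\<Sum>j\<in>S. f j * (if j = k then y else z j)) = (\<Sum>j\<in>S. f j * z j)" for f z :: "'a \<Rightarrow> real" and y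
    by (rule sum.cong) (use fin in auto)
  \<comment> \<open>The pivot is the value of the form at the k-th unit vector.\<close>
  have kk: "M k k > 0"
  proof -
    have "(\<Sum>i\<in>S. (if i = k then 1 else 0) * f i) = 0" for f :: "'a \<Rightarrow> real"
      by (rule sum.neutral) (use fin in auto)
    then show ?thesis
      using insert.prems[of "\<lambda>j. if j = k then 1 else 0"] fin by (simp add: sum_S)
  qed
  define M' where "M' i j = M i j - M i k * M k j / M k k" for i j
  have M': "(\<Sum>j\<in>S. M' i j * x j) = (\<Sum>j\<in>S. M i j * x j) - M i k * (\<Sum>j\<in>S. M k j * x j) / M k k" for i x
    by (simp add: M'_def left_diff_distrib sum_subtractf sum_distrib_left sum_divide_distrib mult.assoc)
  have "\<exists>x. \<forall>i\<in>S. (\<Sum>j\<in>S. M' i j * x j) = b i - M i k * b k / M k k"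
  proof (rule insert.IH)
    fix x :: "'a \<Rightarrow> real" assume x: "\<exists>i\<in>S. x i \<noteq> 0"
    \<comment> \<open>With this entry at k, row k of M vanishes on the extended vector, and the form
      of M there equals the form of \<open>M'\<close> at x.\<close>
    define y where "y = - (\<Sum>j\<in>S. M k j * x j) / M k k"
    let ?x = "\<lambda>j. if j = k then y else x j"
    have row: "(\<Sum>j\<in>insert k S. M i j * ?x j) = M i k * y + (\<Sum>j\<in>S. M i j * x j)" for i
      using fin by (simp add: sum_S)
    have "0 < (\<Sum>i\<in>insert k S. ?x i * (\<Sum>j\<in>insert k S. M i j * ?x j))"
      using x fin by (intro insert.prems) auto
    also have "\<dots> = y * (M k k * y + (\<Sum>j\<in>S. M k j * x j))
        + (\<Sum>i\<in>S. ?x i * (M i k * y + (\<Sum>j\<in>S. M i j * x j)))"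
      unfolding row using fin by simp
    also have "M k k * y + (\<Sum>j\<in>S. M k j * x j) = 0"
      using kk by (simp add: y_def)
    also have "(\<Sum>i\<in>S. ?x i * (M i k * y + (\<Sum>j\<in>S. M i j * x j))) = (\<Sum>i\<in>S. x i * (\<Sum>j\<in>S. M' i j * x j))"
      by (rule sum.cong) (use fin in \<open>auto simp: M' y_def\<close>)
    finally show "0 < (\<Sum>i\<in>S. x i * (\<Sum>j\<in>S. M' i j * x j))" by simp
  qed
  then obtain x where x: "\<And>i. i \<in> S \<Longrightarrow> (\<Sum>j\<in>S. M' i j * x j) = b i - M i k * b k / M k k" by blast
  \<comment> \<open>Back substitution into row k.\<close>
  define y where "y = (b k - (\<Sum>j\<in>S. M k j * x j)) / M k k"
  have *: "(\<Sum>j\<in>insert k S. M i j * (if j = k then y else x j)) = b i" if "i \<in> insert k S" for i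
  proof -
    have row: "(\<Sum>j\<in>insert k S. M i j * (if j = k then y else x j)) = M i k * y + (\<Sum>j\<in>S. M i j * x j)"
      using fin by (simp add: sum_S)
    show ?thesis
    proof (cases "i = k")
      case True
      then show ?thesis using row kk by (simp add: y_def)
    next
      case False
      then have "i \<in> S" using that by simp
      note x[OF this, unfolded M']
      moreover have "M i k * y = M i k * b k / M k k - M i k * (\<Sum>j\<in>S. M k j * x j) / M k k"
        by (simp add: y_def diff_divide_distrib right_diff_distrib)
      ultimately show ?thesis unfolding row by linarith
    qed
  qed
  show ?case by (rule exI[of _ "\<lambda>j. if j = k then y else x j"], rule ballI, rule *)
qed

context network
begin

lemma stationary_solutionD:
  assumes "stationary_solution V E l a f g u p"
  shows "u \<in> H_div V E l" "p \<in> H1_0 V E l"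
    "AE_net E l (\<lambda>e x. dx l p e x + a e x * u e x = f e x)" "AE_net E l (\<lambda>e x. dx l u e x = g e x)"
    "u \<in> L2_net E l" "p \<in> L2_net E l" "dx l u \<in> L2_net E l" "dx l p \<in> L2_net E l"
  using assms H1_net_L2 dx_L2 H_div_H1 H1_0_H1 unfolding stationary_solution_def by blast+

lemma stationary_solution_comb:
  assumes "stationary_solution V E l a f g u p" "stationary_solution V E l a f' g' u' p'"
  shows "stationary_solution V E l a (\<lambda>e x. f e x + k * f' e x) (\<lambda>e x. g e x + k * g' e x)
    (\<lambda>e x. u e x + k * u' e x) (\<lambda>e x. p e x + k * p' e x)"
proof -
  note D = stationary_solutionD[OF assms(1)] and D' = stationary_solutionD[OF assms(2)]
  note dp = H1_net_comb(2)[OF H1_0_H1[OF D(2)] H1_0_H1[OF D'(2)], where k = k]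
  note du = H1_net_comb(2)[OF H_div_H1[OF D(1)] H_div_H1[OF D'(1)], where k = k]
  have "AE_net E l (\<lambda>e x. dx l (\<lambda>e x. p e x + k * p' e x) e x + a e x * (u e x + k * u' e x) = f e x + k * f' e x)"
    using AE_net_conj[OF dp AE_net_conj[OF D(3) D'(3)]]
  proof (rule AE_net_mono, elim conjE)
    fix e x
    assume p: "dx l (\<lambda>e x. p e x + k * p' e x) e x = dx l p e x + k * dx l p' e x"
      and "dx l p e x + a e x * u e x = f e x" "dx l p' e x + a e x * u' e x = f' e x"
    then have "f e x = dx l p e x + a e x * u e x" "f' e x = dx l p' e x + a e x * u' e x" by simp_all
    then show "dx l (\<lambda>e x. p e x + k * p' e x) e x + a e x * (u e x + k * u' e x) = f e x + k * f' e x"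
      unfolding p by (simp add: algebra_simps)
  qed
  moreover have "AE_net E l (\<lambda>e x. dx l (\<lambda>e x. u e x + k * u' e x) e x = g e x + k * g' e x)"
    using AE_net_conj[OF du AE_net_conj[OF D(4) D'(4)]]
    by (rule AE_net_mono) auto
  ultimately show ?thesis
    unfolding stationary_solution_def using H_div_comb H1_0_comb D(1,2) D'(1,2) by blast
qed

text \<open>The weak form of a v + dx q = 0. Choosing u = v yields the a priori bound; choosing u
  with dx u = 0 shows a v orthogonal to u, which later controls the time derivative of the
  flux.\<close>

lemma stationary_solution_test:
  assumes a: "bounded_weight E l C0 C1 a" and s: "stationary_solution V E l a (\<lambda>_ _. 0) g v q"
    and u: "u \<in> H_div V E l"
  shows "inner_net E l (\<lambda>e x. a e x * v e x) u = inner_net E l q (dx l u)"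
proof -
  note D = stationary_solutionD[OF s]
  note uL = H1_net_L2[OF H_div_H1[OF u]]
  have "inner_net E l (\<lambda>e x. a e x * v e x) u = inner_net E l (\<lambda>e x. (- 1) * dx l q e x) u"
    by (intro inner_net_cong bounded_weight_L2[OF a] L2_net_cmult uL D AE_net_mono[OF D(3)]) auto
  also have "\<dots> = - inner_net E l (dx l q) u"
    using inner_net_cmult_left[OF D(8) uL, of "- 1"] by simp
  also have "\<dots> = inner_net E l q (dx l u)"
    using inner_net_by_parts[OF u D(2)]
      inner_net_commute[of E l "dx l q" u] inner_net_commute[of E l "dx l u" q] by simp
  finally show ?thesis .
qed

lemma stationary_solution_norm_dx:
  assumes a: "bounded_weight E l C0 C1 a" and s: "stationary_solution V E l a (\<lambda>_ _. 0) g v q"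
  shows "L2_norm E l (dx l q) \<le> C1 * L2_norm E l v"
proof -
  note D = stationary_solutionD[OF s]
  have "L2_norm E l (dx l q) = L2_norm E l (\<lambda>e x. (- 1) * (a e x * v e x))"
    by (intro L2_norm_cong bounded_weight_L2[OF a] L2_net_cmult D AE_net_mono[OF D(3)]) auto
  also have "\<dots> = L2_norm E l (\<lambda>e x. a e x * v e x)"
    by (simp add: L2_norm_def inner_net_def)
  also have "\<dots> \<le> C1 * L2_norm E l v" by (rule bounded_weight_norm[OF a D(5)])
  finally show ?thesis .
qed

text \<open>Testing with v gives C0 |v|^2 \<le> (g, q) \<le> |g| |q|. Poincare's inequality and dx q
  = - a v bound |q| by K C1 |v|, and one factor |v| cancels.\<close>

lemma stationary_solution_bound:
  assumes b: "boundary_vertices V E \<noteq> {}" and a: "bounded_weight E l C0 C1 a"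
  shows "\<exists>K\<ge>0. \<forall>g\<in>L2_net E l. \<forall>v q. stationary_solution V E l a (\<lambda>_ _. 0) g v q \<longrightarrow>
    L2_norm E l v \<le> K * L2_norm E l g"
proof -
  obtain K where K: "K \<ge> 0" "\<And>q. q \<in> H1_0 V E l \<Longrightarrow> L2_norm E l q \<le> K * L2_norm E l (dx l q)"
    using Poincare[OF b] by blast
  have C: "0 < C0" "0 < C1" using a by (auto simp: bounded_weight_def)
  have "L2_norm E l v \<le> (K * C1 / C0) * L2_norm E l g"
    if g: "g \<in> L2_net E l" and s: "stationary_solution V E l a (\<lambda>_ _. 0) g v q" for g v q
  proof (cases "L2_norm E l v = 0")
    case True
    then show ?thesis using K C by (simp add: L2_norm_nonneg)
  next
    case False
    note D = stationary_solutionD[OF s]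
    have pos: "L2_norm E l v > 0" using False L2_norm_nonneg[of E l v] by simp
    have "C0 * (L2_norm E l v)\<^sup>2 \<le> inner_net E l (\<lambda>e x. a e x * v e x) v"
      using bounded_weight_lower[OF a D(5)] by (simp add: L2_norm_power2)
    also have "\<dots> = inner_net E l (dx l v) q"
      using stationary_solution_test[OF a s D(1)] inner_net_commute[of E l q] by simp
    also have "\<dots> = inner_net E l g q" by (rule inner_net_cong[OF D(7) g D(6) D(4)])
    also have "\<dots> \<le> L2_norm E l g * L2_norm E l q"
      using inner_net_Cauchy_Schwarz[OF g D(6)] by simp
    also have "\<dots> \<le> L2_norm E l g * (K * (C1 * L2_norm E l v))"
      by (intro mult_left_mono order_trans[OF K(2)[OF D(2)]] stationary_solution_norm_dx[OF a s] K(1) L2_norm_nonneg)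
    finally have "(C0 * L2_norm E l v) * L2_norm E l v \<le> (K * C1 * L2_norm E l g) * L2_norm E l v"
      by (simp add: power2_eq_square mult_ac)
    then have "C0 * L2_norm E l v \<le> K * C1 * L2_norm E l g" using pos by simp
    then show ?thesis using C by (simp add: field_simps)
  qed
  moreover have "0 \<le> K * C1 / C0" using K C by simp
  ultimately show ?thesis by blast
qed

text \<open>The difference of two solutions has zero data. The a priori bound kills its flux, the
  first equation then kills dx q, and Poincare's inequality kills q.\<close>

lemma stationary_solution_unique:
  assumes b: "boundary_vertices V E \<noteq> {}" and a: "bounded_weight E l C0 C1 a"
    and s: "stationary_solution V E l a f g u p" "stationary_solution V E l a f g u' p'"
  shows "AE_net E l (\<lambda>e x. u e x = u' e x \<and> p e x = p' e x)"
proof -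
  define v q where "v = (\<lambda>e x. u e x + (- 1) * u' e x)" and "q = (\<lambda>e x. p e x + (- 1) * p' e x)"
  have s0: "stationary_solution V E l a (\<lambda>_ _. 0) (\<lambda>_ _. 0) v q"
    using stationary_solution_comb[OF s, of "- 1"] by (simp add: v_def q_def)
  note D = stationary_solutionD[OF s0]
  have n0: "L2_norm E l (\<lambda>_ _. 0) = 0" by (simp add: L2_norm_def inner_net_def)
  obtain K where K: "\<And>g v q. g \<in> L2_net E l \<Longrightarrow> stationary_solution V E l a (\<lambda>_ _. 0) g v q \<Longrightarrow>
    L2_norm E l v \<le> K * L2_norm E l g" using stationary_solution_bound[OF b a] by blast
  have v0: "L2_norm E l v = 0" using K[OF L2_net_const s0] L2_norm_nonneg[of E l v] n0 by simp
  then have "L2_norm E l (dx l q) = 0"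
    using stationary_solution_norm_dx[OF a s0] L2_norm_nonneg[of E l "dx l q"] by simp
  moreover obtain K' where "\<And>q. q \<in> H1_0 V E l \<Longrightarrow> L2_norm E l q \<le> K' * L2_norm E l (dx l q)"
    using Poincare[OF b] by blast
  ultimately have q0: "L2_norm E l q = 0" using D(2) L2_norm_nonneg[of E l q] by fastforce
  have "AE_net E l (\<lambda>e x. v e x = 0)" "AE_net E l (\<lambda>e x. q e x = 0)"
    using v0 q0 by (intro inner_net_eq_0_imp_AE finite_edges D(5,6); simp flip: L2_norm_power2)+
  from AE_net_conj[OF this] show ?thesis
    by (rule AE_net_mono) (simp add: v_def q_def)
qed

section \<open>Existence of stationary solutions\<close>

lemma H1_rep_primitive:
  assumes "g \<in> L2_interval r"
  shows "H1_rep r (\<lambda>x. k + primitive g x) g (\<lambda>x. k + primitive g x)"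
  unfolding H1_rep_def
  by (auto intro!: borel_measurable_lebesgue_on_continuous continuous_intros
      primitive_continuous L2_integrable assms)

text \<open>The form is the Dirichlet energy of a weighted graph: the sum over the edges of (y (snd
  e) - y (fst e))^2 / A e, with x extended by 0 to y. If it were 0, y would be constant along edges,
  and connectedness would carry the value 0 from a boundary vertex to every vertex.\<close>

lemma dirichlet_laplacian_pos:
  fixes A :: "'v \<times> 'v \<Rightarrow> real"
  assumes b: "boundary_vertices V E \<noteq> {}" and A: "\<And>e. e \<in> E \<Longrightarrow> A e > 0"
    and S: "S = interior_vertices V E" and x: "\<exists>i\<in>S. x i \<noteq> 0"
  shows "0 < (\<Sum>i\<in>S. x i * (\<Sum>j\<in>S. (\<Sum>e\<in>E. edge_sign e i * edge_sign e j / A e) * x j))"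
proof -
  have SV: "S \<subseteq> V" by (auto simp: S interior_vertices_def)
  define y where "y v = (if v \<in> S then x v else 0)" for v
  define D where "D e = (\<Sum>j\<in>S. edge_sign e j * x j)" for e
  have D: "D e = y (snd e) - y (fst e)" if "e \<in> E" for e
  proof -
    have "D e = (\<Sum>v\<in>V. edge_sign e v * y v)"
      unfolding D_def using SV finite_vertices by (intro sum.mono_neutral_cong_left) (auto simp: y_def)
    then show ?thesis using sum_edge_sign[OF that] by simp
  qed
  have "(\<Sum>i\<in>S. x i * (\<Sum>j\<in>S. (\<Sum>e\<in>E. edge_sign e i * edge_sign e j / A e) * x j))
    = (\<Sum>i\<in>S. \<Sum>j\<in>S. \<Sum>e\<in>E. (edge_sign e i * x i) * (edge_sign e j * x j) / A e)"
    by (simp add: sum_distrib_left sum_distrib_right mult_ac)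
  also have "\<dots> = (\<Sum>e\<in>E. \<Sum>i\<in>S. \<Sum>j\<in>S. (edge_sign e i * x i) * (edge_sign e j * x j) / A e)"
    by (subst (2) sum.swap, subst sum.swap) (rule refl)
  also have "\<dots> = (\<Sum>e\<in>E. (D e)\<^sup>2 / A e)"
    by (simp add: D_def power2_eq_square sum_product sum_divide_distrib)
  finally have eq: "(\<Sum>i\<in>S. x i * (\<Sum>j\<in>S. (\<Sum>e\<in>E. edge_sign e i * edge_sign e j / A e) * x j))
    = (\<Sum>e\<in>E. (D e)\<^sup>2 / A e)" .
  have nn: "0 \<le> (D e)\<^sup>2 / A e" if "e \<in> E" for e using A[OF that] by simp
  have "(\<Sum>e\<in>E. (D e)\<^sup>2 / A e) \<noteq> 0"
  proof
    assume "(\<Sum>e\<in>E. (D e)\<^sup>2 / A e) = 0"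
    then have "\<forall>e\<in>E. (D e)\<^sup>2 / A e = 0"
      using sum_nonneg_eq_0_iff[OF finite_edges nn] by simp
    then have edge: "y (snd e) = y (fst e)" if "e \<in> E" for e
      using A[OF that] D[OF that] that by fastforce
    obtain v0 where v0: "v0 \<in> boundary_vertices V E" using b by blast
    obtain i where i: "i \<in> S" "x i \<noteq> 0" using x by blast
    have "(v0, i) \<in> (E \<union> E\<inverse>)\<^sup>*"
      using v0 i SV by (intro connected_undirected) (auto simp: boundary_vertices_def)
    then have "y i = y v0"
    proof (induction rule: rtrancl_induct)
      case (step p q)
      then show ?case using edge[of "(p, q)"] edge[of "(q, p)"] by auto
    qed simp
    then show False using v0 i by (auto simp: y_def S boundary_vertices_def)
  qed
  then show ?thesis unfolding eq using sum_nonneg[of E, OF nn] by fastforce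
qed

text \<open>On every edge the solution is determined by its end values of \<open>p\<close>; the balance conditions at
  the interior vertices form a discrete Dirichlet problem for these values.\<close>

lemma stationary_solution_ex:
  assumes b: "boundary_vertices V E \<noteq> {}" and a: "bounded_weight E l C0 C1 a"
    and f: "f \<in> L2_net E l" and g: "g \<in> L2_net E l"
  shows "\<exists>u p. stationary_solution V E l a f g u p"
proof -
  define S where "S = interior_vertices V E"
  have SV: "S \<subseteq> V" and Sfin: "finite S" using finite_vertices by (auto simp: S_def interior_vertices_def)
  have aL: "a e \<in> L2_interval (l e)" and gL: "g e \<in> L2_interval (l e)" and fL: "f e \<in> L2_interval (l e)" if "e \<in> E" for e
    using that a f g by (auto simp: bounded_weight_def L2_net_def)
  have C: "0 < C0" using a by (auto simp: bounded_weight_def)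
  \<comment> \<open>The resistance of the edge; its reciprocal is the weight in the discrete
    Laplacian.\<close>
  define A where "A e = primitive (a e) (l e)" for e
  have A: "A e > 0" if e: "e \<in> E" for e
  proof -
    have "0 < C0 * l e" using C length_pos[OF e] by simp
    also have "\<dots> = primitive (\<lambda>_. C0) (l e)" using length_pos[OF e] by (simp add: primitive_const)
    also have "\<dots> \<le> A e" unfolding A_def primitive_def
      by (intro integral_mono_AE integrable_const_interval L2_integrable aL e)
         (use a e in \<open>auto simp: bounded_weight_def AE_net_def elim: eventually_mono\<close>)
    finally show ?thesis .
  qed
  define G where "G e = primitive (g e)" for e
  \<comment> \<open>Inserting u = U + G into the first equation leaves dx p = h - U a, with one
    constant U free on each edge.\<close>
  define h where "h = (\<lambda>e x. f e x + (- 1) * (a e x * G e x))"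
  have GL: "G \<in> L2_net E l"
    unfolding L2_net_def G_def using L2_continuous[OF primitive_continuous[OF L2_integrable[OF gL]]] by blast
  have hL: "h \<in> L2_net E l"
    unfolding h_def by (intro L2_net_comb f bounded_weight_L2[OF a GL])
  define m where "m e = primitive (h e) (l e)" for e
  \<comment> \<open>The contribution of g to the trace of u at the end v. If v is not an end of e,
    the value is cancelled by \<open>edge_sign\<close>.\<close>
  define T where "T e v = (if v = fst e then 0 else G e (l e))" for e v
  \<comment> \<open>Flux balance at v after U has been expressed by the vertex values: their
    differences D e over A e on the left, the known terms on the right.\<close>
  have "\<exists>\<pi>. \<forall>v\<in>S. (\<Sum>w\<in>S. (\<Sum>e\<in>E. edge_sign e v * edge_sign e w / A e) * \<pi> w)
      = (\<Sum>e\<in>E. edge_sign e v * (m e / A e + T e v))"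
    by (rule pos_def_solvable[OF Sfin]) (rule dirichlet_laplacian_pos[OF b A S_def])
  then obtain \<pi>0 where \<pi>0: "\<And>v. v \<in> S \<Longrightarrow> (\<Sum>w\<in>S. (\<Sum>e\<in>E. edge_sign e v * edge_sign e w / A e) * \<pi>0 w)
      = (\<Sum>e\<in>E. edge_sign e v * (m e / A e + T e v))" by blast
  \<comment> \<open>The value 0 off S builds in the boundary condition for p.\<close>
  define \<pi> where "\<pi> v = (if v \<in> S then \<pi>0 v else 0)" for v
  define D where "D e = \<pi> (snd e) - \<pi> (fst e)" for e
  have D: "D e = (\<Sum>w\<in>S. edge_sign e w * \<pi>0 w)" if "e \<in> E" for e
  proof -
    have "D e = (\<Sum>v\<in>V. edge_sign e v * \<pi> v)" using sum_edge_sign[OF that] by (simp add: D_def)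
    also have "\<dots> = (\<Sum>w\<in>S. edge_sign e w * \<pi>0 w)"
      using SV finite_vertices by (intro sum.mono_neutral_cong_right) (auto simp: \<pi>_def)
    finally show ?thesis .
  qed
  \<comment> \<open>The one constant for which p runs from \<pi> (fst e) to \<pi> (snd e) along the
    edge.\<close>
  define U where "U e = (m e - D e) / A e" for e
  define u where "u = (\<lambda>e x. U e + primitive (g e) x)"
  define p where "p = (\<lambda>e x. \<pi> (fst e) + primitive (\<lambda>x. h e x + (- U e) * a e x) x)"
  have Ru: "H1_rep (l e) (u e) (g e) (u e)" if "e \<in> E" for e
    unfolding u_def by (rule H1_rep_primitive[OF gL[OF that]])
  have Rp: "H1_rep (l e) (p e) (\<lambda>x. h e x + (- U e) * a e x) (p e)" if "e \<in> E" for e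
    unfolding p_def by (intro H1_rep_primitive L2_add L2_cmult aL L2_netD[OF hL] that)
  note Nu = H1_netI[of u g u, OF Ru] and Np = H1_netI[of p "\<lambda>e x. h e x + (- U e) * a e x" p, OF Rp]
  have p_end: "p e (l e) = \<pi> (snd e)" if e: "e \<in> E" for e
  proof -
    have "primitive (\<lambda>x. h e x + (- U e) * a e x) (l e) = m e + (- U e) * A e"
      unfolding m_def A_def using length_pos[OF e]
      by (intro primitive_add[of "l e"] L2_integrable L2_netD[OF hL e] aL[OF e]) auto
    also have "\<dots> = D e" using A[OF e] by (simp add: U_def)
    finally show ?thesis by (simp add: p_def D_def)
  qed
  have tp: "trace_at l p e v = \<pi> v" if "e \<in> incident E v" for e v
    using that Np(3)[of e v] p_end[of e] by (auto simp: incident_def p_def)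
  have "p \<in> H1_0 V E l"
    unfolding H1_0_def using Np(1) tp by (auto simp: \<pi>_def S_def boundary_vertices_def)
  moreover have "u \<in> H_div V E l"
  proof -
    have "(\<Sum>e\<in>incident E v. edge_sign e v * trace_at l u e v) = 0" if v: "v \<in> S" for v
    proof -
      have "(\<Sum>e\<in>incident E v. edge_sign e v * trace_at l u e v) = (\<Sum>e\<in>E. edge_sign e v * trace_at l u e v)"
        by (rule sum_incident)
      also have "\<dots> = (\<Sum>e\<in>E. edge_sign e v * (m e / A e + T e v) - edge_sign e v * D e / A e)"
      proof (rule sum.cong[OF refl])
        fix e assume "e \<in> E"
        then have "trace_at l u e v = u e (if v = fst e then 0 else l e)"
          using Nu(3)[of e v] by blast
        also have "\<dots> = m e / A e + T e v - D e / A e"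
          by (simp add: u_def U_def T_def G_def diff_divide_distrib)
        finally show "edge_sign e v * trace_at l u e v = edge_sign e v * (m e / A e + T e v) - edge_sign e v * D e / A e"
          by (simp add: right_diff_distrib)
      qed
      also have "\<dots> = (\<Sum>e\<in>E. edge_sign e v * (m e / A e + T e v)) - (\<Sum>e\<in>E. edge_sign e v * D e / A e)"
        by (rule sum_subtractf)
      also have "(\<Sum>e\<in>E. edge_sign e v * D e / A e) = (\<Sum>e\<in>E. \<Sum>w\<in>S. edge_sign e v * edge_sign e w / A e * \<pi>0 w)"
        by (rule sum.cong) (simp_all add: D sum_distrib_left sum_divide_distrib mult_ac)
      also have "\<dots> = (\<Sum>w\<in>S. (\<Sum>e\<in>E. edge_sign e v * edge_sign e w / A e) * \<pi>0 w)"
        by (subst sum.swap) (simp add: sum_distrib_right)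
      finally show ?thesis using \<pi>0[OF v] by simp
    qed
    then show ?thesis using Nu(1) by (simp add: H_div_def S_def)
  qed
  moreover have "AE_net E l (\<lambda>e x. dx l p e x + a e x * u e x = f e x)"
  proof (rule AE_net_mono)
    show "AE_net E l (\<lambda>e x. dx l p e x = h e x + (- U e) * a e x)"
      using Np(2) by blast
    fix e x assume q: "dx l p e x = h e x + (- U e) * a e x"
    have "u e x = U e + G e x" "h e x = f e x - a e x * G e x" by (simp_all add: u_def G_def h_def)
    then show "dx l p e x + a e x * u e x = f e x"
      unfolding q by (simp add: algebra_simps)
  qed
  ultimately have "stationary_solution V E l a f g u p"
    using Nu(2) by (simp add: stationary_solution_def)
  then show ?thesis by blast
qed

end

subsection \<open>Differentiation in \<open>L\<^sup>2(\<E>)\<close>\<close>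

lemma L2_norm_triangle:
  assumes "w \<in> L2_net E l" "z \<in> L2_net E l"
  shows "L2_norm E l (\<lambda>e x. w e x + k * z e x) \<le> L2_norm E l w + \<bar>k\<bar> * L2_norm E l z"
proof (rule power2_le_imp_le)
  have "k * inner_net E l w z \<le> \<bar>k\<bar> * (L2_norm E l w * L2_norm E l z)"
    using mult_left_mono[OF inner_net_Cauchy_Schwarz[OF assms], of "\<bar>k\<bar>"]
    by (metis abs_ge_self abs_ge_zero abs_mult order_trans)
  then show "(L2_norm E l (\<lambda>e x. w e x + k * z e x))\<^sup>2 \<le> (L2_norm E l w + \<bar>k\<bar> * L2_norm E l z)\<^sup>2"
    unfolding L2_norm_power2 inner_net_square_comb[OF assms] power2_sum power_mult_distrib power2_abs
    by (simp add: mult_ac)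
  show "0 \<le> L2_norm E l w + \<bar>k\<bar> * L2_norm E l z" by (simp add: L2_norm_nonneg)
qed

lemma L2_norm_minus: "L2_norm E l (\<lambda>e x. - w e x) = L2_norm E l w"
  by (simp add: L2_norm_def inner_net_def)

text \<open>With increments A and B the error is exactly (A, B) + (A, z) + (w, B). Membership is
  asked for only eventually, which suits limits within [0, \<infinity>) as well as limits from the
  right.\<close>

lemma inner_net_tendsto:
  assumes W: "\<forall>\<^sub>F s in F. W s \<in> L2_net E l" and Z: "\<forall>\<^sub>F s in F. Z s \<in> L2_net E l"
    and w: "w \<in> L2_net E l" and z: "z \<in> L2_net E l"
    and lim: "((\<lambda>s. L2_norm E l (\<lambda>e x. W s e x - w e x)) \<longlongrightarrow> 0) F"
      "((\<lambda>s. L2_norm E l (\<lambda>e x. Z s e x - z e x)) \<longlongrightarrow> 0) F"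
  shows "((\<lambda>s. inner_net E l (W s) (Z s)) \<longlongrightarrow> inner_net E l w z) F"
proof -
  let ?A = "\<lambda>s. L2_norm E l (\<lambda>e x. W s e x - w e x)" and ?B = "\<lambda>s. L2_norm E l (\<lambda>e x. Z s e x - z e x)"
  have "((\<lambda>s. inner_net E l (W s) (Z s) - inner_net E l w z) \<longlongrightarrow> 0) F"
  proof (rule Lim_null_comparison)
    show "((\<lambda>s. ?A s * ?B s + ?A s * L2_norm E l z + L2_norm E l w * ?B s) \<longlongrightarrow> 0) F"
      using lim by (auto intro!: tendsto_eq_intros)
    show "\<forall>\<^sub>F s in F. norm (inner_net E l (W s) (Z s) - inner_net E l w z)
        \<le> ?A s * ?B s + ?A s * L2_norm E l z + L2_norm E l w * ?B s"
      using W Z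
    proof eventually_elim
      case (elim s)
      define A B where "A = (\<lambda>e x. W s e x - w e x)" and "B = (\<lambda>e x. Z s e x - z e x)"
      have AB: "A \<in> L2_net E l" "B \<in> L2_net E l"
        unfolding A_def B_def using elim w z by (auto intro: L2_net_diff)
      have WZ: "W s = (\<lambda>e x. w e x + 1 * A e x)" "Z s = (\<lambda>e x. z e x + 1 * B e x)"
        by (simp_all add: A_def B_def fun_eq_iff)
      have "inner_net E l (W s) (Z s) = inner_net E l w (Z s) + inner_net E l A (Z s)"
        using inner_net_comb_left[OF w AB(1) elim(2), of 1] unfolding WZ(1) by simp
      also have "inner_net E l w (Z s) = inner_net E l w z + inner_net E l w B"
        using inner_net_comb_right[OF z AB(2) w, of 1] unfolding WZ(2) by simp
      also have "inner_net E l A (Z s) = inner_net E l A z + inner_net E l A B"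
        using inner_net_comb_right[OF z AB(2) AB(1), of 1] unfolding WZ(2) by simp
      finally show ?case
        using inner_net_Cauchy_Schwarz[OF AB] inner_net_Cauchy_Schwarz[OF AB(1) z]
          inner_net_Cauchy_Schwarz[OF w AB(2)]
        unfolding A_def[symmetric] B_def[symmetric] by simp
    qed
  qed
  then show ?thesis by (simp add: LIM_zero_iff)
qed

text \<open>The derivative clause of \<open>time_C1\<close> at a single time t, where
  \<open>w'\<close> is the value of the derivative; one-sided at 0 through the filter.\<close>

definition L2_deriv ::
  "('v \<times> 'v) set \<Rightarrow> ('v \<times> 'v \<Rightarrow> real) \<Rightarrow> (real \<Rightarrow> 'v netfun) \<Rightarrow> 'v netfun \<Rightarrow> real \<Rightarrow> bool" where
  "L2_deriv E l w w' t \<longleftrightarrow>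
     ((\<lambda>s. L2_norm E l (\<lambda>e x. (w s e x - w t e x) / (s - t) - w' e x)) \<longlongrightarrow> 0) (at t within {0..})"

lemma L2_net_quotient:
  "w \<in> L2_net E l \<Longrightarrow> z \<in> L2_net E l \<Longrightarrow> (\<lambda>e x. (w e x - z e x) / k) \<in> L2_net E l"
  using L2_net_cmult[OF L2_net_diff, of w E l z "1 / k"] by simp

lemma eventually_at_within_nonneg:
  "(\<And>s. 0 \<le> s \<Longrightarrow> s \<noteq> t \<Longrightarrow> P s) \<Longrightarrow> \<forall>\<^sub>F s in at t within {0..}. P (s::real)"
  by (simp add: eventually_at_filter)

text \<open>With difference quotients W and Z, w s = w t + (s - t) W s and likewise for z.
  Bilinearity turns the quotient of the inner products into (W, z t) + (w t, Z) + (s - t) (W, Z),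
  whose last term vanishes in the limit.\<close>

lemma L2_deriv_inner:
  assumes w: "\<And>s. 0 \<le> s \<Longrightarrow> w s \<in> L2_net E l" and z: "\<And>s. 0 \<le> s \<Longrightarrow> z s \<in> L2_net E l"
    and w': "w' \<in> L2_net E l" and z': "z' \<in> L2_net E l" and t: "0 \<le> t"
    and d: "L2_deriv E l w w' t" "L2_deriv E l z z' t"
  shows "((\<lambda>s. inner_net E l (w s) (z s)) has_real_derivative
    inner_net E l w' (z t) + inner_net E l (w t) z') (at t within {0..})"
proof -
  define W Z where "W s = (\<lambda>e x. (w s e x - w t e x) / (s - t))"
    and "Z s = (\<lambda>e x. (z s e x - z t e x) / (s - t))" for s
  note wt = w[OF t] and zt = z[OF t]
  have W: "W s \<in> L2_net E l" and Z: "Z s \<in> L2_net E l" if "0 \<le> s" for s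
    unfolding W_def Z_def by (intro L2_net_quotient w z that t)+
  have evW: "\<forall>\<^sub>F s in at t within {0..}. W s \<in> L2_net E l"
    and evZ: "\<forall>\<^sub>F s in at t within {0..}. Z s \<in> L2_net E l"
    using W Z by (auto intro: eventually_at_within_nonneg)
  have lim: "((\<lambda>s. L2_norm E l (\<lambda>e x. W s e x - w' e x)) \<longlongrightarrow> 0) (at t within {0..})"
    "((\<lambda>s. L2_norm E l (\<lambda>e x. Z s e x - z' e x)) \<longlongrightarrow> 0) (at t within {0..})"
    using d unfolding L2_deriv_def W_def Z_def by simp_all
  have const: "((\<lambda>s. L2_norm E l (\<lambda>e x. y e x - y e x)) \<longlongrightarrow> 0) F" for y and F :: "real filter"
    by (simp add: L2_norm_def inner_net_def)
  have "((\<lambda>s. s - t) \<longlongrightarrow> t - t) (at t within {0..})"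
    by (intro tendsto_intros)
  then have "((\<lambda>s. inner_net E l (W s) (z t) + inner_net E l (w t) (Z s) + (s - t) * inner_net E l (W s) (Z s))
     \<longlongrightarrow> inner_net E l w' (z t) + inner_net E l (w t) z' + (t - t) * inner_net E l w' z') (at t within {0..})"
    by (intro tendsto_add tendsto_mult inner_net_tendsto evW evZ always_eventually allI wt zt w' z' lim const)
  moreover have "\<forall>\<^sub>F s in at t within {0..}.
      inner_net E l (W s) (z t) + inner_net E l (w t) (Z s) + (s - t) * inner_net E l (W s) (Z s)
    = (inner_net E l (w s) (z s) - inner_net E l (w t) (z t)) / (s - t)"
  proof (rule eventually_at_within_nonneg)
    fix s :: real assume s: "0 \<le> s" "s \<noteq> t"
    define k where "k = s - t"
    have k: "k \<noteq> 0" using s by (simp add: k_def)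
    have ws: "w s = (\<lambda>e x. w t e x + k * W s e x)" and zs: "z s = (\<lambda>e x. z t e x + k * Z s e x)"
      using k by (simp_all add: W_def Z_def k_def fun_eq_iff)
    have "inner_net E l (w s) (z s) = inner_net E l (w t) (z s) + k * inner_net E l (W s) (z s)"
      using inner_net_comb_left[OF wt W[OF s(1)] z[OF s(1)], of k] unfolding ws[symmetric] .
    also have "inner_net E l (w t) (z s) = inner_net E l (w t) (z t) + k * inner_net E l (w t) (Z s)"
      using inner_net_comb_right[OF zt Z[OF s(1)] wt, of k] unfolding zs[symmetric] .
    also have "inner_net E l (W s) (z s) = inner_net E l (W s) (z t) + k * inner_net E l (W s) (Z s)"
      using inner_net_comb_right[OF zt Z[OF s(1)] W[OF s(1)], of k] unfolding zs[symmetric] .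
    finally have "inner_net E l (w s) (z s) - inner_net E l (w t) (z t)
      = k * (inner_net E l (W s) (z t) + inner_net E l (w t) (Z s) + k * inner_net E l (W s) (Z s))"
      by (simp add: algebra_simps)
    then show "inner_net E l (W s) (z t) + inner_net E l (w t) (Z s) + (s - t) * inner_net E l (W s) (Z s)
      = (inner_net E l (w s) (z s) - inner_net E l (w t) (z t)) / (s - t)"
      using k unfolding k_def[symmetric] by simp
  qed
  ultimately have "((\<lambda>s. (inner_net E l (w s) (z s) - inner_net E l (w t) (z t)) / (s - t))
     \<longlongrightarrow> inner_net E l w' (z t) + inner_net E l (w t) z' + (t - t) * inner_net E l w' z') (at t within {0..})"
    by (rule Lim_transform_eventually)
  then show ?thesis by (simp add: has_field_derivative_iff)
qed

lemma L2_deriv_weight: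
  assumes m: "bounded_weight E l C0 C1 m" and w: "\<And>s. 0 \<le> s \<Longrightarrow> w s \<in> L2_net E l"
    and w': "w' \<in> L2_net E l" and t: "0 \<le> t" and d: "L2_deriv E l w w' t"
  shows "L2_deriv E l (\<lambda>s e x. m e x * w s e x) (\<lambda>e x. m e x * w' e x) t"
  unfolding L2_deriv_def
proof (rule Lim_null_comparison)
  show "((\<lambda>s. C1 * L2_norm E l (\<lambda>e x. (w s e x - w t e x) / (s - t) - w' e x)) \<longlongrightarrow> 0) (at t within {0..})"
    using tendsto_mult_right_zero[OF d[unfolded L2_deriv_def]] .
  show "\<forall>\<^sub>F s in at t within {0..}. norm (L2_norm E l (\<lambda>e x. (m e x * w s e x - m e x * w t e x) / (s - t) - m e x * w' e x))
    \<le> C1 * L2_norm E l (\<lambda>e x. (w s e x - w t e x) / (s - t) - w' e x)"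
  proof (rule eventually_at_within_nonneg)
    fix s :: real assume s: "0 \<le> s"
    have "(\<lambda>e x. (m e x * w s e x - m e x * w t e x) / (s - t) - m e x * w' e x)
       = (\<lambda>e x. m e x * ((w s e x - w t e x) / (s - t) - w' e x))"
      by (simp add: right_diff_distrib)
    moreover have "L2_norm E l (\<lambda>e x. m e x * ((w s e x - w t e x) / (s - t) - w' e x))
      \<le> C1 * L2_norm E l (\<lambda>e x. (w s e x - w t e x) / (s - t) - w' e x)"
      by (intro bounded_weight_norm[OF m] L2_net_diff L2_net_quotient w s t w')
    ultimately show "norm (L2_norm E l (\<lambda>e x. (m e x * w s e x - m e x * w t e x) / (s - t) - m e x * w' e x))
      \<le> C1 * L2_norm E l (\<lambda>e x. (w s e x - w t e x) / (s - t) - w' e x)"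
      by (simp add: L2_norm_nonneg)
  qed
qed

lemma L2_deriv_comb:
  assumes w: "\<And>s. 0 \<le> s \<Longrightarrow> w s \<in> L2_net E l" and z: "\<And>s. 0 \<le> s \<Longrightarrow> z s \<in> L2_net E l"
    and w': "w' \<in> L2_net E l" and z': "z' \<in> L2_net E l" and t: "0 \<le> t"
    and d: "L2_deriv E l w w' t" "L2_deriv E l z z' t"
  shows "L2_deriv E l (\<lambda>s e x. w s e x + k * z s e x) (\<lambda>e x. w' e x + k * z' e x) t"
  unfolding L2_deriv_def
proof (rule Lim_null_comparison)
  let ?A = "\<lambda>s e x. (w s e x - w t e x) / (s - t) - w' e x"
  let ?B = "\<lambda>s e x. (z s e x - z t e x) / (s - t) - z' e x"
  show "((\<lambda>s. L2_norm E l (?A s) + \<bar>k\<bar> * L2_norm E l (?B s)) \<longlongrightarrow> 0) (at t within {0..})"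
    using tendsto_add[OF d(1)[unfolded L2_deriv_def] tendsto_mult_right_zero[OF d(2)[unfolded L2_deriv_def], of "\<bar>k\<bar>"]]
    by simp
  show "\<forall>\<^sub>F s in at t within {0..}. norm (L2_norm E l (\<lambda>e x. (w s e x + k * z s e x - (w t e x + k * z t e x)) / (s - t)
      - (w' e x + k * z' e x))) \<le> L2_norm E l (?A s) + \<bar>k\<bar> * L2_norm E l (?B s)"
  proof (rule eventually_at_within_nonneg)
    fix s :: real assume s: "0 \<le> s"
    have "(\<lambda>e x. (w s e x + k * z s e x - (w t e x + k * z t e x)) / (s - t) - (w' e x + k * z' e x))
      = (\<lambda>e x. ?A s e x + k * ?B s e x)"
      by (simp add: fun_eq_iff diff_divide_distrib add_divide_distrib algebra_simps)
    moreover have "L2_norm E l (\<lambda>e x. ?A s e x + k * ?B s e x) \<le> L2_norm E l (?A s) + \<bar>k\<bar> * L2_norm E l (?B s)"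
      by (intro L2_norm_triangle L2_net_diff L2_net_quotient w z s t w' z')
    ultimately show "norm (L2_norm E l (\<lambda>e x. (w s e x + k * z s e x - (w t e x + k * z t e x)) / (s - t)
      - (w' e x + k * z' e x))) \<le> L2_norm E l (?A s) + \<bar>k\<bar> * L2_norm E l (?B s)"
      by (simp add: L2_norm_nonneg)
  qed
qed

lemma L2_deriv_shift:
  assumes "0 \<le> h" "L2_deriv E l w w' (t + h)"
  shows "L2_deriv E l (\<lambda>s. w (s + h)) w' t"
proof -
  have "filterlim (\<lambda>s. s + h) (at (t + h) within {0..}) (at t within {0..})"
    unfolding filterlim_at
    by (intro conjI eventually_at_within_nonneg tendsto_intros) (use assms(1) in auto)
  from filterlim_compose[OF assms(2)[unfolded L2_deriv_def] this] show ?thesis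
    unfolding L2_deriv_def by simp
qed

text \<open>Forward increments suffice and keep t = 0 included. The squared, divided form is the one
  in which a decay estimate for increments passes to the derivative.\<close>

lemma L2_deriv_norm_tendsto:
  assumes w: "\<And>s. 0 \<le> s \<Longrightarrow> w s \<in> L2_net E l" and w': "w' \<in> L2_net E l" and t: "0 \<le> t"
    and d: "L2_deriv E l w w' t"
  shows "((\<lambda>h. (L2_norm E l (\<lambda>e x. w (t + h) e x - w t e x))\<^sup>2 / h\<^sup>2) \<longlongrightarrow> (L2_norm E l w')\<^sup>2) (at_right 0)"
proof -
  define W where "W h = (\<lambda>e x. (w (t + h) e x - w t e x) / h)" for h
  have "filterlim (\<lambda>h. t + h) (at t within {0..}) (at_right 0)"
    unfolding filterlim_at
    by (intro conjI tendsto_eq_intros) (use t in \<open>auto simp: eventually_at_filter\<close>)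
  from filterlim_compose[OF d[unfolded L2_deriv_def] this]
  have "((\<lambda>h. L2_norm E l (\<lambda>e x. W h e x - w' e x)) \<longlongrightarrow> 0) (at_right 0)"
    by (simp add: W_def)
  moreover have "\<forall>\<^sub>F h in at_right 0. W h \<in> L2_net E l"
    using eventually_at_right_less[of 0]
    by eventually_elim (unfold W_def, intro L2_net_quotient w, use t in auto)
  ultimately have "((\<lambda>h. inner_net E l (W h) (W h)) \<longlongrightarrow> inner_net E l w' w') (at_right 0)"
    by (intro inner_net_tendsto w')
  moreover have "inner_net E l (W h) (W h) = (L2_norm E l (\<lambda>e x. w (t + h) e x - w t e x))\<^sup>2 / h\<^sup>2" for h
    unfolding L2_norm_power2
    by (simp add: W_def inner_net_def power2_eq_square sum_divide_distrib)
  ultimately show ?thesis by (simp add: L2_norm_power2)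
qed

subsection \<open>Exponential decay\<close>

text \<open>The product exp (\<gamma> t) F(t) is nonincreasing. Derivative and inequality are asked
  for at positive times, where the equations hold; continuity brings in s = 0.\<close>

lemma Gronwall_decay:
  fixes F :: "real \<Rightarrow> real"
  assumes c: "continuous_on {0..} F" and d: "\<And>t. 0 < t \<Longrightarrow> (F has_real_derivative F' t) (at t)"
    and le: "\<And>t. 0 < t \<Longrightarrow> F' t \<le> - \<gamma> * F t" and st: "0 \<le> s" "s \<le> t"
  shows "F t \<le> exp (- \<gamma> * (t - s)) * F s"
proof -
  have "exp (\<gamma> * t) * F t \<le> exp (\<gamma> * s) * F s"
  proof (rule DERIV_nonpos_imp_decreasing_open[OF st(2)])
    fix x assume x: "s < x" "x < t"
    have "((\<lambda>t. exp (\<gamma> * t) * F t) has_real_derivative exp (\<gamma> * x) * (\<gamma> * F x + F' x)) (at x)"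
      using x st by (auto intro!: derivative_eq_intros d simp: algebra_simps)
    moreover have "exp (\<gamma> * x) * (\<gamma> * F x + F' x) \<le> 0"
      using le[of x] x st by (intro mult_nonneg_nonpos) auto
    ultimately show "\<exists>y. ((\<lambda>t. exp (\<gamma> * t) * F t) has_real_derivative y) (at x) \<and> y \<le> 0" by blast
  next
    show "continuous_on {s..t} (\<lambda>t. exp (\<gamma> * t) * F t)"
      using st by (intro continuous_intros continuous_on_subset[OF c]) auto
  qed
  then have "exp (- \<gamma> * t) * (exp (\<gamma> * t) * F t) \<le> exp (- \<gamma> * t) * (exp (\<gamma> * s) * F s)"
    by (intro mult_left_mono) auto
  then show ?thesis
    by (simp add: mult.assoc[symmetric] exp_add[symmetric] right_diff_distrib)
qed

text \<open>X and Y stand for the norms of u and p; P X Y and Q X^2 are the unwanted terms produced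
  by the correction. Young's inequality absorbs P X Y into half of C0 Y^2, and what remains is a
  multiple of X^2, paid for by the friction once \<epsilon> is small. The bound on \<epsilon> P
  keeps the corrected energy equivalent to the plain one.\<close>

lemma dissipation_constants:
  fixes C0 P Q :: real
  assumes C: "0 < C0" and P: "0 \<le> P" and Q: "0 \<le> Q"
  shows "\<exists>\<epsilon>>0. \<exists>\<delta>>0. \<epsilon> * P \<le> C0 / 2 \<and>
    (\<forall>X Y. - C0 * X\<^sup>2 - \<epsilon> * (C0 * Y\<^sup>2 - P * (X * Y) - Q * X\<^sup>2) \<le> - \<delta> * (X\<^sup>2 + Y\<^sup>2))"
proof -
  \<comment> \<open>The first two summands are the coefficient of X^2 after Young's inequality, P is
    there for the bound on \<epsilon> P, and 1 makes R positive.\<close>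
  define R where "R = P\<^sup>2 / (2 * C0) + Q + P + 1"
  have R: "R > 0" "P \<le> R" "P\<^sup>2 / (2 * C0) + Q \<le> R" using assms by (auto simp: R_def intro!: add_nonneg_pos)
  define \<epsilon> where "\<epsilon> = C0 / 2 / R"
  have e: "\<epsilon> > 0" "\<epsilon> * R = C0 / 2" using R C by (simp_all add: \<epsilon>_def)
  define \<delta> where "\<delta> = min (C0 / 2) (\<epsilon> * C0 / 2)"
  have d: "\<delta> > 0" "\<delta> \<le> C0 / 2" "\<delta> \<le> \<epsilon> * C0 / 2" using e C by (auto simp: \<delta>_def)
  have 1: "\<epsilon> * P \<le> C0 / 2" using mult_left_mono[OF R(2), of \<epsilon>] e by simp
  have "- C0 * X\<^sup>2 - \<epsilon> * (C0 * Y\<^sup>2 - P * (X * Y) - Q * X\<^sup>2) \<le> - \<delta> * (X\<^sup>2 + Y\<^sup>2)" for X Y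
  proof -
    have "0 \<le> (C0 * Y - P * X)\<^sup>2 / (2 * C0)" using C by simp
    also have "\<dots> = C0 / 2 * Y\<^sup>2 - P * (X * Y) + P\<^sup>2 / (2 * C0) * X\<^sup>2"
      using C by (simp add: power2_eq_square field_simps)
    finally have "P * (X * Y) \<le> C0 / 2 * Y\<^sup>2 + P\<^sup>2 / (2 * C0) * X\<^sup>2" by simp
    then have "P * (X * Y) + Q * X\<^sup>2 \<le> C0 / 2 * Y\<^sup>2 + (P\<^sup>2 / (2 * C0) + Q) * X\<^sup>2"
      by (simp add: algebra_simps)
    also have "\<dots> \<le> C0 / 2 * Y\<^sup>2 + R * X\<^sup>2" using R(3) by (intro add_left_mono mult_right_mono) auto
    finally have "\<epsilon> * (P * (X * Y) + Q * X\<^sup>2) \<le> \<epsilon> * (C0 / 2 * Y\<^sup>2 + R * X\<^sup>2)"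
      using e by (intro mult_left_mono) auto
    also have "\<dots> = \<epsilon> * C0 / 2 * Y\<^sup>2 + C0 / 2 * X\<^sup>2" using e(2) by (simp add: algebra_simps)
    finally have 2: "\<epsilon> * (P * (X * Y) + Q * X\<^sup>2) \<le> \<epsilon> * C0 / 2 * Y\<^sup>2 + C0 / 2 * X\<^sup>2" .
    have "\<delta> * X\<^sup>2 \<le> C0 / 2 * X\<^sup>2" "\<delta> * Y\<^sup>2 \<le> \<epsilon> * C0 / 2 * Y\<^sup>2"
      using d by (intro mult_right_mono; simp)+
    with 2 show ?thesis by (simp add: algebra_simps)
  qed
  with 1 e d show ?thesis by blast
qed

text \<open>This class is closed under differences and forward time shifts, so it contains the
  increments u(t + h) - u(t).\<close>

definition homogeneous_solution ::
  "'v set \<Rightarrow> ('v \<times> 'v) set \<Rightarrow> ('v \<times> 'v \<Rightarrow> real) \<Rightarrow> 'v netfun \<Rightarrow> 'v netfun \<Rightarrow> 'v netfun \<Rightarrow>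
   (real \<Rightarrow> 'v netfun) \<Rightarrow> (real \<Rightarrow> 'v netfun) \<Rightarrow> (real \<Rightarrow> 'v netfun) \<Rightarrow> (real \<Rightarrow> 'v netfun) \<Rightarrow> bool" where
  "homogeneous_solution V E l a b c u u' p p' \<longleftrightarrow>
     (\<forall>t\<ge>0. u t \<in> H_div V E l \<and> p t \<in> H1_0 V E l \<and> u' t \<in> L2_net E l \<and> p' t \<in> L2_net E l \<and>
        L2_deriv E l u (u' t) t \<and> L2_deriv E l p (p' t) t) \<and>
     (\<forall>t>0. AE_net E l (\<lambda>e x. c e x * u' t e x + dx l (p t) e x + a e x * u t e x = 0) \<and>
            AE_net E l (\<lambda>e x. b e x * p' t e x + dx l (u t) e x = 0))"

context network
begin

text \<open>The map from g to the flux v is linear and bounded; the a priori bound is applied to the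
  error of the difference quotient.\<close>

lemma stationary_solution_L2_deriv:
  assumes bd: "boundary_vertices V E \<noteq> {}" and a: "bounded_weight E l C0 C1 a"
    and s: "\<And>t. 0 \<le> t \<Longrightarrow> stationary_solution V E l a (\<lambda>_ _. 0) (g t) (v t) (q t)"
    and s': "stationary_solution V E l a (\<lambda>_ _. 0) g' v' q'"
    and g: "\<And>t. 0 \<le> t \<Longrightarrow> g t \<in> L2_net E l" "g' \<in> L2_net E l"
    and t: "0 \<le> t" and d: "L2_deriv E l g g' t"
  shows "L2_deriv E l v v' t"
proof -
  obtain K where K: "\<And>g v q. g \<in> L2_net E l \<Longrightarrow> stationary_solution V E l a (\<lambda>_ _. 0) g v q \<Longrightarrow>
    L2_norm E l v \<le> K * L2_norm E l g" using stationary_solution_bound[OF bd a] by blast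
  show ?thesis
    unfolding L2_deriv_def
  proof (rule Lim_null_comparison)
    show "((\<lambda>s. K * L2_norm E l (\<lambda>e x. (g s e x - g t e x) / (s - t) - g' e x)) \<longlongrightarrow> 0) (at t within {0..})"
      using tendsto_mult_right_zero[OF d[unfolded L2_deriv_def]] .
    show "\<forall>\<^sub>F r in at t within {0..}. norm (L2_norm E l (\<lambda>e x. (v r e x - v t e x) / (r - t) - v' e x))
      \<le> K * L2_norm E l (\<lambda>e x. (g r e x - g t e x) / (r - t) - g' e x)"
    proof (rule eventually_at_within_nonneg)
      fix r :: real assume r: "0 \<le> r"
      \<comment> \<open>The sign fits the shape w + k z of \<open>stationary_solution_comb\<close>;
        the combination is the negative of the error.\<close>
      define k where "k = - (1 / (r - t))"
      have m: "(\<lambda>e x. z' e x + k * (z e x + (- 1) * y e x)) = (\<lambda>e x. - ((z e x - y e x) / (r - t) - z' e x))"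
        for z y z' :: "'v netfun"
        by (simp add: k_def fun_eq_iff)
      have "stationary_solution V E l a (\<lambda>_ _. 0)
        (\<lambda>e x. g' e x + k * (g r e x + (- 1) * g t e x))
        (\<lambda>e x. v' e x + k * (v r e x + (- 1) * v t e x)) (\<lambda>e x. q' e x + k * (q r e x + (- 1) * q t e x))"
        using stationary_solution_comb[OF s' stationary_solution_comb[OF s[OF r] s[OF t], of "- 1"], of k] by simp
      from K[OF L2_net_comb[OF g(2) L2_net_comb[OF g(1)[OF r] g(1)[OF t]]] this] have "L2_norm E l (\<lambda>e x. - ((v r e x - v t e x) / (r - t) - v' e x))
        \<le> K * L2_norm E l (\<lambda>e x. - ((g r e x - g t e x) / (r - t) - g' e x))"
        unfolding m .
      then show "norm (L2_norm E l (\<lambda>e x. (v r e x - v t e x) / (r - t) - v' e x))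
        \<le> K * L2_norm E l (\<lambda>e x. (g r e x - g t e x) / (r - t) - g' e x)"
        unfolding L2_norm_minus by (simp add: L2_norm_nonneg)
    qed
  qed
qed

text \<open>Differentiating \<open>(c u, v)\<close> produces \<open>(p, \<partial>\<^sub>x v) = (b p, p)\<close>, the missing dissipation. The
  time derivative \<open>v'\<close> satisfies \<open>\<partial>\<^sub>x (v' + u) = 0\<close> and is thus bounded by \<open>u\<close> in \<open>L\<^sup>2\<close>,
  although \<open>\<partial>\<^sub>t p\<close> is not.\<close>

lemma homogeneous_decay:
  assumes bd: "boundary_vertices V E \<noteq> {}" and a: "bounded_weight E l C0 C1 a"
    and b: "bounded_weight E l C0 C1 b" and c: "bounded_weight E l C0 C1 c"
  shows "\<exists>C>0. \<exists>\<gamma>>0. \<forall>u u' p p'. homogeneous_solution V E l a b c u u' p p' \<longrightarrow>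
    (\<forall>s t. 0 \<le> s \<and> s \<le> t \<longrightarrow> (L2_norm E l (u t))\<^sup>2 + (L2_norm E l (p t))\<^sup>2
       \<le> C * exp (- \<gamma> * (t - s)) * ((L2_norm E l (u s))\<^sup>2 + (L2_norm E l (p s))\<^sup>2))"
proof -
  have C: "0 < C0" "0 < C1" using a by (auto simp: bounded_weight_def)
  obtain K where K0: "K \<ge> 0" and K: "\<And>g v q. g \<in> L2_net E l \<Longrightarrow> stationary_solution V E l a (\<lambda>_ _. 0) g v q \<Longrightarrow>
    L2_norm E l v \<le> K * L2_norm E l g" using stationary_solution_bound[OF bd a] by blast
  \<comment> \<open>P serves for (a u, v) and (c u, v): C1 from the weight, K C1 from the bound of v
    by p. Q serves for (c u, v'), where v' is bounded by C1 / C0 times u.\<close>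
  define P Q where "P = C1 * (K * C1)" and "Q = C1 * (C1 / C0)"
  have PQ: "0 \<le> P" "0 \<le> Q" using C K0 by (auto simp: P_def Q_def)
  obtain \<epsilon> \<delta> where e: "0 < \<epsilon>" "0 < \<delta>" "\<epsilon> * P \<le> C0 / 2" and
    diss: "\<And>X Y. - C0 * X\<^sup>2 - \<epsilon> * (C0 * Y\<^sup>2 - P * (X * Y) - Q * X\<^sup>2) \<le> - \<delta> * (X\<^sup>2 + Y\<^sup>2)"
    using dissipation_constants[OF C(1) PQ] by blast
  \<comment> \<open>C1 / 2 bounds the plain energy and C0 / 4 the correction; the rate is the
    dissipation \<delta> divided by this bound.\<close>
  define B where "B = C1 / 2 + C0 / 4"
  have B: "0 < B" using C by (simp add: B_def)
  define \<gamma> where "\<gamma> = \<delta> / B"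
  have g: "0 < \<gamma>" using e B by (simp add: \<gamma>_def)
  let ?ip = "inner_net E l" and ?n = "L2_norm E l"
  have "(?n (u t))\<^sup>2 + (?n (p t))\<^sup>2 \<le> (4 * B / C0) * exp (- \<gamma> * (t - s)) * ((?n (u s))\<^sup>2 + (?n (p s))\<^sup>2)"
    if hom: "homogeneous_solution V E l a b c u u' p p'" and st: "0 \<le> s" "s \<le> t" for u u' p p' s t
  proof -
    from hom have H: "u t \<in> H_div V E l" "p t \<in> H1_0 V E l" "u' t \<in> L2_net E l" "p' t \<in> L2_net E l"
      "L2_deriv E l u (u' t) t" "L2_deriv E l p (p' t) t" if "0 \<le> t" for t
      using that unfolding homogeneous_solution_def by blast+
    from hom have eq: "AE_net E l (\<lambda>e x. c e x * u' t e x + dx l (p t) e x + a e x * u t e x = 0)"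
      "AE_net E l (\<lambda>e x. b e x * p' t e x + dx l (u t) e x = 0)" if "0 < t" for t
      using that unfolding homogeneous_solution_def by blast+
    have uL: "u t \<in> L2_net E l" and pL: "p t \<in> L2_net E l"
      and duL: "dx l (u t) \<in> L2_net E l" and dpL: "dx l (p t) \<in> L2_net E l" if "0 \<le> t" for t
      by (intro H1_net_L2 dx_L2 H_div_H1 H1_0_H1 H that)+
    \<comment> \<open>The flux is chosen at each time separately; its differentiability in time
      follows from linearity and the a priori bound.\<close>
    have "\<forall>t. \<exists>v q. 0 \<le> t \<longrightarrow> stationary_solution V E l a (\<lambda>_ _. 0) (\<lambda>e x. b e x * p t e x) v q"
      using stationary_solution_ex[OF bd a L2_net_const bounded_weight_L2[OF b pL]] by blast
    then obtain v q where vq: "\<And>t. 0 \<le> t \<Longrightarrow> stationary_solution V E l a (\<lambda>_ _. 0) (\<lambda>e x. b e x * p t e x) (v t) (q t)"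
      by metis
    have "\<forall>t. \<exists>v q. 0 \<le> t \<longrightarrow> stationary_solution V E l a (\<lambda>_ _. 0) (\<lambda>e x. b e x * p' t e x) v q"
      using stationary_solution_ex[OF bd a L2_net_const bounded_weight_L2[OF b H(4)]] by blast
    then obtain v' q' where v'q': "\<And>t. 0 \<le> t \<Longrightarrow> stationary_solution V E l a (\<lambda>_ _. 0) (\<lambda>e x. b e x * p' t e x) (v' t) (q' t)"
      by metis
    note D = stationary_solutionD[OF vq] and D' = stationary_solutionD[OF v'q']
    have dv: "L2_deriv E l v (v' t) t" if t: "0 \<le> t" for t
      by (rule stationary_solution_L2_deriv[OF bd a vq v'q'[OF t] bounded_weight_L2[OF b pL]
            bounded_weight_L2[OF b H(4)[OF t]] t L2_deriv_weight[OF b pL H(4)[OF t] t H(6)[OF t]]])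
    have v_bound: "?n (v t) \<le> K * C1 * ?n (p t)" if "0 \<le> t" for t
      using order_trans[OF K[OF bounded_weight_L2[OF b pL] vq] mult_left_mono[OF bounded_weight_norm[OF b pL] K0]] that
      by (simp add: mult.assoc)
    have v'_bound: "?n (v' t) \<le> C1 / C0 * ?n (u t)" if t: "0 < t" for t
    proof (cases "?n (v' t) = 0")
      case True
      then show ?thesis using C by (simp add: L2_norm_nonneg)
    next
      case False
      then have pos: "?n (v' t) > 0" using L2_norm_nonneg[of E l "v' t"] by simp
      have t0: "0 \<le> t" using t by simp
      \<comment> \<open>Since dx v' = b p' = - dx u, this field has dx z = 0. Testing with it gives
        (a v', v') = - (a v', u).\<close>
      define z where "z = (\<lambda>e x. v' t e x + 1 * u t e x)"
      have z: "z \<in> H_div V E l" unfolding z_def by (intro H_div_comb D'(1) H(1) t0)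
      have "AE_net E l (\<lambda>e x. dx l z e x = 0)"
        using AE_net_conj[OF H1_net_comb(2)[OF H_div_H1[OF D'(1)[OF t0]] H_div_H1[OF H(1)[OF t0]], where k = 1]
            AE_net_conj[OF D'(4)[OF t0] eq(2)[OF t]]]
        unfolding z_def by (rule AE_net_mono) auto
      then have "?ip (dx l z) (q' t) = ?ip (\<lambda>_ _. 0) (q' t)"
        by (intro inner_net_cong dx_L2 H_div_H1 z L2_net_const D'(6) t0)
      then have "?ip (q' t) (dx l z) = 0"
        unfolding inner_net_commute[of E l "q' t"] by (simp add: inner_net_def)
      then have "?ip (\<lambda>e x. a e x * v' t e x) z = 0"
        using stationary_solution_test[OF a v'q'[OF t0] z] by simp
      then have "?ip (\<lambda>e x. a e x * v' t e x) (v' t) = - ?ip (\<lambda>e x. a e x * v' t e x) (u t)"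
        using inner_net_comb_right[OF D'(5)[OF t0] uL[OF t0] bounded_weight_L2[OF a D'(5)[OF t0]], of 1]
        unfolding z_def by simp
      also have "\<dots> \<le> C1 * ?n (v' t) * ?n (u t)"
        using bounded_weight_Cauchy_Schwarz[OF a D'(5)[OF t0] uL[OF t0]] by simp
      finally have "C0 * (?n (v' t))\<^sup>2 \<le> C1 * ?n (v' t) * ?n (u t)"
        using bounded_weight_lower[OF a D'(5)[OF t0]] by (simp add: L2_norm_power2)
      then have "(C0 * ?n (v' t)) * ?n (v' t) \<le> (C1 * ?n (u t)) * ?n (v' t)"
        by (simp add: power2_eq_square mult_ac)
      then have "C0 * ?n (v' t) \<le> C1 * ?n (u t)" using pos by simp
      then show ?thesis using C by (simp add: field_simps)
    qed
    define F where "F t = ?ip (\<lambda>e x. c e x * u t e x) (u t) / 2 + ?ip (\<lambda>e x. b e x * p t e x) (p t) / 2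
      - \<epsilon> * ?ip (\<lambda>e x. c e x * u t e x) (v t)" for t
    define F' where "F' t = ?ip (\<lambda>e x. c e x * u' t e x) (u t) + ?ip (\<lambda>e x. b e x * p' t e x) (p t)
      - \<epsilon> * (?ip (\<lambda>e x. c e x * u' t e x) (v t) + ?ip (\<lambda>e x. c e x * u t e x) (v' t))" for t
    \<comment> \<open>Weights act symmetrically, so the two terms of the product rule agree and
      absorb the factor 1 / 2 in F.\<close>
    have sym: "?ip (\<lambda>e x. m e x * w e x) z = ?ip (\<lambda>e x. m e x * z e x) w" for m w z
      by (simp add: inner_net_def mult_ac)
    have dF: "(F has_real_derivative F' t) (at t within {0..})" if t: "0 \<le> t" for t
    proof -
      note cu = L2_deriv_weight[OF c uL H(3)[OF t] t H(5)[OF t]]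
      note bp = L2_deriv_weight[OF b pL H(4)[OF t] t H(6)[OF t]]
      note cuL = bounded_weight_L2[OF c uL] bounded_weight_L2[OF c H(3)[OF t]]
      note bpL = bounded_weight_L2[OF b pL] bounded_weight_L2[OF b H(4)[OF t]]
      note 1 = L2_deriv_inner[OF cuL(1) uL cuL(2) H(3)[OF t] t cu H(5)[OF t]]
      note 2 = L2_deriv_inner[OF bpL(1) pL bpL(2) H(4)[OF t] t bp H(6)[OF t]]
      note 3 = L2_deriv_inner[OF cuL(1) D(5) cuL(2) D'(5)[OF t] t cu dv[OF t]]
      show ?thesis unfolding F_def[abs_def]
        by (rule DERIV_cong[OF DERIV_diff[OF DERIV_add[OF DERIV_cdivide[OF 1] DERIV_cdivide[OF 2]] DERIV_cmult[OF 3]]])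
           (simp_all add: F'_def sym[of c "u t" "u' t"] sym[of b "p t" "p' t"])
    qed
    have F_lower: "C0 / 4 * ((?n (u t))\<^sup>2 + (?n (p t))\<^sup>2) \<le> F t"
      and F_upper: "F t \<le> B * ((?n (u t))\<^sup>2 + (?n (p t))\<^sup>2)" if t: "0 \<le> t" for t
    proof -
      let ?X = "?n (u t)" and ?Y = "?n (p t)"
      have "\<bar>?ip (\<lambda>e x. c e x * u t e x) (v t)\<bar> \<le> C1 * ?X * ?n (v t)"
        by (rule bounded_weight_Cauchy_Schwarz[OF c uL[OF t] D(5)[OF t]])
      also have "\<dots> \<le> C1 * ?X * (K * C1 * ?Y)"
        using C by (intro mult_left_mono v_bound t mult_nonneg_nonneg L2_norm_nonneg) auto
      also have "\<dots> = P * (?X * ?Y)" by (simp add: P_def)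
      also have "\<dots> \<le> P * ((?X\<^sup>2 + ?Y\<^sup>2) / 2)"
        using sum_squares_bound[of ?X ?Y] PQ by (intro mult_left_mono) auto
      finally have "\<epsilon> * \<bar>?ip (\<lambda>e x. c e x * u t e x) (v t)\<bar> \<le> \<epsilon> * (P * ((?X\<^sup>2 + ?Y\<^sup>2) / 2))"
        using e by (intro mult_left_mono) auto
      also have "\<dots> \<le> C0 / 2 * ((?X\<^sup>2 + ?Y\<^sup>2) / 2)"
        unfolding mult.assoc[symmetric] using e(3) by (intro divide_right_mono mult_right_mono) auto
      \<comment> \<open>Half of the coercivity constant C0 / 2 of the plain energy; the other half
        survives as the lower bound of F.\<close>
      finally have *: "\<bar>\<epsilon> * ?ip (\<lambda>e x. c e x * u t e x) (v t)\<bar> \<le> C0 / 4 * (?X\<^sup>2 + ?Y\<^sup>2)"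
        using e by (simp add: abs_mult)
      have "C0 * ?X\<^sup>2 \<le> ?ip (\<lambda>e x. c e x * u t e x) (u t)" "C0 * ?Y\<^sup>2 \<le> ?ip (\<lambda>e x. b e x * p t e x) (p t)"
        unfolding L2_norm_power2 by (rule bounded_weight_lower[OF c uL[OF t]] bounded_weight_lower[OF b pL[OF t]])+
      then show "C0 / 4 * (?X\<^sup>2 + ?Y\<^sup>2) \<le> F t"
        using * unfolding F_def distrib_left by linarith
      have "?ip (\<lambda>e x. c e x * u t e x) (u t) \<le> C1 * ?X\<^sup>2" "?ip (\<lambda>e x. b e x * p t e x) (p t) \<le> C1 * ?Y\<^sup>2"
        using bounded_weight_Cauchy_Schwarz[OF c uL[OF t] uL[OF t]] bounded_weight_Cauchy_Schwarz[OF b pL[OF t] pL[OF t]]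
        by (simp_all add: power2_eq_square mult.assoc)
      then show "F t \<le> B * (?X\<^sup>2 + ?Y\<^sup>2)"
        using * unfolding F_def B_def distrib_left distrib_right by linarith
    qed
    have F'_le: "F' t \<le> - \<gamma> * F t" if t: "0 < t" for t
    proof -
      let ?X = "?n (u t)" and ?Y = "?n (p t)"
      have t0: "0 \<le> t" using t by simp
      have cu: "?ip (\<lambda>e x. c e x * u' t e x) z = - ?ip (dx l (p t)) z - ?ip (\<lambda>e x. a e x * u t e x) z"
        if z: "z \<in> L2_net E l" for z
      proof -
        note L = L2_net_cmult[OF dpL[OF t0], of "- 1"] bounded_weight_L2[OF a uL[OF t0]]
        have "?ip (\<lambda>e x. c e x * u' t e x) z = ?ip (\<lambda>e x. (- 1) * dx l (p t) e x + (- 1) * (a e x * u t e x)) z"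
          by (intro inner_net_cong bounded_weight_L2[OF c] H(3) t0 L2_net_comb L z AE_net_mono[OF eq(1)[OF t]]) auto
        then show ?thesis
          using inner_net_comb_left[OF L z, of "- 1"] inner_net_cmult_left[OF dpL[OF t0] z, of "- 1"] by simp
      qed
      have bp: "?ip (\<lambda>e x. b e x * p' t e x) (p t) = - ?ip (dx l (u t)) (p t)"
      proof -
        have "?ip (\<lambda>e x. b e x * p' t e x) (p t) = ?ip (\<lambda>e x. (- 1) * dx l (u t) e x) (p t)"
          by (intro inner_net_cong bounded_weight_L2[OF b] H(4) t0 L2_net_cmult duL pL AE_net_mono[OF eq(2)[OF t]]) auto
        then show ?thesis
          using inner_net_cmult_left[OF duL[OF t0] pL[OF t0], of "- 1"] by simp
      qed
      \<comment> \<open>The energy identity: the terms with dx cancel by integration by parts, and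
        only the friction remains.\<close>
      have "?ip (\<lambda>e x. c e x * u' t e x) (u t) + ?ip (\<lambda>e x. b e x * p' t e x) (p t) = - ?ip (\<lambda>e x. a e x * u t e x) (u t)"
        using cu[OF uL[OF t0]] bp inner_net_by_parts[OF H(1)[OF t0] H(2)[OF t0]]
          inner_net_commute[of E l "u t" "dx l (p t)"] by simp
      moreover have "- ?ip (dx l (p t)) (v t) = ?ip (\<lambda>e x. b e x * p t e x) (p t)"
        using inner_net_by_parts[OF D(1)[OF t0] H(2)[OF t0]] inner_net_commute[of E l "v t" "dx l (p t)"]
          inner_net_cong[OF D(7)[OF t0] bounded_weight_L2[OF b pL[OF t0]] pL[OF t0] D(4)[OF t0]] by simp
      ultimately have F': "F' t = - ?ip (\<lambda>e x. a e x * u t e x) (u t)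
        - \<epsilon> * (?ip (\<lambda>e x. b e x * p t e x) (p t) - ?ip (\<lambda>e x. a e x * u t e x) (v t) + ?ip (\<lambda>e x. c e x * u t e x) (v' t))"
        using cu[OF D(5)[OF t0]] unfolding F'_def by simp
      have 1: "C0 * ?X\<^sup>2 \<le> ?ip (\<lambda>e x. a e x * u t e x) (u t)" "C0 * ?Y\<^sup>2 \<le> ?ip (\<lambda>e x. b e x * p t e x) (p t)"
        unfolding L2_norm_power2 by (rule bounded_weight_lower[OF a uL[OF t0]] bounded_weight_lower[OF b pL[OF t0]])+
      have "\<bar>?ip (\<lambda>e x. a e x * u t e x) (v t)\<bar> \<le> C1 * ?X * (K * C1 * ?Y)"
        using C by (intro order_trans[OF bounded_weight_Cauchy_Schwarz[OF a uL[OF t0] D(5)[OF t0]]]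
            mult_left_mono v_bound t0 mult_nonneg_nonneg L2_norm_nonneg) auto
      then have 2: "\<bar>?ip (\<lambda>e x. a e x * u t e x) (v t)\<bar> \<le> P * (?X * ?Y)" by (simp add: P_def mult_ac)
      have "\<bar>?ip (\<lambda>e x. c e x * u t e x) (v' t)\<bar> \<le> C1 * ?X * (C1 / C0 * ?X)"
        using C by (intro order_trans[OF bounded_weight_Cauchy_Schwarz[OF c uL[OF t0] D'(5)[OF t0]]]
            mult_left_mono v'_bound t mult_nonneg_nonneg L2_norm_nonneg) auto
      then have 3: "\<bar>?ip (\<lambda>e x. c e x * u t e x) (v' t)\<bar> \<le> Q * ?X\<^sup>2" by (simp add: Q_def power2_eq_square mult_ac)
      have "C0 * ?Y\<^sup>2 - P * (?X * ?Y) - Q * ?X\<^sup>2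
        \<le> ?ip (\<lambda>e x. b e x * p t e x) (p t) - ?ip (\<lambda>e x. a e x * u t e x) (v t) + ?ip (\<lambda>e x. c e x * u t e x) (v' t)"
        using 1(2) 2 3 by linarith
      from mult_left_mono[OF this, of \<epsilon>]
      have "F' t \<le> - C0 * ?X\<^sup>2 - \<epsilon> * (C0 * ?Y\<^sup>2 - P * (?X * ?Y) - Q * ?X\<^sup>2)"
        using 1(1) e(1) unfolding F' by linarith
      also have "\<dots> \<le> - \<delta> * (?X\<^sup>2 + ?Y\<^sup>2)" by (rule diss)
      also have "\<dots> \<le> - \<gamma> * F t"
        using mult_left_mono[OF F_upper[OF t0], of \<gamma>] g B by (simp add: \<gamma>_def)
      finally show ?thesis .
    qed
    have "F t \<le> exp (- \<gamma> * (t - s)) * F s"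
    proof (rule Gronwall_decay[OF _ _ F'_le st])
      show "continuous_on {0..} F" by (rule DERIV_continuous_on) (use dF in auto)
      show "(F has_real_derivative F' t) (at t)" if "0 < t" for t
        using dF[of t] that at_within_interior[of t "{0..}"] by simp
    qed
    also have "\<dots> \<le> exp (- \<gamma> * (t - s)) * (B * ((?n (u s))\<^sup>2 + (?n (p s))\<^sup>2))"
      by (intro mult_left_mono F_upper st) auto
    finally have "C0 / 4 * ((?n (u t))\<^sup>2 + (?n (p t))\<^sup>2) \<le> exp (- \<gamma> * (t - s)) * (B * ((?n (u s))\<^sup>2 + (?n (p s))\<^sup>2))"
      using F_lower[of t] st by linarith
    then show ?thesis using C by (simp add: field_simps)
  qed
  moreover have "4 * B / C0 > 0" using B C by simp
  ultimately show ?thesis using g by blast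
qed

section \<open>From homogeneous to classical solutions and their time derivatives\<close>

lemma homogeneous_solutionD:
  assumes "homogeneous_solution V E l a b c u u' p p'"
  shows "0 \<le> t \<Longrightarrow> u t \<in> H_div V E l" "0 \<le> t \<Longrightarrow> p t \<in> H1_0 V E l"
    "0 \<le> t \<Longrightarrow> u' t \<in> L2_net E l" "0 \<le> t \<Longrightarrow> p' t \<in> L2_net E l"
    "0 \<le> t \<Longrightarrow> L2_deriv E l u (u' t) t" "0 \<le> t \<Longrightarrow> L2_deriv E l p (p' t) t"
    "0 < t \<Longrightarrow> AE_net E l (\<lambda>e x. c e x * u' t e x + dx l (p t) e x + a e x * u t e x = 0)"
    "0 < t \<Longrightarrow> AE_net E l (\<lambda>e x. b e x * p' t e x + dx l (u t) e x = 0)"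
  using assms unfolding homogeneous_solution_def by blast+

lemma homogeneous_solution_diff:
  assumes h: "homogeneous_solution V E l a b c u u' p p'" "homogeneous_solution V E l a b c U U' P P'"
  shows "homogeneous_solution V E l a b c
    (\<lambda>t e x. u t e x + (- 1) * U t e x) (\<lambda>t e x. u' t e x + (- 1) * U' t e x)
    (\<lambda>t e x. p t e x + (- 1) * P t e x) (\<lambda>t e x. p' t e x + (- 1) * P' t e x)"
proof -
  note A = homogeneous_solutionD[OF h(1)] and B = homogeneous_solutionD[OF h(2)]
  note L = H1_net_L2[OF H_div_H1[OF A(1)]] H1_net_L2[OF H_div_H1[OF B(1)]]
    H1_net_L2[OF H1_0_H1[OF A(2)]] H1_net_L2[OF H1_0_H1[OF B(2)]]
  show ?thesis
    unfolding homogeneous_solution_def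
  proof (intro conjI allI impI)
    fix t :: real assume t: "0 \<le> t"
    show "L2_deriv E l (\<lambda>t e x. u t e x + (- 1) * U t e x) (\<lambda>e x. u' t e x + (- 1) * U' t e x) t"
      by (rule L2_deriv_comb[OF L(1,2) A(3)[OF t] B(3)[OF t] t A(5)[OF t] B(5)[OF t]])
    show "L2_deriv E l (\<lambda>t e x. p t e x + (- 1) * P t e x) (\<lambda>e x. p' t e x + (- 1) * P' t e x) t"
      by (rule L2_deriv_comb[OF L(3,4) A(4)[OF t] B(4)[OF t] t A(6)[OF t] B(6)[OF t]])
    show "(\<lambda>e x. u t e x + (- 1) * U t e x) \<in> H_div V E l"
      by (rule H_div_comb[OF A(1)[OF t] B(1)[OF t]])
    show "(\<lambda>e x. p t e x + (- 1) * P t e x) \<in> H1_0 V E l"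
      by (rule H1_0_comb[OF A(2)[OF t] B(2)[OF t]])
    show "(\<lambda>e x. u' t e x + (- 1) * U' t e x) \<in> L2_net E l"
      by (rule L2_net_comb[OF A(3)[OF t] B(3)[OF t]])
    show "(\<lambda>e x. p' t e x + (- 1) * P' t e x) \<in> L2_net E l"
      by (rule L2_net_comb[OF A(4)[OF t] B(4)[OF t]])
  next
    fix t :: real assume t: "0 < t"
    then have t0: "0 \<le> t" by simp
    note du = H1_net_comb(2)[OF H_div_H1[OF A(1)[OF t0]] H_div_H1[OF B(1)[OF t0]], where k = "- 1"]
    note dp = H1_net_comb(2)[OF H1_0_H1[OF A(2)[OF t0]] H1_0_H1[OF B(2)[OF t0]], where k = "- 1"]
    show "AE_net E l (\<lambda>e x. c e x * (u' t e x + (- 1) * U' t e x)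
        + dx l (\<lambda>e x. p t e x + (- 1) * P t e x) e x + a e x * (u t e x + (- 1) * U t e x) = 0)"
      by (rule AE_net_mono[OF AE_net_conj[OF dp AE_net_conj[OF A(7)[OF t] B(7)[OF t]]]], elim conjE)
         (simp only: distrib_left; linarith)
    show "AE_net E l (\<lambda>e x. b e x * (p' t e x + (- 1) * P' t e x)
        + dx l (\<lambda>e x. u t e x + (- 1) * U t e x) e x = 0)"
      by (rule AE_net_mono[OF AE_net_conj[OF du AE_net_conj[OF A(8)[OF t] B(8)[OF t]]]], elim conjE)
         (simp only: distrib_left; linarith)
  qed
qed

lemma homogeneous_solution_shift:
  assumes h: "homogeneous_solution V E l a b c u u' p p'" and "0 \<le> h"
  shows "homogeneous_solution V E l a b c (\<lambda>t. u (t + h)) (\<lambda>t. u' (t + h)) (\<lambda>t. p (t + h)) (\<lambda>t. p' (t + h))"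
  unfolding homogeneous_solution_def
  by (intro conjI allI impI homogeneous_solutionD[OF h] L2_deriv_shift \<open>0 \<le> h\<close>) (use \<open>0 \<le> h\<close> in auto)

text \<open>The stationary pair drops out of all difference quotients, so the derivatives are still
  u' and p'; one reduction therefore serves both estimates.\<close>

lemma classical_solution_minus_stationary:
  assumes cs: "classical_solution V E l a b c f g u u' p p'"
    and ss: "stationary_solution V E l a f g us ps"
  shows "homogeneous_solution V E l a b c (\<lambda>t e x. u t e x + (- 1) * us e x) u'
    (\<lambda>t e x. p t e x + (- 1) * ps e x) p'"
proof -
  note D = stationary_solutionD[OF ss]
  have A: "u t \<in> H_div V E l" "p t \<in> H1_0 V E l" "u' t \<in> L2_net E l" "p' t \<in> L2_net E l"
    "L2_deriv E l u (u' t) t" "L2_deriv E l p (p' t) t" if "0 \<le> t" for t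
    using cs that unfolding classical_solution_def time_C1_def time_continuous_def L2_deriv_def by blast+
  have eq: "AE_net E l (\<lambda>e x. c e x * u' t e x + dx l (p t) e x + a e x * u t e x = f e x)"
    "AE_net E l (\<lambda>e x. b e x * p' t e x + dx l (u t) e x = g e x)" if "0 < t" for t
    using cs that unfolding classical_solution_def by blast+
  show ?thesis
    unfolding homogeneous_solution_def
  proof (intro conjI allI impI)
    fix t :: real assume t: "0 \<le> t"
    show "L2_deriv E l (\<lambda>t e x. u t e x + (- 1) * us e x) (u' t) t"
      "L2_deriv E l (\<lambda>t e x. p t e x + (- 1) * ps e x) (p' t) t"
      using A(5,6)[OF t] by (simp_all add: L2_deriv_def)
    show "(\<lambda>e x. u t e x + (- 1) * us e x) \<in> H_div V E l"
      by (rule H_div_comb[OF A(1)[OF t] D(1)])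
    show "(\<lambda>e x. p t e x + (- 1) * ps e x) \<in> H1_0 V E l"
      by (rule H1_0_comb[OF A(2)[OF t] D(2)])
    show "u' t \<in> L2_net E l" "p' t \<in> L2_net E l" by (rule A(3)[OF t] A(4)[OF t])+
  next
    fix t :: real assume t: "0 < t"
    then have t0: "0 \<le> t" by simp
    note du = H1_net_comb(2)[OF H_div_H1[OF A(1)[OF t0]] H_div_H1[OF D(1)], where k = "- 1"]
    note dp = H1_net_comb(2)[OF H1_0_H1[OF A(2)[OF t0]] H1_0_H1[OF D(2)], where k = "- 1"]
    show "AE_net E l (\<lambda>e x. c e x * u' t e x
        + dx l (\<lambda>e x. p t e x + (- 1) * ps e x) e x + a e x * (u t e x + (- 1) * us e x) = 0)"
      by (rule AE_net_mono[OF AE_net_conj[OF dp AE_net_conj[OF eq(1)[OF t] D(3)]]], elim conjE)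
         (simp only: distrib_left; linarith)
    show "AE_net E l (\<lambda>e x. b e x * p' t e x + dx l (\<lambda>e x. u t e x + (- 1) * us e x) e x = 0)"
      by (rule AE_net_mono[OF AE_net_conj[OF du AE_net_conj[OF eq(2)[OF t] D(4)]]], elim conjE)
         linarith
  qed
qed

text \<open>As \<open>u'\<close> and \<open>p'\<close> need not solve the system classically, their decay is inherited from
  the difference quotients.\<close>

lemma homogeneous_derivative_decay:
  assumes decay: "\<And>u u' p p' s t. homogeneous_solution V E l a b c u u' p p' \<Longrightarrow> 0 \<le> s \<Longrightarrow> s \<le> t \<Longrightarrow>
      (L2_norm E l (u t))\<^sup>2 + (L2_norm E l (p t))\<^sup>2
       \<le> C * exp (- \<gamma> * (t - s)) * ((L2_norm E l (u s))\<^sup>2 + (L2_norm E l (p s))\<^sup>2)"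
    and h: "homogeneous_solution V E l a b c u u' p p'" and st: "0 \<le> s" "s \<le> t"
  shows "(L2_norm E l (u' t))\<^sup>2 + (L2_norm E l (p' t))\<^sup>2
       \<le> C * exp (- \<gamma> * (t - s)) * ((L2_norm E l (u' s))\<^sup>2 + (L2_norm E l (p' s))\<^sup>2)"
proof -
  note H = homogeneous_solutionD[OF h]
  note uL = H1_net_L2[OF H_div_H1[OF H(1)]] and pL = H1_net_L2[OF H1_0_H1[OF H(2)]]
  \<comment> \<open>Squared norms of the increments over h, divided by h^2. For fixed h > 0 the
    decay estimate holds with constants independent of h, and so survives the limit.\<close>
  define q where "q h r = (L2_norm E l (\<lambda>e x. u (r + h) e x - u r e x))\<^sup>2 / h\<^sup>2
    + (L2_norm E l (\<lambda>e x. p (r + h) e x - p r e x))\<^sup>2 / h\<^sup>2" for h r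
  have lim: "((\<lambda>h. q h r) \<longlongrightarrow> (L2_norm E l (u' r))\<^sup>2 + (L2_norm E l (p' r))\<^sup>2) (at_right 0)"
    if r: "0 \<le> r" for r
    unfolding q_def
    by (intro tendsto_add L2_deriv_norm_tendsto[OF uL H(3)[OF r] r H(5)[OF r]]
        L2_deriv_norm_tendsto[OF pL H(4)[OF r] r H(6)[OF r]])
  have t: "0 \<le> t" using st by simp
  show ?thesis
  proof (rule tendsto_le[OF _ tendsto_mult_left[OF lim[OF st(1)]] lim[OF t]])
    show "\<forall>\<^sub>F h in at_right 0. q h t \<le> C * exp (- \<gamma> * (t - s)) * q h s"
      using eventually_at_right_less[of 0]
    proof eventually_elim
      case (elim d)
      then have "0 \<le> d" by simp
      note decay[OF homogeneous_solution_diff[OF homogeneous_solution_shift[OF h this] h] st]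
      from divide_right_mono[OF this, of "d\<^sup>2"] show ?case
        by (simp add: q_def add_divide_distrib distrib_left)
    qed
  qed simp
qed

end

theorem theorem3p5:
  fixes V :: "'v set" and E :: "('v \<times> 'v) set" and l :: "'v \<times> 'v \<Rightarrow> real"
    and a b c :: "'v netfun" and C0 C1 :: real
  assumes "network V E l"
    and "boundary_vertices V E \<noteq> {}"
    and "a \<in> L2_net E l" and "b \<in> L2_net E l" and "c \<in> L2_net E l"
    and "0 < C0" and "0 < C1"
    and "AE_net E l (\<lambda>e x. C0 \<le> a e x \<and> a e x \<le> C1)"
    and "AE_net E l (\<lambda>e x. C0 \<le> b e x \<and> b e x \<le> C1)"
    and "AE_net E l (\<lambda>e x. C0 \<le> c e x \<and> c e x \<le> C1)"
  shows "\<exists>C>0. \<exists>\<gamma>>0. \<forall>f \<in> L2_net E l. \<forall>g \<in> L2_net E l.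
    \<exists>us ps.
      stationary_solution V E l a f g us ps \<and>
      (\<forall>us2 ps2. stationary_solution V E l a f g us2 ps2 \<longrightarrow>
         AE_net E l (\<lambda>e x. us2 e x = us e x \<and> ps2 e x = ps e x)) \<and>
      (\<forall>u u' p p'. classical_solution V E l a b c f g u u' p p' \<longrightarrow>
         (\<forall>s t. 0 \<le> s \<and> s \<le> t \<longrightarrow>
            (L2_norm E l (\<lambda>e x. u t e x - us e x))\<^sup>2 + (L2_norm E l (\<lambda>e x. p t e x - ps e x))\<^sup>2
              \<le> C * exp (- \<gamma> * (t - s)) *
                ((L2_norm E l (\<lambda>e x. u s e x - us e x))\<^sup>2 + (L2_norm E l (\<lambda>e x. p s e x - ps e x))\<^sup>2) \<and>
            (L2_norm E l (u' t))\<^sup>2 + (L2_norm E l (p' t))\<^sup>2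
              \<le> C * exp (- \<gamma> * (t - s)) * ((L2_norm E l (u' s))\<^sup>2 + (L2_norm E l (p' s))\<^sup>2)))"
proof -
  interpret network V E l by fact
  note bd = assms(2)
  have a: "bounded_weight E l C0 C1 a" and b: "bounded_weight E l C0 C1 b" and c: "bounded_weight E l C0 C1 c"
    using assms by (simp_all add: bounded_weight_def)
  obtain C \<gamma> where C: "C > 0" "\<gamma> > 0" and decay: "\<And>u u' p p' s t. homogeneous_solution V E l a b c u u' p p' \<Longrightarrow>
      0 \<le> s \<Longrightarrow> s \<le> t \<Longrightarrow> (L2_norm E l (u t))\<^sup>2 + (L2_norm E l (p t))\<^sup>2
       \<le> C * exp (- \<gamma> * (t - s)) * ((L2_norm E l (u s))\<^sup>2 + (L2_norm E l (p s))\<^sup>2)"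
    using homogeneous_decay[OF bd a b c] by blast
  have est: "\<exists>us ps.
      stationary_solution V E l a f g us ps \<and>
      (\<forall>us2 ps2. stationary_solution V E l a f g us2 ps2 \<longrightarrow>
         AE_net E l (\<lambda>e x. us2 e x = us e x \<and> ps2 e x = ps e x)) \<and>
      (\<forall>u u' p p'. classical_solution V E l a b c f g u u' p p' \<longrightarrow>
         (\<forall>s t. 0 \<le> s \<and> s \<le> t \<longrightarrow>
            (L2_norm E l (\<lambda>e x. u t e x - us e x))\<^sup>2 + (L2_norm E l (\<lambda>e x. p t e x - ps e x))\<^sup>2
              \<le> C * exp (- \<gamma> * (t - s)) *
                ((L2_norm E l (\<lambda>e x. u s e x - us e x))\<^sup>2 + (L2_norm E l (\<lambda>e x. p s e x - ps e x))\<^sup>2) \<and>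
            (L2_norm E l (u' t))\<^sup>2 + (L2_norm E l (p' t))\<^sup>2
              \<le> C * exp (- \<gamma> * (t - s)) * ((L2_norm E l (u' s))\<^sup>2 + (L2_norm E l (p' s))\<^sup>2)))"
    if f: "f \<in> L2_net E l" and g: "g \<in> L2_net E l" for f g
  proof -
    obtain us ps where ss: "stationary_solution V E l a f g us ps"
      using stationary_solution_ex[OF bd a f g] by blast
    show ?thesis
    proof (rule exI[of _ us], rule exI[of _ ps], intro conjI allI impI)
      show "stationary_solution V E l a f g us ps" by (rule ss)
      show "AE_net E l (\<lambda>e x. us2 e x = us e x \<and> ps2 e x = ps e x)"
        if "stationary_solution V E l a f g us2 ps2" for us2 ps2
        by (rule stationary_solution_unique[OF bd a that ss])
      fix u u' p p' and s t :: real
      assume cs: "classical_solution V E l a b c f g u u' p p'" and "0 \<le> s \<and> s \<le> t"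
      then have st: "0 \<le> s" "s \<le> t" by auto
      note h = classical_solution_minus_stationary[OF cs ss]
      show "(L2_norm E l (\<lambda>e x. u t e x - us e x))\<^sup>2 + (L2_norm E l (\<lambda>e x. p t e x - ps e x))\<^sup>2
              \<le> C * exp (- \<gamma> * (t - s)) *
                ((L2_norm E l (\<lambda>e x. u s e x - us e x))\<^sup>2 + (L2_norm E l (\<lambda>e x. p s e x - ps e x))\<^sup>2)"
        using decay[OF h st] by simp
      show "(L2_norm E l (u' t))\<^sup>2 + (L2_norm E l (p' t))\<^sup>2
              \<le> C * exp (- \<gamma> * (t - s)) * ((L2_norm E l (u' s))\<^sup>2 + (L2_norm E l (p' s))\<^sup>2)"
        by (rule homogeneous_derivative_decay[OF decay h st])
    qed
  qed
  show ?thesis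
    by (rule exI[of _ C], rule conjI[OF C(1)], rule exI[of _ \<gamma>], rule conjI[OF C(2)]) (blast intro: est)
qed

end
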